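(* There is a computationally efficient mechanism $\mathbb{M}$ that is $(\alpha+2\psi,\beta)$-statistically-accurate for $k$ adaptively chosen queries given a sample (an $n$-tuple) from an underlying measure with Gibbs-dependency $\psi$, provided that $$n\ \ge\ \tilde{O}\left(\frac{\sqrt{k}}{\alpha^2}\log\frac1\beta\right).$$
   Context: $\mathcal{X}$ is a metric space (the data domain). For a probability measure $\mu$ over $\mathcal{X}^n$ let $$\psi(\mu)=\sup_{x\in\mathcal{X}^n}\ \mathbb{E}_{i\sim[n]}\left\|\mu_i(\cdot)-\mu_i(\cdot\mid x^{-i})\right\|_{TV},$$ where $\mu_i(\cdot)$ is the $i$-th marginal measure, $\mu_i(\cdot\mid x^{-i})$ is the $i$-th marginal measure conditioned on all the coordinates other than $i$ (given the $n$-tuple $x$), and $\|\cdot\|_{TV}$ is total variation distance. The measure $\mu$ has Gibbs-dependency $\psi$ (is $\psi$-Gibbs dependent) if $\psi(\mu)\le\psi$. Game between a mechanism $\mathbb{M}$ and an adversary $\mathbb{A}$: the adversary fixes a measure $\mu$ over $\mathcal{X}^n$ (here, one with Gibbs-dependency $\psi$). The mechanism obtains a sample $S\sim\mu$ containing $n$ (possibly correlated) observations. For $k$ rounds $j=1,\dots,k$, the adversary chooses a query $h_j:\mathcal{X}\to\{0,1\}$, possibly as a function of all previous answers given by the mechanism, and the mechanism obtains $h_j$ and responds with an answer $z_j\in\mathbb{R}$, which is given to $\mathbb{A}$. For $T\in\mathcal{X}^n$ write $h(T)=\frac1n\sum_{x\in T}h(x)$, and write $h(\mu)=\mathbb{E}_{T\sim\mu}[h(T)]$.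 The mechanism is $(\alpha',\beta)$-statistically-accurate if (for every adversary) with probability at least $1-\beta$, for every $j$ it holds that $|z_j-h_j(\mu)|\le\alpha'$. *)

theory Defs
  imports "HOL-Probability.Probability" "HOL-Library.Landau_Symbols"
begin

section \<open>Gibbs-dependency\<close>

text \<open>Coordinates of an \<open>n\<close>-tuple are indexed by \<open>{..<n}\<close>. The \<open>n\<close>-fold power of the domain
  carries the product of the Borel sigma-algebras (the Borel sigma-algebra of the product
  topology when the domain is separable).\<close>

abbreviation tuples :: "nat set \<Rightarrow> (nat \<Rightarrow> 'a::metric_space) measure" where
  "tuples I \<equiv> PiM I (\<lambda>_. borel)"

definition measure_on_tuples :: "nat \<Rightarrow> (nat \<Rightarrow> 'a::metric_space) measure \<Rightarrow> bool" where
  "measure_on_tuples n \<mu> \<longleftrightarrow> prob_space \<mu> \<and> sets \<mu> = sets (tuples {..<n})"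

definition tv_dist :: "'a measure \<Rightarrow> 'a measure \<Rightarrow> real" where
  "tv_dist P Q = (SUP A\<in>sets P. \<bar>measure P A - measure Q A\<bar>)"

definition marginal :: "(nat \<Rightarrow> 'a::metric_space) measure \<Rightarrow> nat \<Rightarrow> 'a measure" where
  "marginal \<mu> i = distr \<mu> borel (\<lambda>x. x i)"

definition drop_coord :: "nat \<Rightarrow> nat \<Rightarrow> (nat \<Rightarrow> 'a) \<Rightarrow> nat \<Rightarrow> 'a" where
  "drop_coord n i x = restrict x ({..<n} - {i})"

text \<open>\<open>\<kappa> i y\<close> is a (regular) version of the \<open>i\<close>-th marginal of \<open>\<mu>\<close> conditioned on the other
  coordinates being \<open>y\<close>.\<close>

definition conditional_marginals ::
    "nat \<Rightarrow> (nat \<Rightarrow> 'a::metric_space) measure \<Rightarrow> (nat \<Rightarrow> (nat \<Rightarrow> 'a) \<Rightarrow> 'a measure) \<Rightarrow> bool" where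
  "conditional_marginals n \<mu> \<kappa> \<longleftrightarrow>
     (\<forall>i<n. \<kappa> i \<in> tuples ({..<n} - {i}) \<rightarrow>\<^sub>M prob_algebra borel \<and>
       (\<forall>A\<in>sets borel. \<forall>B\<in>sets (tuples ({..<n} - {i})).
          emeasure \<mu> {x \<in> space \<mu>. x i \<in> A \<and> drop_coord n i x \<in> B} =
          (\<integral>\<^sup>+x. emeasure (\<kappa> i (drop_coord n i x)) A * indicator B (drop_coord n i x) \<partial>\<mu>)))"

text \<open>The real supremum is harmless: every total variation distance lies in \<open>[0, 1]\<close>.\<close>

definition gibbs_dependency ::
    "nat \<Rightarrow> (nat \<Rightarrow> 'a::metric_space) measure \<Rightarrow> (nat \<Rightarrow> (nat \<Rightarrow> 'a) \<Rightarrow> 'a measure) \<Rightarrow> real" where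
  "gibbs_dependency n \<mu> \<kappa> =
     (SUP x\<in>space (tuples {..<n}).
        (\<Sum>i<n. tv_dist (marginal \<mu> i) (\<kappa> i (drop_coord n i x))) / real n)"

text \<open>Conditional measures are only determined almost everywhere while the supremum ranges over
  all tuples; \<open>\<mu>\<close> is \<open>\<psi>\<close>-Gibbs dependent if the bound holds for some version.\<close>

definition gibbs_dependent :: "nat \<Rightarrow> real \<Rightarrow> (nat \<Rightarrow> 'a::metric_space) measure \<Rightarrow> bool" where
  "gibbs_dependent n \<psi> \<mu> \<longleftrightarrow>
     (\<exists>\<kappa>. conditional_marginals n \<mu> \<kappa> \<and> gibbs_dependency n \<mu> \<kappa> \<le> \<psi>)"


section \<open>Mechanisms, adversaries and statistical accuracy\<close>

type_synonym 'a query = "'a \<Rightarrow> bool"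

definition query_avg :: "nat \<Rightarrow> 'a query \<Rightarrow> (nat \<Rightarrow> 'a) \<Rightarrow> real" where
  "query_avg n h x = (\<Sum>i<n. of_bool (h (x i))) / real n"

definition query_mean :: "nat \<Rightarrow> (nat \<Rightarrow> 'a::metric_space) measure \<Rightarrow> 'a query \<Rightarrow> real" where
  "query_mean n \<mu> h = (\<integral>x. query_avg n h x \<partial>\<mu>)"

text \<open>The internal randomness of a mechanism is an infinite tape of independent uniform draws
  from \<open>[0, 1]\<close>.\<close>

type_synonym tape = "nat \<Rightarrow> real"

definition tape_space :: "tape measure" where
  "tape_space = PiM UNIV (\<lambda>_. uniform_measure lborel {0..1})"

text \<open>A mechanism maps its tape, its sample and the nonempty list of queries received so far
  (the current one last) to the answer to the current query. Its own earlier answers are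
  functions of the same data.\<close>

type_synonym 'a mechanism = "tape \<Rightarrow> (nat \<Rightarrow> 'a) \<Rightarrow> 'a query list \<Rightarrow> real"

text \<open>An adversary maps a private random seed and the previous answers to the next query.\<close>

type_synonym 'a adversary = "real \<Rightarrow> real list \<Rightarrow> 'a query"

definition measurable_adversary :: "'a::metric_space adversary \<Rightarrow> bool" where
  "measurable_adversary A \<longleftrightarrow>
     (\<forall>j. (\<lambda>(r, z, x). A r (map z [0..<j]) x)
        \<in> borel \<Otimes>\<^sub>M (PiM {..<j} (\<lambda>_. borel) \<Otimes>\<^sub>M borel) \<rightarrow>\<^sub>M count_space UNIV)"

primrec interaction ::
    "(real list \<Rightarrow> 'a query) \<Rightarrow> ('a query list \<Rightarrow> real) \<Rightarrow> nat \<Rightarrow> ('a query \<times> real) list" where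
  "interaction A M 0 = []"
| "interaction A M (Suc j) =
     (let t = interaction A M j; h = A (map snd t) in t @ [(h, M (map fst t @ [h]))])"

text \<open>\<open>\<rho>\<close> is the law of the adversary's seed. A nonmeasurable event would have measure 0, so
  nothing is gained by a mechanism whose accuracy event fails to be measurable.\<close>

definition statistically_accurate ::
    "nat \<Rightarrow> nat \<Rightarrow> real \<Rightarrow> real \<Rightarrow> real \<Rightarrow> 'a::metric_space mechanism \<Rightarrow> bool" where
  "statistically_accurate n k \<psi> \<alpha>' \<beta> M \<longleftrightarrow>
     (\<forall>\<mu> A \<rho>. measure_on_tuples n \<mu> \<longrightarrow> gibbs_dependent n \<psi> \<mu> \<longrightarrow>
        measurable_adversary A \<longrightarrow> prob_space \<rho> \<longrightarrow> sets \<rho> = sets borel \<longrightarrow>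
        measure (\<rho> \<Otimes>\<^sub>M (\<mu> \<Otimes>\<^sub>M tape_space))
          {(r, x, \<omega>) \<in> space (\<rho> \<Otimes>\<^sub>M (\<mu> \<Otimes>\<^sub>M tape_space)).
             \<forall>(h, z) \<in> set (interaction (A r) (M \<omega> x) k). \<bar>z - query_mean n \<mu> h\<bar> \<le> \<alpha>'}
        \<ge> 1 - \<beta>)"


section \<open>Computational efficiency\<close>

text \<open>Efficiency is polynomial running time on a randomized real random access machine. A sample
  point of the abstract domain is not a machine word: the machine accesses it by evaluating
  the current query on it, at unit cost. Every other instruction has unit cost as well.
  Register contents used as addresses or sample indices are rounded down to naturals.\<close>

datatype instr =
    Const nat int
  | Add nat nat nat | Sub nat nat nat | Mul nat nat nat | Div nat nat nat
  | Sqrt nat nat | Exp nat nat | Ln nat nat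
  | Load nat nat
  | Store nat nat
  | JumpLe nat nat nat
  | Draw nat
  | Eval nat nat
  | Answer nat

text \<open>Program counter, memory, number of random draws consumed.\<close>

type_synonym config = "nat \<times> (nat \<Rightarrow> real) \<times> nat"

definition addr :: "real \<Rightarrow> nat" where
  "addr r = nat \<lfloor>r\<rfloor>"

text \<open>The argument \<open>q\<close> gives the values of the current query on the sample points.\<close>

fun step :: "tape \<Rightarrow> (nat \<Rightarrow> bool) \<Rightarrow> instr \<Rightarrow> config \<Rightarrow> config" where
  "step \<omega> q (Const d c) (pc, m, t) = (pc + 1, m(d := of_int c), t)"
| "step \<omega> q (Add d a b) (pc, m, t) = (pc + 1, m(d := m a + m b), t)"
| "step \<omega> q (Sub d a b) (pc, m, t) = (pc + 1, m(d := m a - m b), t)"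
| "step \<omega> q (Mul d a b) (pc, m, t) = (pc + 1, m(d := m a * m b), t)"
| "step \<omega> q (Div d a b) (pc, m, t) = (pc + 1, m(d := m a / m b), t)"
| "step \<omega> q (Sqrt d a) (pc, m, t) = (pc + 1, m(d := sqrt (m a)), t)"
| "step \<omega> q (Exp d a) (pc, m, t) = (pc + 1, m(d := exp (m a)), t)"
| "step \<omega> q (Ln d a) (pc, m, t) = (pc + 1, m(d := ln (m a)), t)"
| "step \<omega> q (Load d a) (pc, m, t) = (pc + 1, m(d := m (addr (m a))), t)"
| "step \<omega> q (Store a b) (pc, m, t) = (pc + 1, m(addr (m a) := m b), t)"
| "step \<omega> q (JumpLe a b l) (pc, m, t) = (if m a \<le> m b then l else pc + 1, m, t)"
| "step \<omega> q (Draw d) (pc, m, t) = (pc + 1, m(d := \<omega> t), t + 1)"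
| "step \<omega> q (Eval d a) (pc, m, t) = (pc + 1, m(d := of_bool (q (addr (m a)))), t)"
| "step \<omega> q (Answer a) s = s"

text \<open>One round, with a bound on the number of steps; \<open>None\<close> if no answer is produced within the
  bound. The next round restarts at instruction 0 with the memory and the tape position
  left by this one.\<close>

fun run_round :: "instr list \<Rightarrow> tape \<Rightarrow> (nat \<Rightarrow> bool) \<Rightarrow> nat \<Rightarrow> config \<Rightarrow> (real \<times> config) option" where
  "run_round p \<omega> q 0 s = None"
| "run_round p \<omega> q (Suc b) (pc, m, t) =
     (if pc < length p then
        (case p ! pc of
           Answer a \<Rightarrow> Some (m a, (0, m, t))
         | i \<Rightarrow> run_round p \<omega> q b (step \<omega> q i (pc, m, t)))
      else None)"

fun run_rounds ::
    "instr list \<Rightarrow> tape \<Rightarrow> nat \<Rightarrow> (nat \<Rightarrow> 'a) \<Rightarrow> nat \<Rightarrow> 'a query list \<Rightarrow> config \<Rightarrow> real option" where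
  "run_rounds p \<omega> n x b [] s = None"
| "run_rounds p \<omega> n x b (h # hs) s =
     (case run_round p \<omega> (\<lambda>i. i < n \<and> h (x i)) b s of
        None \<Rightarrow> None
      | Some (z, s') \<Rightarrow> if hs = [] then Some z else run_rounds p \<omega> n x b hs s')"

definition init_config :: "nat \<Rightarrow> nat \<Rightarrow> real \<Rightarrow> real \<Rightarrow> config" where
  "init_config n k \<alpha> \<beta> = (0, (\<lambda>_. 0)(0 := real n, 1 := real k, 2 := \<alpha>, 3 := \<beta>), 0)"

text \<open>A mechanism, given for all parameters \<open>n\<close>, \<open>k\<close>, \<open>\<alpha>\<close>, \<open>\<beta>\<close>, is efficient if a single program
  computes all its answers, each in time polynomial in \<open>n\<close> and \<open>k\<close>.\<close>

definition computationally_efficient ::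
    "(nat \<Rightarrow> nat \<Rightarrow> real \<Rightarrow> real \<Rightarrow> 'a mechanism) \<Rightarrow> bool" where
  "computationally_efficient M \<longleftrightarrow>
     (\<exists>p c. \<forall>n k \<alpha> \<beta> \<omega> x hs.
        1 \<le> n \<longrightarrow> 1 \<le> k \<longrightarrow> 0 < \<alpha> \<longrightarrow> 0 < \<beta> \<longrightarrow> \<beta> < 1 \<longrightarrow> hs \<noteq> [] \<longrightarrow> length hs \<le> k \<longrightarrow>
        run_rounds p \<omega> n x (c * (n + k) ^ c) hs (init_config n k \<alpha> \<beta>) = Some (M n k \<alpha> \<beta> \<omega> x hs))"


section \<open>Soft-O\<close>

text \<open>\<open>g\<close> up to a factor polylogarithmic in \<open>g\<close> itself. The summand 2 keeps the logarithm
  positive.\<close>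

definition soft_bigo :: "'b filter \<Rightarrow> ('b \<Rightarrow> real) \<Rightarrow> ('b \<Rightarrow> real) set" where
  "soft_bigo F g = (\<Union>c::nat. O[F](\<lambda>x. g x * ln (2 + \<bar>g x\<bar>) ^ c))"

text \<open>The parameters \<open>(k, \<alpha>, \<beta>)\<close> over which the bound on \<open>n\<close> is uniform. The failure
  probability is kept away from 1, where \<open>ln (1 / \<beta>)\<close> vanishes.\<close>

definition parameter_regime :: "(nat \<times> real \<times> real) filter" where
  "parameter_regime = principal {(k, \<alpha>, \<beta>). 1 \<le> k \<and> 0 < \<alpha> \<and> \<alpha> < 1 \<and> 0 < \<beta> \<and> \<beta> \<le> 1 / 2}"

end

theory Submission
  imports Defs
begin

text \<open>The mechanism answers with the empirical mean plus \<open>k powr (1 / 4) / n\<close> times a sum of \<open>n\<close>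
  independent logistic variables. Summing \<open>n\<close> draws makes the tail of the noise Gaussian down to
  probability \<open>exp (- n)\<close>, while each draw keeps a bounded likelihood ratio under shifts; a single
  Laplace or logistic draw would cost a factor \<open>sqrt (ln (1 / \<beta>))\<close> in the sample size.

  Replacing one sample point moves each of the \<open>k n\<close> draws by at most \<open>1 / (k powr (1 / 4) n)\<close>, so
  the transcript is \<open>(\<epsilon>, \<delta>)\<close>-differentially private with \<open>\<epsilon>\<close> of order
  \<open>sqrt (sqrt k / n * ln (1 / \<delta>))\<close>, by a moment bound for the likelihood ratio.

  Let \<open>E\<close> be the event, on transcripts, that the \<open>j\<close>-th answer exceeds the true mean of its query \<open>h\<close>
  by \<open>\<alpha> + \<psi>\<close>. Privacy allows the \<open>i\<close>-th sample point to be removed before the transcript is drawn;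
  given the other points it then has its conditional law, on which \<open>h\<close> has a mean within the total
  variation distance of its marginal mean. Hence on \<open>E\<close> the empirical mean of \<open>h\<close> exceeds the true
  mean by little more than \<open>\<psi>\<close> on average, although up to the small noise it exceeds it by
  \<open>\<alpha> + \<psi>\<close>. So \<open>E\<close> has probability \<open>O(\<delta> / \<alpha>)\<close>.\<close>

section \<open>The mechanism and its running time\<close>

text \<open>Why \<open>k powr (1 / 4)\<close>: with scale s, s times the average of n standard
  logistic draws has variance of order s^2 / n, while one sample point moves each of the k n draws
  by 1 / (s n), so the squared shifts add up to k / (s^2 n). For s^2 = sqrt k both are of order sqrt
  k / n, and noise tail and privacy loss ask for the same sample size. On the machine a logistic
  draw costs only a few instructions, since \<open>Ln\<close> of the odds of a uniform draw is
  logistic.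

  A query has no sigma-algebra to live in, so no law of transcripts is formed. All randomness stays
  on the tape: a sample acts by shifting the tape, two samples are compared through two densities on
  the same tape space, and an event on transcripts is a set of tapes.

  All estimates are nonnegative integrals, so a signed deviation is carried as 1 + value - mean,
  which lies in [0, 2]. The added 1 is multiplied by exp (2 \<epsilon>) along with the rest; this
  loss has to stay below the deviation to be detected, which ties \<epsilon> to \<alpha>.\<close>

definition logit :: "real \<Rightarrow> real" where
  "logit u = ln (u / (1 - u))"

text \<open>\<open>logit\<close> of a uniform variable is standard logistic. Round \<open>j\<close>,
  counted from 0, owns the draws from \<open>j * n\<close> to \<open>j * n + n - 1\<close>; these
  are the ones the program reads in that round, since every round draws \<open>n\<close>
  times.\<close>

definition noise :: "nat \<Rightarrow> nat \<Rightarrow> nat \<Rightarrow> tape \<Rightarrow> real" where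
  "noise n k j \<omega> = sqrt (sqrt (real k)) / real n * (\<Sum>l<n. logit (\<omega> (j * n + l)))"

definition noisy_mean :: "nat \<Rightarrow> nat \<Rightarrow> real \<Rightarrow> real \<Rightarrow> 'a mechanism" where
  "noisy_mean n k \<alpha> \<beta> \<omega> x hs = query_avg n (last hs) x + noise n k (length hs - 1) \<omega>"

text \<open>Registers: 4 sums the query values, 5 the noise, 6 is the loop index, 7 holds 1. Everything
  except 0 and 1 is overwritten at the start of a round, so nothing leaks between rounds.\<close>

definition noisy_mean_program :: "instr list" where
  "noisy_mean_program = [Const 4 0, Const 5 0, Const 6 0, Const 7 1,
     JumpLe 0 6 14,
     Eval 8 6, Add 4 4 8, Draw 8, Sub 9 7 8, Div 8 8 9, Ln 8 8, Add 5 5 8, Add 6 6 7, JumpLe 0 0 4,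
     Div 4 4 0, Sqrt 8 1, Sqrt 8 8, Div 8 8 0, Mul 5 8 5, Add 4 4 5, Answer 4]"

lemma length_noisy_mean_program [simp]: "length noisy_mean_program = 21"
  by (simp add: noisy_mean_program_def)

lemma addr_of_nat [simp]: "addr (real i) = i"
  by (simp add: addr_def)

text \<open>Induction on the number of passes left. The budget counts ten instructions per pass, and
  eight for the exit jump, the six arithmetic instructions behind it and \<open>Answer\<close>. Of
  the final memory only registers 0 and 1 are tracked: the next round writes every other register
  before reading it.\<close>

lemma run_round_loop:
  assumes "m 0 = real n" "m 1 = real k" "m 7 = 1" "m 6 = real i" "i \<le> n"
    and "10 * (n - i) + 8 \<le> b"
  shows "\<exists>m'. m' 0 = real n \<and> m' 1 = real k \<and>
    run_round noisy_mean_program \<omega> q b (4, m, t) =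
      Some ((m 4 + (\<Sum>l=i..<n. of_bool (q l))) / real n +
              sqrt (sqrt (real k)) / real n * (m 5 + (\<Sum>l<n-i. logit (\<omega> (t + l)))),
            (0, m', t + (n - i)))"
  using assms
proof (induction "n - i" arbitrary: i m t b)
  case 0
  then have i: "i = n" by simp
  obtain b' where b: "b = Suc (Suc (Suc (Suc (Suc (Suc (Suc (Suc b')))))))"
  proof -
    have "b = 8 + (b - 8)" using 0 by linarith
    then show ?thesis using that[of "b - 8"] by (simp add: numeral_eq_Suc)
  qed
  show ?case
    using 0 i by (simp add: b noisy_mean_program_def)
next
  case (Suc d)
  have in': "i < n" using Suc by simp
  obtain b' where b: "b = Suc (Suc (Suc (Suc (Suc (Suc (Suc (Suc (Suc (Suc b')))))))))"
     and b': "10 * (n - Suc i) + 8 \<le> b'"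
  proof -
    have "b = 10 + (b - 10)" using Suc.prems(6) Suc.hyps(2) by linarith
    moreover have "10 * (n - Suc i) + 8 \<le> b - 10" using Suc.prems(6) in' by linarith
    ultimately show ?thesis using that[of "b - 10"] by (simp add: numeral_eq_Suc)
  qed
  \<comment> \<open>Memory after one pass. Register 8 has held the query value, the draw and its
    odds in turn, and ends with the logit.\<close>
  define m1 where "m1 = m(8 := logit (\<omega> t), 4 := m 4 + of_bool (q i), 9 := 1 - \<omega> t,
     5 := m 5 + logit (\<omega> t), 6 := real (Suc i))"
  have step: "run_round noisy_mean_program \<omega> q b (4, m, t) = run_round noisy_mean_program \<omega> q b' (4, m1, Suc t)"
    using Suc.prems in'
    by (simp add: b noisy_mean_program_def m1_def logit_def)
       (intro conjI impI arg_cong[where f="run_round _ _ _ _"]; simp add: fun_eq_iff)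
  have "\<exists>m'. m' 0 = real n \<and> m' 1 = real k \<and>
    run_round noisy_mean_program \<omega> q b' (4, m1, Suc t) =
      Some ((m1 4 + (\<Sum>l=Suc i..<n. of_bool (q l))) / real n +
              sqrt (sqrt (real k)) / real n * (m1 5 + (\<Sum>l<n-Suc i. logit (\<omega> (Suc t + l)))),
            (0, m', Suc t + (n - Suc i)))"
    using Suc.prems Suc.hyps(2) in' b' by (intro Suc.hyps(1)) (auto simp: m1_def)
  moreover have "m1 4 + (\<Sum>l=Suc i..<n. of_bool (q l)) = m 4 + (\<Sum>l=i..<n. of_bool (q l))"
    by (simp add: m1_def sum.atLeast_Suc_lessThan[OF in'] del: sum_of_bool_eq)
  moreover have "m1 5 + (\<Sum>l<n-Suc i. logit (\<omega> (Suc t + l))) = m 5 + (\<Sum>l<n-i. logit (\<omega> (t + l)))"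
  proof -
    have "n - i = Suc (n - Suc i)" using in' by simp
    then show ?thesis by (simp only: sum.lessThan_Suc_shift) (simp add: m1_def)
  qed
  moreover have "Suc t + (n - Suc i) = t + (n - i)" using in' by simp
  ultimately show ?case unfolding step by (simp only:)
qed

lemma run_round_noisy_mean:
  assumes "m 0 = real n" "m 1 = real k" and "10 * n + 12 \<le> b"
  shows "\<exists>m'. m' 0 = real n \<and> m' 1 = real k \<and>
    run_round noisy_mean_program \<omega> q b (0, m, t) =
      Some ((\<Sum>l<n. of_bool (q l)) / real n +
              sqrt (sqrt (real k)) / real n * (\<Sum>l<n. logit (\<omega> (t + l))), (0, m', t + n))"
proof -
  obtain b' where b: "b = Suc (Suc (Suc (Suc b')))" and b': "10 * n + 8 \<le> b'"
  proof -
    have "b = 4 + (b - 4)" "10 * n + 8 \<le> b - 4" using assms(3) by linarith+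
    then show ?thesis using that[of "b - 4"] by (simp add: numeral_eq_Suc)
  qed
  define m1 where "m1 = m(4 := 0, 5 := 0, 6 := 0, 7 := 1)"
  have "run_round noisy_mean_program \<omega> q b (0, m, t) = run_round noisy_mean_program \<omega> q b' (4, m1, t)"
    by (simp add: b noisy_mean_program_def m1_def) (simp add: numeral_eq_Suc)
  with run_round_loop[of m1 n k 0 b' \<omega> q t] assms b' show ?thesis
    by (simp add: m1_def atLeast0LessThan)
qed

lemma run_rounds_noisy_mean:
  assumes "m 0 = real n" "m 1 = real k" "10 * n + 12 \<le> b" "hs \<noteq> []"
  shows "run_rounds noisy_mean_program \<omega> n x b hs (0, m, t) =
    Some (query_avg n (last hs) x +
      sqrt (sqrt (real k)) / real n * (\<Sum>l<n. logit (\<omega> (t + (length hs - 1) * n + l))))"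
  using assms
proof (induction hs arbitrary: m t)
  case (Cons h hs)
  obtain m' where m': "m' 0 = real n" "m' 1 = real k"
    "run_round noisy_mean_program \<omega> (\<lambda>i. i < n \<and> h (x i)) b (0, m, t) =
      Some ((\<Sum>l<n. of_bool (l < n \<and> h (x l))) / real n +
              sqrt (sqrt (real k)) / real n * (\<Sum>l<n. logit (\<omega> (t + l))), (0, m', t + n))"
    using run_round_noisy_mean[OF Cons.prems(1,2,3)] by blast
  show ?case
  proof (cases "hs = []")
    case True
    then show ?thesis by (simp add: m' query_avg_def)
  next
    case False
    then have eq: "t + n + (length hs - 1) * n = t + length hs * n"
      by (cases hs) auto
    show ?thesis
      using Cons.IH[OF m'(1,2) Cons.prems(3) False, of "t + n"] False unfolding eq
      by (simp add: m'(3))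
  qed
qed simp

lemma noisy_mean_efficient: "computationally_efficient noisy_mean"
  unfolding computationally_efficient_def
\<comment> \<open>One number must serve as factor and as exponent. The factor 20 already gives 10 n
  + 12 \<le> 20 (n + k); the exponent merely enlarges this linear bound.\<close>
proof (intro exI[of _ noisy_mean_program] exI[of _ 20] allI impI)
  fix n k :: nat and \<alpha> \<beta> :: real and \<omega> :: tape and x :: "nat \<Rightarrow> 'a" and hs :: "'a query list"
  assume "1 \<le> n" "1 \<le> k" "hs \<noteq> []"
  have "10 * n + 12 \<le> 20 * (n + k)" using \<open>1 \<le> n\<close> \<open>1 \<le> k\<close> by simp
  also have "\<dots> \<le> 20 * (n + k) ^ 20"
    using self_le_power[of "n + k" 20] \<open>1 \<le> n\<close> by simp
  finally show "run_rounds noisy_mean_program \<omega> n x (20 * (n + k) ^ 20) hs (init_config n k \<alpha> \<beta>) =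
      Some (noisy_mean n k \<alpha> \<beta> \<omega> x hs)"
    using \<open>hs \<noteq> []\<close> unfolding init_config_def
    by (subst run_rounds_noisy_mean) (auto simp: noisy_mean_def noise_def)
qed

section \<open>Shifting a uniform tape in logistic scale\<close>

definition uniform01 :: "real measure" where
  "uniform01 = uniform_measure lborel {0..1}"

lemma sets_uniform01 [simp, measurable_cong]: "sets uniform01 = sets borel"
  by (simp add: uniform01_def)

lemma space_uniform01 [simp]: "space uniform01 = UNIV"
  by (simp add: uniform01_def)

lemma prob_space_uniform01: "prob_space uniform01"
  unfolding uniform01_def by (rule prob_space_uniform_measure) auto

lemma nn_integral_uniform01:
  assumes [measurable]: "f \<in> borel_measurable borel"
  shows "(\<integral>\<^sup>+u. f u \<partial>uniform01) = (\<integral>\<^sup>+u. f u * indicator {0..1} u \<partial>lborel)"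
  unfolding uniform01_def by (subst nn_integral_uniform_measure) (auto simp: divide_ennreal_def)

lemma AE_uniform01: "AE u in uniform01. 0 < u \<and> u < 1"
proof -
  have "AE u in lborel. u \<noteq> (0::real)" "AE u in lborel. u \<noteq> (1::real)"
    by (rule AE_lborel_singleton)+
  then show ?thesis
    unfolding uniform01_def by (subst AE_uniform_measure) (auto elim!: AE_mp)
qed

lemma tape_space_eq: "tape_space = PiM UNIV (\<lambda>_. uniform01)"
  by (simp add: tape_space_def uniform01_def)

lemma space_tape_space [simp]: "space tape_space = UNIV"
  by (simp add: tape_space_eq space_PiM)

lemma sets_tape_space [measurable_cong]: "sets tape_space = sets (PiM UNIV (\<lambda>_. borel))"
  unfolding tape_space_eq by (rule sets_PiM_cong) auto

lemma prob_space_tape_space: "prob_space tape_space"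
  unfolding tape_space_eq by (rule prob_space_PiM) (rule prob_space_uniform01)

text \<open>The endpoints have to be excluded: \<open>logistic_shift\<close> fixes 0 and 1, so there
  \<open>logit\<close> keeps its default value instead of moving by the shift.\<close>

lemma AE_tape_space: "AE \<omega> in tape_space. \<forall>m. 0 < \<omega> m \<and> \<omega> m < 1"
  unfolding tape_space_eq AE_all_countable
  by (intro allI AE_PiM_component[where M="\<lambda>_. uniform01" and P="\<lambda>u. 0 < u \<and> u < 1"]
      prob_space_uniform01 AE_uniform01) simp

lemma measurable_tape_coord: "(\<lambda>\<omega>. \<omega> m) \<in> borel_measurable tape_space"
proof -
  have "(\<lambda>\<omega>. \<omega> m) \<in> PiM UNIV (\<lambda>_. borel :: real measure) \<rightarrow>\<^sub>M borel"
    by (rule measurable_component_singleton) simp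
  then show ?thesis by (simp cong: measurable_cong_sets add: sets_tape_space)
qed

lemma measurable_tape_upd [measurable (raw)]:
  assumes "f \<in> M \<rightarrow>\<^sub>M tape_space" "g \<in> borel_measurable M"
  shows "(\<lambda>x. (f x)(m := g x)) \<in> M \<rightarrow>\<^sub>M tape_space"
proof -
  have "(\<lambda>x. (f x)(m := g x)) \<in> M \<rightarrow>\<^sub>M PiM UNIV (\<lambda>_. borel)"
  proof (rule measurable_PiM_single')
    fix i
    show "(\<lambda>x. ((f x)(m := g x)) i) \<in> borel_measurable M"
      using assms(2) measurable_compose[OF assms(1) measurable_tape_coord[of i]]
      by (cases "i = m") simp_all
  qed simp
  then show ?thesis by (simp cong: measurable_cong_sets add: sets_tape_space)
qed

text \<open>Fubini with coordinate \<open>m\<close> split off from the product measure. Later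
  integrals over the tape are evaluated one coordinate at a time in this form.\<close>

lemma nn_integral_tape_space_resample:
  assumes [measurable]: "F \<in> borel_measurable tape_space"
  shows "(\<integral>\<^sup>+\<omega>. F \<omega> \<partial>tape_space) = (\<integral>\<^sup>+\<omega>. (\<integral>\<^sup>+u. F (\<omega> (m := u)) \<partial>uniform01) \<partial>tape_space)"
proof -
  let ?P = "PiM (UNIV - {m}) (\<lambda>_. uniform01)"
  interpret U: prob_space uniform01 by (rule prob_space_uniform01)
  interpret P: prob_space ?P by (rule prob_space_PiM) (rule prob_space_uniform01)
  interpret UP: pair_sigma_finite uniform01 ?P ..
  have upd: "(\<lambda>(u, X). X(m := u)) \<in> uniform01 \<Otimes>\<^sub>M ?P \<rightarrow>\<^sub>M tape_space"
  proof -
    have "(\<lambda>z. (snd z)(m := fst z)) \<in> uniform01 \<Otimes>\<^sub>M ?P \<rightarrow>\<^sub>M PiM (insert m (UNIV - {m})) (\<lambda>_. uniform01)"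
      by measurable
    then show ?thesis by (simp add: tape_space_eq case_prod_beta insert_UNIV)
  qed
  have split: "(\<integral>\<^sup>+\<omega>. G \<omega> \<partial>tape_space) = (\<integral>\<^sup>+X. (\<integral>\<^sup>+u. G (X(m := u)) \<partial>uniform01) \<partial>?P)"
    if [measurable]: "G \<in> borel_measurable tape_space" for G
  proof -
    have "tape_space = distr (uniform01 \<Otimes>\<^sub>M ?P) tape_space (\<lambda>(u, X). X(m := u))"
      using distr_pair_PiM_eq_PiM[of "UNIV - {m}" "\<lambda>_. uniform01" m] prob_space_uniform01
      by (simp add: tape_space_eq insert_UNIV)
    then have "(\<integral>\<^sup>+\<omega>. G \<omega> \<partial>tape_space)
        = (\<integral>\<^sup>+\<omega>. G \<omega> \<partial>distr (uniform01 \<Otimes>\<^sub>M ?P) tape_space (\<lambda>(u, X). X(m := u)))" by simp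
    also have "\<dots> = (\<integral>\<^sup>+z. G ((\<lambda>(u, X). X(m := u)) z) \<partial>(uniform01 \<Otimes>\<^sub>M ?P))"
      by (rule nn_integral_distr[OF upd]) simp
    also have "\<dots> = (\<integral>\<^sup>+X. (\<integral>\<^sup>+u. G ((\<lambda>(u, X). X(m := u)) (u, X)) \<partial>uniform01) \<partial>?P)"
      by (rule UP.nn_integral_snd[symmetric]) (rule measurable_compose[OF upd that])
    finally show ?thesis by simp
  qed
  have "(\<lambda>\<omega>. \<integral>\<^sup>+u. F (\<omega> (m := u)) \<partial>uniform01) \<in> borel_measurable tape_space"
    by measurable
  \<comment> \<open>In the resampled integrand the value put at \<open>m\<close> by the splitting is
    overwritten, so integrating over it averages a constant over a probability space.\<close>
  from split[OF this] split[OF assms] show ?thesis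
    by (simp add: U.emeasure_space_1[simplified])
qed

text \<open>Translation by \<open>s\<close> transported to the unit interval by
  \<open>logit\<close>. The rational form needs no case distinction at 0 and 1, which are fixed
  points.\<close>

definition logistic_shift :: "real \<Rightarrow> real \<Rightarrow> real" where
  "logistic_shift s u = u / (u + (1 - u) * exp (- s))"

text \<open>The derivative of \<open>logistic_shift (- s)\<close>, hence the density of a shifted
  uniform variable with respect to the uniform law.\<close>

definition logistic_density :: "real \<Rightarrow> real \<Rightarrow> real" where
  "logistic_density s v = exp s / (v + (1 - v) * exp s)\<^sup>2"

lemma measurable_shift [measurable]: "logistic_shift s \<in> borel_measurable borel"
  unfolding logistic_shift_def[abs_def] by measurable

lemma measurable_logistic_density [measurable]: "logistic_density s \<in> borel_measurable borel"
  unfolding logistic_density_def[abs_def] by measurable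

lemma convex_pos:
  fixes u c :: real
  assumes "0 \<le> u" "u \<le> 1" "0 < c"
  shows "0 < u + (1 - u) * c"
proof (cases "u = 0")
  case False
  then have "0 < u" "0 \<le> (1 - u) * c" using assms by auto
  then show ?thesis by linarith
qed (use assms in simp)

lemma shift_interior:
  assumes "0 < u" "u < 1"
  shows "0 < logistic_shift s u" "logistic_shift s u < 1" "logit (logistic_shift s u) = logit u + s"
proof -
  have D: "0 < u + (1 - u) * exp (- s)" by (rule convex_pos) (use assms in auto)
  show "0 < logistic_shift s u" unfolding logistic_shift_def using D assms by simp
  show "logistic_shift s u < 1" unfolding logistic_shift_def using D assms by simp
  have "logistic_shift s u / (1 - logistic_shift s u) = u / (1 - u) * exp s"
    using D assms by (simp add: logistic_shift_def divide_simps exp_minus)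
  then show "logit (logistic_shift s u) = logit u + s"
    unfolding logit_def using assms by (simp add: ln_mult ln_div)
qed

lemma shift_shift_minus:
  assumes "0 \<le> v" "v \<le> 1"
  shows "logistic_shift s (logistic_shift (- s) v) = v"
proof -
  have "0 < v + (1 - v) * exp s" by (rule convex_pos) (use assms in auto)
  then show ?thesis
    by (simp add: logistic_shift_def divide_simps exp_minus)
qed

text \<open>Substitution u = \<open>logistic_shift (- s) v\<close>. The endpoints are fixed, so the
  interval of integration does not change.\<close>

lemma nn_integral_shift:
  fixes g :: "real \<Rightarrow> ennreal"
  assumes [measurable]: "g \<in> borel_measurable borel"
  shows "(\<integral>\<^sup>+u. g (logistic_shift s u) \<partial>uniform01) = (\<integral>\<^sup>+v. g v * logistic_density s v \<partial>uniform01)"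
proof -
  have D: "0 < v + (1 - v) * exp s" if "v \<in> {0..1}" for v
    by (rule convex_pos) (use that in auto)
  have "(\<integral>\<^sup>+u. g (logistic_shift s u) \<partial>uniform01) =
      (\<integral>\<^sup>+u. g (logistic_shift s u) * indicator {logistic_shift (- s) 0..logistic_shift (- s) 1} u \<partial>lborel)"
    by (subst nn_integral_uniform01) (auto simp: logistic_shift_def)
  also have "\<dots> = (\<integral>\<^sup>+v. g (logistic_shift s (logistic_shift (- s) v)) * logistic_density s v * indicator {0..1} v \<partial>lborel)"
  proof (rule nn_integral_substitution_aux)
    show "(logistic_shift (- s) has_real_derivative logistic_density s v) (at v)" if "v \<in> {0..1}" for v
      unfolding logistic_shift_def[abs_def] logistic_density_def
      using D[OF that]
      by (auto intro!: derivative_eq_intros simp: power2_eq_square divide_simps)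
         (simp_all add: algebra_simps)
    show "continuous_on {0..1} (logistic_density s)"
      unfolding logistic_density_def using D by (force intro!: continuous_intros)
    show "0 \<le> logistic_density s v" for v by (simp add: logistic_density_def)
  qed auto
  also have "\<dots> = (\<integral>\<^sup>+v. g v * logistic_density s v * indicator {0..1} v \<partial>lborel)"
    by (intro nn_integral_cong) (auto simp: shift_shift_minus split: split_indicator)
  also have "\<dots> = (\<integral>\<^sup>+v. g v * logistic_density s v \<partial>uniform01)"
    by (subst nn_integral_uniform01) auto
  finally show ?thesis .
qed

lemma logistic_density_pos:
  assumes "0 < v" "v < 1"
  shows "0 < logistic_density s v"
proof -
  have "0 < v + (1 - v) * exp s" by (rule convex_pos) (use assms in auto)
  then show ?thesis by (simp add: logistic_density_def)
qed

text \<open>The log density is s - 2 ln (D s), and ln (D s) is nondecreasing in s with slope at most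
  1. So the log density is 1-Lipschitz in s, uniformly in v. This is the property for which logistic
  noise is chosen.\<close>

lemma logistic_density_ratio:
  assumes "0 < v" "v < 1"
  shows "\<bar>ln (logistic_density s v / logistic_density s' v)\<bar> \<le> \<bar>s - s'\<bar>"
proof -
  define D where "D s = v + (1 - v) * exp s" for s :: real
  have D: "0 < D s" for s unfolding D_def by (rule convex_pos) (use assms in auto)
  have sd: "ln (logistic_density s v) = s - 2 * ln (D s)" for s
    using D[of s] by (simp add: logistic_density_def D_def[symmetric] ln_div ln_realpow)
  have *: "\<bar>ln (logistic_density s v) - ln (logistic_density s' v)\<bar> \<le> s' - s" if "s \<le> s'" for s s'
  proof -
    have "D s \<le> D s'" unfolding D_def using that assms by (simp add: mult_left_mono)
    then have 1: "ln (D s) \<le> ln (D s')" using D by simp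
    have "D s' \<le> exp (s' - s) * D s"
    proof -
      have "exp (s' - s) * exp s = exp s'" by (simp add: exp_add[symmetric])
      moreover have "v \<le> exp (s' - s) * v" using that assms by simp
      ultimately show ?thesis unfolding D_def by (simp add: algebra_simps)
    qed
    then have "ln (D s') \<le> ln (exp (s' - s) * D s)" using D by simp
    also have "\<dots> = s' - s + ln (D s)" using D[of s] by (simp add: ln_mult)
    finally show ?thesis using 1 unfolding sd by linarith
  qed
  have "ln (logistic_density s v / logistic_density s' v) = ln (logistic_density s v) - ln (logistic_density s' v)"
    using logistic_density_pos[OF assms, of s] logistic_density_pos[OF assms, of s'] by (simp add: ln_div)
  then show ?thesis using *[of s s'] *[of s' s] by linarith
qed

lemma exp_le_quadratic:
  fixes x :: real
  assumes "\<bar>x\<bar> \<le> 1"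
  shows "exp x \<le> 1 + x + x\<^sup>2"
proof (cases "0 \<le> x")
  case True
  then show ?thesis using exp_bound[of x] assms by simp
next
  case False
  define y where "y = - x"
  have y: "0 \<le> y" "y \<le> 1" using False assms by (auto simp: y_def)
  \<comment> \<open>The second factor is the quadratic Taylor polynomial of exp y, a lower bound for
    it; so the product with exp y is at least 1 as well.\<close>
  have "1 \<le> (1 - y + y\<^sup>2) * (1 + y + y\<^sup>2 / 2)"
  proof -
    have "(1 - y + y\<^sup>2) * (1 + y + y\<^sup>2 / 2) = 1 + y\<^sup>2 / 2 + y ^ 3 / 2 + y ^ 4 / 2"
      by (simp add: field_simps power2_eq_square power3_eq_cube power4_eq_xxxx)
    then show ?thesis using y by simp
  qed
  also have "\<dots> \<le> (1 - y + y\<^sup>2) * exp y"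
    using exp_lower_Taylor_quadratic[of y] y
    by (intro mult_left_mono) (auto simp: add_nonneg_nonneg)
  finally have "exp (- y) \<le> 1 - y + y\<^sup>2"
    by (simp add: exp_minus divide_simps)
  then show ?thesis by (simp add: y_def)
qed

text \<open>Pointwise form of \<open>E exp (t L) \<le> 1 + (t + t\<^sup>2) \<epsilon>\<^sup>2\<close> for a log-likelihood ratio
  \<open>\<bar>L\<bar> \<le> \<epsilon>\<close>: the linear term is removed with the help of \<open>E exp (- L) = 1\<close>.\<close>

lemma moment_le:
  fixes w w' \<epsilon> :: real and t :: nat
  assumes "0 < w" "0 < w'" "\<bar>ln (w / w')\<bar> \<le> \<epsilon>" "\<epsilon> \<le> 1" "t * \<epsilon> \<le> 1"
  shows "w ^ Suc t / w' ^ t + t * w' \<le> w * (1 + t + (t + (real t)\<^sup>2) * \<epsilon>\<^sup>2)"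
proof -
  define L where "L = ln (w / w')"
  have e: "exp L = w / w'" using assms by (simp add: L_def)
  have sq: "L\<^sup>2 \<le> \<epsilon>\<^sup>2"
    using assms(3) by (simp add: L_def abs_le_square_iff[symmetric])
  have "\<bar>t * L\<bar> \<le> t * \<epsilon>"
    using assms(3) by (auto simp: abs_mult L_def intro!: mult_left_mono)
  then have "exp (t * L) \<le> 1 + t * L + (t * L)\<^sup>2"
    using assms by (intro exp_le_quadratic) linarith
  moreover have "exp (- L) \<le> 1 - L + L\<^sup>2"
    using exp_le_quadratic[of "- L"] assms by (simp add: L_def)
  then have "t * exp (- L) \<le> t * (1 - L + L\<^sup>2)" by (intro mult_left_mono) auto
  ultimately have "exp (t * L) + t * exp (- L) \<le> 1 + t + (t + (real t)\<^sup>2) * L\<^sup>2"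
    by (simp add: algebra_simps power_mult_distrib)
  also have "\<dots> \<le> 1 + t + (t + (real t)\<^sup>2) * \<epsilon>\<^sup>2"
    using sq by (intro add_left_mono mult_left_mono) auto
  finally have "w * (exp (t * L) + t * exp (- L)) \<le> w * (1 + t + (t + (real t)\<^sup>2) * \<epsilon>\<^sup>2)"
    using assms by (intro mult_left_mono) auto
  moreover have "w ^ Suc t / w' ^ t = w * exp (t * L)" "t * w' = w * (t * exp (- L))"
    using assms e by (simp_all add: exp_of_nat_mult exp_minus power_divide)
  ultimately show ?thesis
    by (simp only: distrib_left)
qed

lemma logistic_density_moment:
  fixes s s' \<epsilon> :: real and t :: nat
  assumes "\<bar>s - s'\<bar> \<le> \<epsilon>" "\<epsilon> \<le> 1" "t * \<epsilon> \<le> 1"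
  shows "(\<integral>\<^sup>+v. ennreal (logistic_density s v ^ Suc t / logistic_density s' v ^ t) \<partial>uniform01)
    \<le> ennreal (1 + (t + (real t)\<^sup>2) * \<epsilon>\<^sup>2)"
proof -
  have nn: "0 \<le> logistic_density s v" for s v by (simp add: logistic_density_def)
  have total: "(\<integral>\<^sup>+v. ennreal (logistic_density s v) \<partial>uniform01) = 1" for s
    using nn_integral_shift[of "\<lambda>_. 1" s] prob_space.emeasure_space_1[OF prob_space_uniform01]
    by simp
  have eps: "0 \<le> \<epsilon>" using assms by linarith
  define c where "c = (t + (real t)\<^sup>2) * \<epsilon>\<^sup>2"
  have c: "0 \<le> c" unfolding c_def by (intro mult_nonneg_nonneg add_nonneg_nonneg) auto
  let ?I = "\<integral>\<^sup>+v. ennreal (logistic_density s v ^ Suc t / logistic_density s' v ^ t) \<partial>uniform01"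
  \<comment> \<open>The integral of \<open>t\<close> copies of the density at s' is
    \<open>t\<close>. Adding it on the left produces the integrand of \<open>moment_le\<close>
    without any subtraction under the integral; \<open>t\<close> is cancelled at the end.\<close>
  have "?I + t = (\<integral>\<^sup>+v. ennreal (logistic_density s v ^ Suc t / logistic_density s' v ^ t)
      + ennreal t * ennreal (logistic_density s' v) \<partial>uniform01)"
    by (subst nn_integral_add, measurable)
      (simp add: nn_integral_cmult total ennreal_of_nat_eq_real_of_nat del: power_Suc)
  also have "\<dots> \<le> (\<integral>\<^sup>+v. ennreal (1 + t + c) * ennreal (logistic_density s v) \<partial>uniform01)"
  proof (rule nn_integral_mono_AE)
    show "AE v in uniform01. ennreal (logistic_density s v ^ Suc t / logistic_density s' v ^ t)
      + ennreal t * ennreal (logistic_density s' v) \<le> ennreal (1 + t + c) * ennreal (logistic_density s v)"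
      using AE_uniform01
    proof eventually_elim
      case (elim v)
      have "logistic_density s v ^ Suc t / logistic_density s' v ^ t + t * logistic_density s' v
          \<le> logistic_density s v * (1 + t + c)"
        unfolding c_def
        by (rule moment_le)
           (use elim assms logistic_density_pos logistic_density_ratio[of v s s'] in auto)
      then have "ennreal (logistic_density s v ^ Suc t / logistic_density s' v ^ t + t * logistic_density s' v)
          \<le> ennreal (logistic_density s v * (1 + t + c))"
        by (rule ennreal_leI)
      then show ?case
        using nn c by (simp add: ennreal_mult mult.commute)
    qed
  qed
  also have "\<dots> = ennreal (1 + t + c)"
    by (simp add: nn_integral_cmult total)
  also have "\<dots> = ennreal (1 + c) + t"
    using c by (simp add: ennreal_of_nat_eq_real_of_nat ennreal_plus[symmetric] algebra_simps del: ennreal_plus)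
  finally show ?thesis
    unfolding c_def[symmetric] by (simp add: ennreal_add_left_cancel_le add.commute)
qed

section \<open>Likelihood ratios and noise tails\<close>

text \<open>Adaptedness without a filtration: the shift of draw \<open>m\<close> ignores the draws
  from \<open>m\<close> on. Invariance under single updates is enough, because coordinates are only
  ever resampled one by one.\<close>

definition predictable :: "(nat \<Rightarrow> tape \<Rightarrow> real) \<Rightarrow> bool" where
  "predictable a \<longleftrightarrow> (\<forall>m. a m \<in> borel_measurable tape_space) \<and>
     (\<forall>m l \<omega> u. m \<le> l \<longrightarrow> a m (\<omega> (l := u)) = a m \<omega>)"

lemma predictable_measurable: "predictable a \<Longrightarrow> a m \<in> borel_measurable tape_space"
  and predictable_upd: "predictable a \<Longrightarrow> m \<le> l \<Longrightarrow> a m (\<omega> (l := u)) = a m \<omega>"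
  by (auto simp: predictable_def)

text \<open>A triangular map. Each shift is computed from the draws already shifted, that is from
  earlier outputs, as an adaptive adversary does; this makes the density explicit in the output
  tape.\<close>

primrec adaptive_shift :: "(nat \<Rightarrow> tape \<Rightarrow> real) \<Rightarrow> nat \<Rightarrow> tape \<Rightarrow> tape" where
  "adaptive_shift a 0 \<omega> = \<omega>"
| "adaptive_shift a (Suc K) \<omega> =
     (let v = adaptive_shift a K \<omega> in v(K := logistic_shift (a K v) (v K)))"

text \<open>For predictable \<open>a\<close> this is the density of the law of the shifted tape with
  respect to the tape law, by the chain rule: \<open>a m v\<close> reads \<open>v\<close> only below
  \<open>m\<close>.\<close>

definition likelihood :: "(nat \<Rightarrow> tape \<Rightarrow> real) \<Rightarrow> nat \<Rightarrow> tape \<Rightarrow> real" where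
  "likelihood a K v = (\<Prod>m<K. logistic_density (a m v) (v m))"

lemma measurable_likelihood [measurable]:
  assumes "predictable a"
  shows "likelihood a K \<in> borel_measurable tape_space"
proof -
  note [measurable] = predictable_measurable[OF assms]
  show ?thesis unfolding likelihood_def[abs_def] logistic_density_def by measurable
qed

lemma logistic_density_nonneg: "0 \<le> logistic_density s v"
  by (simp add: logistic_density_def)

lemma likelihood_nonneg: "0 \<le> likelihood a K v"
  by (simp add: likelihood_def logistic_density_nonneg prod_nonneg)

lemma likelihood_upd: "predictable a \<Longrightarrow> likelihood a K (v(K := u)) = likelihood a K v"
  by (auto simp: likelihood_def predictable_upd intro!: prod.cong)

text \<open>The last coordinate is peeled off. Neither \<open>a K\<close> nor the likelihood of the
  first \<open>K\<close> draws reads coordinate \<open>K\<close>, so once this coordinate is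
  resampled, the one-dimensional change of variables applies with a constant shift.\<close>

lemma nn_integral_adaptive_shift:
  assumes a: "predictable a" and "G \<in> borel_measurable tape_space"
  shows "(\<integral>\<^sup>+\<omega>. G (adaptive_shift a K \<omega>) \<partial>tape_space) =
    (\<integral>\<^sup>+v. G v * ennreal (likelihood a K v) \<partial>tape_space)"
  using assms(2)
proof (induction K arbitrary: G)
  case 0
  then show ?case by (simp add: likelihood_def)
next
  case (Suc K)
  note [measurable] = Suc.prems predictable_measurable[OF a] measurable_likelihood[OF a]
  define H where "H v = G (v(K := logistic_shift (a K v) (v K)))" for v
  have [measurable]: "H \<in> borel_measurable tape_space"
    unfolding H_def[abs_def] logistic_shift_def by measurable
  have "(\<integral>\<^sup>+\<omega>. G (adaptive_shift a (Suc K) \<omega>) \<partial>tape_space) =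
      (\<integral>\<^sup>+v. H v * ennreal (likelihood a K v) \<partial>tape_space)"
    by (simp add: Let_def H_def[symmetric] Suc.IH)
  also have "\<dots> = (\<integral>\<^sup>+v. (\<integral>\<^sup>+u. H (v(K := u)) * ennreal (likelihood a K (v(K := u))) \<partial>uniform01) \<partial>tape_space)"
    by (rule nn_integral_tape_space_resample) measurable
  also have "\<dots> = (\<integral>\<^sup>+v. (\<integral>\<^sup>+u. G (v(K := logistic_shift (a K v) u)) \<partial>uniform01) * ennreal (likelihood a K v) \<partial>tape_space)"
    using a by (intro nn_integral_cong)
      (simp add: H_def predictable_upd likelihood_upd nn_integral_multc)
  also have "\<dots> = (\<integral>\<^sup>+v. (\<integral>\<^sup>+u. G (v(K := u)) * logistic_density (a K v) u \<partial>uniform01) * ennreal (likelihood a K v) \<partial>tape_space)"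
    by (intro nn_integral_cong arg_cong2[where f="(*)"] refl nn_integral_shift) measurable
  also have "\<dots> = (\<integral>\<^sup>+v. (\<integral>\<^sup>+u. G (v(K := u)) * ennreal (likelihood a (Suc K) (v(K := u))) \<partial>uniform01) \<partial>tape_space)"
  proof (intro nn_integral_cong)
    fix v
    have "(\<integral>\<^sup>+u. G (v(K := u)) * logistic_density (a K v) u \<partial>uniform01) * ennreal (likelihood a K v) =
        (\<integral>\<^sup>+u. G (v(K := u)) * logistic_density (a K v) u * ennreal (likelihood a K v) \<partial>uniform01)"
      by (rule nn_integral_multc[symmetric]) measurable
    moreover have "likelihood a (Suc K) (v(K := u)) = logistic_density (a K v) u * likelihood a K v" for u
      using likelihood_upd[OF a, of K v u] a by (simp add: likelihood_def predictable_upd)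
    ultimately show "(\<integral>\<^sup>+u. G (v(K := u)) * logistic_density (a K v) u \<partial>uniform01) * ennreal (likelihood a K v) =
        (\<integral>\<^sup>+u. G (v(K := u)) * ennreal (likelihood a (Suc K) (v(K := u))) \<partial>uniform01)"
      by (simp add: ennreal_mult logistic_density_nonneg likelihood_nonneg mult.assoc)
  qed
  also have "\<dots> = (\<integral>\<^sup>+v. G v * ennreal (likelihood a (Suc K) v) \<partial>tape_space)"
    by (rule nn_integral_tape_space_resample[symmetric]) measurable
  finally show ?case .
qed

text \<open>The last factor is integrated first, with the earlier draws held fixed. As
  \<open>c\<close> bounds each conditional integral uniformly, dependence of the factors on earlier
  draws is harmless. It serves both the adaptive likelihood ratios and the independent exponential
  moments of the noise.\<close>

lemma nn_integral_prod_tape_le: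
  fixes F :: "nat \<Rightarrow> tape \<Rightarrow> ennreal"
  assumes F [measurable]: "\<And>m. F m \<in> borel_measurable tape_space"
    and upd: "\<And>m l \<omega> u. m < l \<Longrightarrow> F m (\<omega> (l := u)) = F m \<omega>"
    and le: "\<And>m \<omega>. (\<integral>\<^sup>+u. F m (\<omega> (m := u)) \<partial>uniform01) \<le> c"
  shows "(\<integral>\<^sup>+\<omega>. (\<Prod>m\<in>{i..<i+d}. F m \<omega>) \<partial>tape_space) \<le> c ^ d"
proof (induction d)
  case 0
  then show ?case by (simp add: prob_space.emeasure_space_1[OF prob_space_tape_space, simplified])
next
  case (Suc d)
  let ?P = "\<lambda>\<omega>. \<Prod>m\<in>{i..<i+d}. F m \<omega>"
  have "(\<integral>\<^sup>+\<omega>. (\<Prod>m\<in>{i..<i + Suc d}. F m \<omega>) \<partial>tape_space) = (\<integral>\<^sup>+\<omega>. ?P \<omega> * F (i + d) \<omega> \<partial>tape_space)"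
    by (simp add: prod.atLeastLessThan_Suc)
  also have "\<dots> = (\<integral>\<^sup>+\<omega>. (\<integral>\<^sup>+u. ?P (\<omega> (i + d := u)) * F (i + d) (\<omega> (i + d := u)) \<partial>uniform01) \<partial>tape_space)"
    by (rule nn_integral_tape_space_resample) measurable
  also have "\<dots> = (\<integral>\<^sup>+\<omega>. ?P \<omega> * (\<integral>\<^sup>+u. F (i + d) (\<omega> (i + d := u)) \<partial>uniform01) \<partial>tape_space)"
    by (simp add: upd nn_integral_cmult)
  also have "\<dots> \<le> (\<integral>\<^sup>+\<omega>. ?P \<omega> * c \<partial>tape_space)"
    by (intro nn_integral_mono mult_left_mono le) simp
  also have "\<dots> = (\<integral>\<^sup>+\<omega>. ?P \<omega> \<partial>tape_space) * c"
    by (rule nn_integral_multc) measurable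
  also have "\<dots> \<le> c ^ d * c"
    by (rule mult_right_mono[OF Suc]) simp
  also have "\<dots> = c ^ Suc d" by (simp add: mult.commute)
  finally show ?case .
qed

text \<open>The integrand is the density of the first law times the \<open>t\<close>-th power of the
  likelihood ratio, so this bounds a Renyi divergence of order t + 1. The integrand is a product
  over draws, and each conditional factor is covered by
  \<open>logistic_density_moment\<close>.\<close>

lemma likelihood_moment:
  fixes \<epsilon> :: real and t :: nat
  assumes a: "predictable a" and b: "predictable b"
    and diff: "\<And>m v. \<bar>a m v - b m v\<bar> \<le> \<epsilon>" and \<epsilon>: "\<epsilon> \<le> 1" "t * \<epsilon> \<le> 1"
  shows "(\<integral>\<^sup>+v. ennreal (likelihood a K v ^ Suc t / likelihood b K v ^ t) \<partial>tape_space)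
    \<le> ennreal ((1 + (t + (real t)\<^sup>2) * \<epsilon>\<^sup>2) ^ K)"
proof -
  note [measurable] = predictable_measurable[OF a] predictable_measurable[OF b]
  have measurable_logistic_density_compose:
      "(\<lambda>v. logistic_density (a m v) (v m)) \<in> borel_measurable tape_space"
      "(\<lambda>v. logistic_density (b m v) (v m)) \<in> borel_measurable tape_space" for m
    unfolding logistic_density_def by measurable
  have "(\<integral>\<^sup>+v. ennreal (likelihood a K v ^ Suc t / likelihood b K v ^ t) \<partial>tape_space)
    = (\<integral>\<^sup>+v. (\<Prod>m\<in>{0..<0+K}.
         ennreal (logistic_density (a m v) (v m) ^ Suc t / logistic_density (b m v) (v m) ^ t)) \<partial>tape_space)"
    by (subst prod_ennreal)
      (auto simp: likelihood_def prod_dividef prod_power_distrib lessThan_atLeast0 logistic_density_nonneg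
        simp del: power_Suc)
  also have "\<dots> \<le> ennreal (1 + (t + (real t)\<^sup>2) * \<epsilon>\<^sup>2) ^ K"
  proof (rule nn_integral_prod_tape_le)
    show "(\<integral>\<^sup>+u. ennreal (logistic_density (a m (\<omega> (m := u))) ((\<omega> (m := u)) m) ^ Suc t /
        logistic_density (b m (\<omega> (m := u))) ((\<omega> (m := u)) m) ^ t) \<partial>uniform01)
      \<le> ennreal (1 + (t + (real t)\<^sup>2) * \<epsilon>\<^sup>2)" for m \<omega>
      using logistic_density_moment[OF diff \<epsilon>, of m \<omega>] a b by (simp add: predictable_upd)
    show "(\<lambda>v. ennreal (logistic_density (a m v) (v m) ^ Suc t / logistic_density (b m v) (v m) ^ t))
      \<in> borel_measurable tape_space" for m
      by (intro measurable_compose[OF _ measurable_ennreal] borel_measurable_divide borel_measurable_power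
          measurable_logistic_density_compose)
    show "ennreal (logistic_density (a m (\<omega> (l := u))) ((\<omega> (l := u)) m) ^ Suc t /
          logistic_density (b m (\<omega> (l := u))) ((\<omega> (l := u)) m) ^ t) =
        ennreal (logistic_density (a m \<omega>) (\<omega> m) ^ Suc t / logistic_density (b m \<omega>) (\<omega> m) ^ t)"
      if "m < l" for m l \<omega> u
      using that a b by (simp add: predictable_upd del: power_Suc)
  qed
  also have "\<dots> = ennreal ((1 + (t + (real t)\<^sup>2) * \<epsilon>\<^sup>2) ^ K)"
    by (rule ennreal_power) (intro add_nonneg_nonneg mult_nonneg_nonneg, auto)
  finally show ?thesis .
qed

text \<open>Where the likelihood ratio is at most exp \<epsilon>, the first density is exchanged for
  the second at that price. Elsewhere 1 is at most the \<open>t\<close>-th power of the ratio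
  divided by exp \<epsilon>, which is Markov's inequality for the moment above.\<close>

lemma likelihood_differential_privacy:
  fixes \<epsilon> \<epsilon>\<^sub>0 B :: real and t :: nat
  assumes a: "predictable a" and b: "predictable b"
    and diff: "\<And>m v. \<bar>a m v - b m v\<bar> \<le> \<epsilon>\<^sub>0" and \<epsilon>\<^sub>0: "\<epsilon>\<^sub>0 \<le> 1" "t * \<epsilon>\<^sub>0 \<le> 1"
    and [measurable]: "G \<in> borel_measurable tape_space" and B: "\<And>v. G v \<le> ennreal B" "0 \<le> B"
  shows "(\<integral>\<^sup>+v. G v * ennreal (likelihood a K v) \<partial>tape_space) \<le>
    ennreal (exp \<epsilon>) * (\<integral>\<^sup>+v. G v * ennreal (likelihood b K v) \<partial>tape_space) +
    ennreal (B * (exp (- (t * \<epsilon>)) * (1 + (t + (real t)\<^sup>2) * \<epsilon>\<^sub>0\<^sup>2) ^ K))"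
proof -
  note [measurable] = measurable_likelihood[OF a] measurable_likelihood[OF b]
  let ?a = "likelihood a K" and ?b = "likelihood b K"
  have "(\<integral>\<^sup>+v. G v * ennreal (?a v) \<partial>tape_space) \<le>
    (\<integral>\<^sup>+v. ennreal (exp \<epsilon>) * (G v * ennreal (?b v)) +
       ennreal (B * exp (- (t * \<epsilon>))) * ennreal (?a v ^ Suc t / ?b v ^ t) \<partial>tape_space)"
  proof (rule nn_integral_mono_AE)
    show "AE v in tape_space. G v * ennreal (?a v) \<le> ennreal (exp \<epsilon>) * (G v * ennreal (?b v)) +
       ennreal (B * exp (- (t * \<epsilon>))) * ennreal (?a v ^ Suc t / ?b v ^ t)"
      using AE_tape_space
    proof eventually_elim
      case (elim v)
      have pos: "0 < ?a v" "0 < ?b v"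
        unfolding likelihood_def using elim by (auto intro!: prod_pos logistic_density_pos)
      show ?case
      proof (cases "?a v \<le> exp \<epsilon> * ?b v")
        case True
        then have "G v * ennreal (?a v) \<le> G v * ennreal (exp \<epsilon> * ?b v)"
          by (intro mult_left_mono ennreal_leI) auto
        also have "\<dots> = ennreal (exp \<epsilon>) * (G v * ennreal (?b v))"
          by (simp add: ennreal_mult likelihood_nonneg mult_ac)
        finally show ?thesis by (rule order_trans) simp
      next
        case False
        then have "1 \<le> ?a v / (exp \<epsilon> * ?b v)" using pos by (simp add: field_simps)
        then have "1 \<le> (?a v / (exp \<epsilon> * ?b v)) ^ t" by (rule one_le_power)
        then have "?a v * 1 \<le> ?a v * (?a v / (exp \<epsilon> * ?b v)) ^ t"
          using pos by (intro mult_left_mono) auto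
        also have "\<dots> = exp (- (t * \<epsilon>)) * (?a v ^ Suc t / ?b v ^ t)"
          by (simp add: power_divide power_mult_distrib exp_of_nat_mult exp_of_nat2_mult exp_minus field_simps)
        finally have "ennreal B * ennreal (?a v) \<le>
            ennreal B * ennreal (exp (- (t * \<epsilon>)) * (?a v ^ Suc t / ?b v ^ t))"
          by (intro mult_left_mono ennreal_leI) auto
        moreover have "G v * ennreal (?a v) \<le> ennreal B * ennreal (?a v)"
          by (intro mult_right_mono B) simp
        ultimately have "G v * ennreal (?a v) \<le>
            ennreal B * ennreal (exp (- (t * \<epsilon>)) * (?a v ^ Suc t / ?b v ^ t))"
          by (rule order_trans[rotated])
        also have "\<dots> = ennreal (B * exp (- (t * \<epsilon>))) * ennreal (?a v ^ Suc t / ?b v ^ t)"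
          using B(2) pos by (simp add: ennreal_mult[symmetric] mult.assoc)
        finally show ?thesis by (rule order_trans) simp
      qed
    qed
  qed
  also have "\<dots> = ennreal (exp \<epsilon>) * (\<integral>\<^sup>+v. G v * ennreal (?b v) \<partial>tape_space) +
      ennreal (B * exp (- (t * \<epsilon>))) * (\<integral>\<^sup>+v. ennreal (?a v ^ Suc t / ?b v ^ t) \<partial>tape_space)"
    by (subst nn_integral_add) (auto simp: nn_integral_cmult)
  also have "\<dots> \<le> ennreal (exp \<epsilon>) * (\<integral>\<^sup>+v. G v * ennreal (?b v) \<partial>tape_space) +
      ennreal (B * exp (- (t * \<epsilon>))) * ennreal ((1 + (t + (real t)\<^sup>2) * \<epsilon>\<^sub>0\<^sup>2) ^ K)"
    by (intro add_left_mono mult_left_mono likelihood_moment[OF a b diff \<epsilon>\<^sub>0]) auto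
  also have "ennreal (B * exp (- (t * \<epsilon>))) * ennreal ((1 + (t + (real t)\<^sup>2) * \<epsilon>\<^sub>0\<^sup>2) ^ K) =
      ennreal (B * (exp (- (t * \<epsilon>)) * (1 + (t + (real t)\<^sup>2) * \<epsilon>\<^sub>0\<^sup>2) ^ K))"
    using B(2) by (subst ennreal_mult[symmetric]) (auto simp: mult_ac)
  finally show ?thesis .
qed

section \<open>Exponential moments of logistic variables and Chernoff bounds for the noise\<close>

text \<open>Comparison of power series: \<theta> ^ n \<le> \<theta> ^ 2 for even n \<ge> 2, and the
  constant terms agree. It reduces all small exponents to a single one at which the integral can be
  bounded by hand.\<close>

lemma cosh_contract:
  fixes \<theta> x :: real
  assumes "\<bar>\<theta>\<bar> \<le> 1"
  shows "cosh (\<theta> * x) \<le> 1 - \<theta>\<^sup>2 + \<theta>\<^sup>2 * cosh x"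
proof (rule sums_le)
  let ?f = "\<lambda>n. if even n then x ^ n /\<^sub>R fact n else 0"
  show "(\<lambda>n. if even n then (\<theta> * x) ^ n /\<^sub>R fact n else 0) sums cosh (\<theta> * x)"
    by (rule cosh_converges)
  show "(\<lambda>n. (if n = 0 then 1 - \<theta>\<^sup>2 else 0) + \<theta>\<^sup>2 * ?f n) sums (1 - \<theta>\<^sup>2 + \<theta>\<^sup>2 * cosh x)"
    by (intro sums_add sums_mult cosh_converges sums_single)
  fix n :: nat
  show "(if even n then (\<theta> * x) ^ n /\<^sub>R fact n else 0) \<le>
      (if n = 0 then 1 - \<theta>\<^sup>2 else 0) + \<theta>\<^sup>2 * ?f n"
  proof (cases "even n \<and> n \<noteq> 0")
    case True
    then have n: "even n" "2 \<le> n" by (auto elim!: evenE)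
    have "\<theta> ^ n = \<bar>\<theta>\<bar> ^ n" using n by (simp add: power_even_abs)
    also have "\<dots> \<le> \<bar>\<theta>\<bar> ^ 2" by (rule power_decreasing) (use assms n in auto)
    finally have "\<theta> ^ n * x ^ n \<le> \<theta>\<^sup>2 * x ^ n"
      using n by (intro mult_right_mono) (auto simp: zero_le_even_power)
    then show ?thesis using True by (simp add: power_mult_distrib divide_simps scaleR_conv_of_real)
  qed auto
qed

lemma measurable_logit [measurable]: "logit \<in> borel_measurable borel"
  unfolding logit_def by measurable

lemma nn_integral_uniform01_reflect:
  assumes [measurable]: "f \<in> borel_measurable borel"
  shows "(\<integral>\<^sup>+u. f (1 - u) \<partial>uniform01) = (\<integral>\<^sup>+u. f u \<partial>uniform01)"
proof -
  have "(\<integral>\<^sup>+u. f u * indicator {0..1} u \<partial>lborel) = (\<integral>\<^sup>+u. f (1 - u) * indicator {0..1} (1 - u) \<partial>lborel)"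
    using nn_integral_real_affine[of "\<lambda>u. f u * indicator {0..1} u" "-1" 1] by simp
  also have "\<dots> = (\<integral>\<^sup>+u. f (1 - u) * indicator {0..1} u \<partial>lborel)"
    by (intro nn_integral_cong) (auto split: split_indicator)
  finally show ?thesis by (simp add: nn_integral_uniform01)
qed

lemma logit_reflect: "0 < u \<Longrightarrow> u < 1 \<Longrightarrow> logit (1 - u) = - logit u"
  by (simp add: logit_def ln_div)

lemma nn_integral_inverse_sqrt: "(\<integral>\<^sup>+u. ennreal (1 / sqrt u) \<partial>uniform01) = 2"
proof -
  have "((\<lambda>u::real. u powr (-1/2)) has_integral 2) {0..1}"
    using has_integral_powr_from_0[of "-1/2" 1] by simp
  then have "((\<lambda>u::real. if u \<in> {0..1} then u powr (-1/2) else 0) has_integral 2) UNIV"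
    by (simp only: has_integral_restrict_UNIV)
  then have "(\<integral>\<^sup>+u. ennreal (if u \<in> {0..1} then u powr (-1/2) else 0) \<partial>lborel) = ennreal 2"
    by (intro nn_integral_has_integral_lborel) auto
  moreover have "(\<integral>\<^sup>+u. ennreal (1 / sqrt u) \<partial>uniform01) =
      (\<integral>\<^sup>+u. ennreal (if u \<in> {0..1} then u powr (-1/2) else 0) \<partial>lborel)"
    by (subst nn_integral_uniform01, measurable, intro nn_integral_cong)
      (auto split: split_indicator simp: powr_minus powr_half_sqrt[symmetric] field_simps)
  ultimately show ?thesis by simp
qed

text \<open>The reflection of u to 1 - u removes the linear term and turns exp into cosh, and
  \<open>cosh_contract\<close> reduces to the exponent 1/2. There 2 cosh is a sum of square roots of
  odds, at most 1 / sqrt (1 - u) + 1 / sqrt u, whose integral is 4.\<close>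

lemma logit_mgf:
  fixes \<theta> :: real
  assumes \<theta>: "\<bar>\<theta>\<bar> \<le> 1 / 2"
  shows "(\<integral>\<^sup>+u. ennreal (exp (\<theta> * logit u)) \<partial>uniform01) \<le> ennreal (1 + 4 * \<theta>\<^sup>2)"
proof -
  let ?I = "\<integral>\<^sup>+u. ennreal (exp (\<theta> * logit u)) \<partial>uniform01"
  have sq: "0 \<le> 1 - 4 * \<theta>\<^sup>2"
    using \<theta> abs_le_square_iff[of \<theta> "1/2"] by (simp add: power2_eq_square)
  have two_cosh: "2 * cosh x = exp x + exp (- x)" for x :: real
    by (simp add: cosh_field_def)
  have "?I = (\<integral>\<^sup>+u. ennreal (exp (\<theta> * logit (1 - u))) \<partial>uniform01)"
    by (subst nn_integral_uniform01_reflect) simp_all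
  also have "\<dots> = (\<integral>\<^sup>+u. ennreal (exp (- \<theta> * logit u)) \<partial>uniform01)"
    by (rule nn_integral_cong_AE) (use AE_uniform01 in eventually_elim, simp add: logit_reflect)
  finally have "?I + ?I = ?I + (\<integral>\<^sup>+u. ennreal (exp (- \<theta> * logit u)) \<partial>uniform01)"
    by simp
  also have "\<dots> = (\<integral>\<^sup>+u. ennreal (2 * cosh (\<theta> * logit u)) \<partial>uniform01)"
    by (subst nn_integral_add[symmetric], measurable)
      (simp add: two_cosh ennreal_plus[symmetric] del: ennreal_plus)
  also have "\<dots> \<le> (\<integral>\<^sup>+u. ennreal (2 * (1 - 4 * \<theta>\<^sup>2)) +
      ennreal (4 * \<theta>\<^sup>2) * (ennreal (1 / sqrt (1 - u)) + ennreal (1 / sqrt u)) \<partial>uniform01)"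
  proof (rule nn_integral_mono_AE)
    show "AE u in uniform01. ennreal (2 * cosh (\<theta> * logit u)) \<le> ennreal (2 * (1 - 4 * \<theta>\<^sup>2)) +
      ennreal (4 * \<theta>\<^sup>2) * (ennreal (1 / sqrt (1 - u)) + ennreal (1 / sqrt u))"
      using AE_uniform01
    proof eventually_elim
      case (elim u)
      have half: "exp (logit u / 2) = sqrt (u / (1 - u))"
        using elim by (simp add: logit_def powr_half_sqrt[symmetric] powr_def)
      have "cosh (logit u / 2) * 2 = sqrt (u / (1 - u)) + sqrt ((1 - u) / u)"
        using elim half by (simp add: cosh_def exp_minus real_sqrt_divide)
      also have "\<dots> \<le> 1 / sqrt (1 - u) + 1 / sqrt u"
        unfolding real_sqrt_divide using elim by (intro add_mono divide_right_mono) auto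
      finally have "4 * \<theta>\<^sup>2 * (cosh (logit u / 2) * 2) \<le> 4 * \<theta>\<^sup>2 * (1 / sqrt (1 - u) + 1 / sqrt u)"
        by (intro mult_left_mono) auto
      moreover have "cosh (\<theta> * logit u) \<le> 1 - 4 * \<theta>\<^sup>2 + 4 * \<theta>\<^sup>2 * cosh (logit u / 2)"
        using cosh_contract[of "2 * \<theta>" "logit u / 2"] \<theta> by (simp add: power_mult_distrib)
      then have "2 * cosh (\<theta> * logit u) \<le> 2 * (1 - 4 * \<theta>\<^sup>2) + 4 * \<theta>\<^sup>2 * (cosh (logit u / 2) * 2)"
        by (simp add: algebra_simps)
      ultimately have "2 * cosh (\<theta> * logit u) \<le>
          2 * (1 - 4 * \<theta>\<^sup>2) + 4 * \<theta>\<^sup>2 * (1 / sqrt (1 - u) + 1 / sqrt u)"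
        by linarith
      then have "ennreal (2 * cosh (\<theta> * logit u)) \<le>
          ennreal (2 * (1 - 4 * \<theta>\<^sup>2) + 4 * \<theta>\<^sup>2 * (1 / sqrt (1 - u) + 1 / sqrt u))"
        by (rule ennreal_leI)
      also have "\<dots> = ennreal (2 * (1 - 4 * \<theta>\<^sup>2)) +
          ennreal (4 * \<theta>\<^sup>2) * (ennreal (1 / sqrt (1 - u)) + ennreal (1 / sqrt u))"
        using elim sq by (simp add: ennreal_plus[symmetric] ennreal_mult[symmetric] del: ennreal_plus)
      finally show ?case .
    qed
  qed
  also have "\<dots> = ennreal (2 * (1 - 4 * \<theta>\<^sup>2)) + ennreal (4 * \<theta>\<^sup>2) * (2 + 2)"
    using nn_integral_uniform01_reflect[of "\<lambda>u. ennreal (1 / sqrt u)"]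
      prob_space.emeasure_space_1[OF prob_space_uniform01]
    by (subst nn_integral_add) (auto simp: nn_integral_cmult nn_integral_add nn_integral_inverse_sqrt)
  also have "\<dots> = ennreal (2 * (1 + 4 * \<theta>\<^sup>2))"
  proof -
    have "(2 + 2 :: ennreal) = ennreal 4" by simp
    then show ?thesis
      using sq by (simp only: ennreal_mult[symmetric] zero_le_mult_iff) 
        (subst ennreal_mult[symmetric], auto simp: ennreal_plus[symmetric] simp del: ennreal_plus)
  qed
  finally have "2 * ?I \<le> 2 * ennreal (1 + 4 * \<theta>\<^sup>2)"
    by (simp add: mult_2 ennreal_mult)
  then show ?thesis by (subst (asm) ennreal_mult_le_mult_iff) auto
qed

lemma sets_logit_sum: "{\<omega>. c \<le> \<theta> * (\<Sum>l<n. logit (\<omega> (i + l)))} \<in> sets tape_space"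
proof -
  have "Measurable.pred tape_space (\<lambda>\<omega>. c \<le> \<theta> * (\<Sum>l<n. logit (\<omega> (i + l))))"
    by measurable
  then show ?thesis by (simp add: pred_def)
qed

text \<open>Chernoff's bound, with (1 + 4 \<theta>^2) ^ n \<le> exp (4 \<theta>^2 n). A signed
  \<open>\<theta>\<close> covers both tails.\<close>

lemma logit_sum_tail:
  fixes \<theta> :: real
  assumes \<theta>: "\<bar>\<theta>\<bar> \<le> 1 / 2"
  shows "emeasure tape_space {\<omega>. c \<le> \<theta> * (\<Sum>l<n. logit (\<omega> (i + l)))}
    \<le> ennreal (exp (4 * \<theta>\<^sup>2 * n - c))"
proof -
  have sum_eq: "(\<Sum>l<n. logit (\<omega> (i + l))) = (\<Sum>m\<in>{i..<i+n}. logit (\<omega> m))" for \<omega> :: tape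
    by (rule sum.reindex_bij_witness[of _ "\<lambda>m. m - i" "\<lambda>l. i + l"]) auto
  have "emeasure tape_space {\<omega>. c \<le> \<theta> * (\<Sum>l<n. logit (\<omega> (i + l)))} =
      (\<integral>\<^sup>+\<omega>. indicator {\<omega>. c \<le> \<theta> * (\<Sum>l<n. logit (\<omega> (i + l)))} \<omega> \<partial>tape_space)"
    by (rule nn_integral_indicator[OF sets_logit_sum, symmetric])
  also have "\<dots> \<le> (\<integral>\<^sup>+\<omega>. ennreal (exp (- c)) *
      (\<Prod>m\<in>{i..<i+n}. ennreal (exp (\<theta> * logit (\<omega> m)))) \<partial>tape_space)"
  proof (rule nn_integral_mono)
    fix \<omega> :: tape
    have "ennreal (exp (- c)) * (\<Prod>m\<in>{i..<i+n}. ennreal (exp (\<theta> * logit (\<omega> m)))) =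
        ennreal (exp (\<theta> * (\<Sum>l<n. logit (\<omega> (i + l))) - c))"
      by (subst prod_ennreal)
        (auto simp: exp_sum[symmetric] sum_eq sum_distrib_left ennreal_mult[symmetric] exp_add[symmetric])
    then show "indicator {\<omega>. c \<le> \<theta> * (\<Sum>l<n. logit (\<omega> (i + l)))} \<omega> \<le>
        ennreal (exp (- c)) * (\<Prod>m\<in>{i..<i+n}. ennreal (exp (\<theta> * logit (\<omega> m))))"
      by (auto split: split_indicator simp: ennreal_leI)
  qed
  also have "\<dots> = ennreal (exp (- c)) *
      (\<integral>\<^sup>+\<omega>. (\<Prod>m\<in>{i..<i+n}. ennreal (exp (\<theta> * logit (\<omega> m)))) \<partial>tape_space)"
    by (rule nn_integral_cmult) measurable
  also have "\<dots> \<le> ennreal (exp (- c)) * ennreal (1 + 4 * \<theta>\<^sup>2) ^ n"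
  proof (intro mult_left_mono nn_integral_prod_tape_le)
    show "(\<integral>\<^sup>+u. ennreal (exp (\<theta> * logit ((\<omega> (m := u)) m))) \<partial>uniform01) \<le> ennreal (1 + 4 * \<theta>\<^sup>2)"
      for m and \<omega> :: tape
      unfolding fun_upd_same by (rule logit_mgf[OF \<theta>])
  qed (auto simp: fun_upd_def)
  also have "\<dots> \<le> ennreal (exp (- c)) * ennreal (exp (4 * \<theta>\<^sup>2) ^ n)"
    by (subst ennreal_power) (auto intro!: mult_left_mono ennreal_leI power_mono)
  also have "\<dots> = ennreal (exp (4 * \<theta>\<^sup>2 * n - c))"
    by (simp add: ennreal_mult[symmetric] exp_of_nat_mult[symmetric] exp_add[symmetric] mult_ac)
  finally show ?thesis .
qed

lemma measurable_noise [measurable]: "noise n k j \<in> borel_measurable tape_space"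
  unfolding noise_def by measurable

lemma noise_tail:
  assumes "1 \<le> n" "1 \<le> k" "0 < \<alpha>" "\<alpha> \<le> 1"
  shows "emeasure tape_space {\<omega>. \<alpha> / 4 < \<bar>noise n k j \<omega>\<bar>}
    \<le> ennreal (2 * exp (- (\<alpha>\<^sup>2 * n / (256 * sqrt k))))"
proof -
  define r where "r = sqrt (sqrt (real k))"
  have r: "1 \<le> r" "r\<^sup>2 = sqrt k" using assms by (auto simp: r_def)
  \<comment> \<open>The minimiser of the Chernoff exponent 4 \<theta>^2 n - \<theta> \<alpha> n / (4
    r); the minimum is the exponent with 256.\<close>
  define \<theta> where "\<theta> = \<alpha> / (32 * r)"
  have l2: "\<theta> \<le> 1 / 2" "0 < \<theta>" using assms r by (auto simp: \<theta>_def field_simps)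
  define c where "c = \<theta> * (\<alpha> * n / (4 * r))"
  have c: "4 * \<theta>\<^sup>2 * n - c = - (\<alpha>\<^sup>2 * n / (256 * sqrt k))"
    using r by (simp add: c_def \<theta>_def r(2)[symmetric] field_simps power2_eq_square)
  have *: "c \<le> \<theta> * (\<Sum>l<n. logit (\<omega> (j * n + l))) \<or> c \<le> - \<theta> * (\<Sum>l<n. logit (\<omega> (j * n + l)))"
    if "\<alpha> / 4 < \<bar>noise n k j \<omega>\<bar>" for \<omega>
  proof -
    let ?S = "\<Sum>l<n. logit (\<omega> (j * n + l))"
    have "\<alpha> / 4 < r / n * \<bar>?S\<bar>"
      using that r by (simp add: noise_def r_def[symmetric] abs_mult)
    then have "\<alpha> * n / (4 * r) \<le> \<bar>?S\<bar>"
      using assms r by (simp add: field_simps)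
    then have "c \<le> \<theta> * \<bar>?S\<bar>" unfolding c_def using l2 by (intro mult_left_mono) auto
    then show ?thesis by (auto simp: abs_if split: if_splits)
  qed
  have "emeasure tape_space {\<omega>. \<alpha> / 4 < \<bar>noise n k j \<omega>\<bar>} \<le>
     emeasure tape_space ({\<omega>. c \<le> \<theta> * (\<Sum>l<n. logit (\<omega> (j * n + l)))} \<union>
       {\<omega>. c \<le> - \<theta> * (\<Sum>l<n. logit (\<omega> (j * n + l)))})"
    by (rule emeasure_mono) (use * sets_logit_sum[of c \<theta> "j * n" n] sets_logit_sum[of c "- \<theta>" "j * n" n] in auto)
  also have "\<dots> \<le> emeasure tape_space {\<omega>. c \<le> \<theta> * (\<Sum>l<n. logit (\<omega> (j * n + l)))} +
       emeasure tape_space {\<omega>. c \<le> - \<theta> * (\<Sum>l<n. logit (\<omega> (j * n + l)))}"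
    by (intro emeasure_subadditive sets_logit_sum)
  also have "\<dots> \<le> ennreal (exp (4 * \<theta>\<^sup>2 * n - c)) + ennreal (exp (4 * (- \<theta>)\<^sup>2 * n - c))"
    by (intro add_mono logit_sum_tail) (use l2 in auto)
  also have "\<dots> = ennreal (2 * exp (- (\<alpha>\<^sup>2 * n / (256 * sqrt k))))"
    by (simp add: c ennreal_plus[symmetric] del: ennreal_plus)
  finally show ?thesis .
qed

section \<open>The interaction as a shifted null run\<close>

lemma adaptive_shift_unchanged: "K \<le> m \<Longrightarrow> adaptive_shift a K \<omega> m = \<omega> m"
  by (induction K) (auto simp: Let_def)

lemma adaptive_shift_Suc:
  "adaptive_shift a (Suc K) \<omega> =
    (adaptive_shift a K \<omega>)(K := logistic_shift (a K (adaptive_shift a K \<omega>)) (\<omega> K))"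
  by (simp only: adaptive_shift.simps Let_def adaptive_shift_unchanged[OF order_refl])

text \<open>Updates after the \<open>m\<close>-th touch neither coordinate \<open>m\<close> nor
  anything that \<open>a m\<close> reads, so the shift applied to draw \<open>m\<close> can be read
  off the final tape.\<close>

lemma adaptive_shift_coord:
  assumes a: "predictable a" and "m < K"
  shows "adaptive_shift a K \<omega> m = logistic_shift (a m (adaptive_shift a K \<omega>)) (\<omega> m)"
  using assms(2)
proof (induction K)
  case (Suc K)
  then show ?case
    unfolding adaptive_shift_Suc
    by (cases "m = K") (simp_all only: predictable_upd[OF a] fun_upd_same fun_upd_other
        order_refl less_Suc_eq less_imp_le simp_thms)
qed simp

lemma measurable_adaptive_shift:
  assumes a: "predictable a"
  shows "adaptive_shift a K \<in> tape_space \<rightarrow>\<^sub>M tape_space"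
proof (induction K)
  case 0
  have "adaptive_shift a 0 = (\<lambda>\<omega>. \<omega>)" by auto
  then show ?case by simp
next
  case (Suc K)
  have [measurable]: "(\<lambda>\<omega>. a K (adaptive_shift a K \<omega>)) \<in> borel_measurable tape_space"
    by (rule measurable_compose[OF Suc predictable_measurable[OF a]])
  have "(\<lambda>\<omega>. logistic_shift (a K (adaptive_shift a K \<omega>)) (\<omega> K)) \<in> borel_measurable tape_space"
    unfolding logistic_shift_def by measurable
  from measurable_tape_upd[OF Suc this] show ?case by (simp only: adaptive_shift_Suc[abs_def])
qed

text \<open>Round \<open>i\<close> reads only draws below \<open>Suc i * n\<close>, hence below
  \<open>m\<close>. This is what makes \<open>sample_shift\<close> predictable.\<close>

lemma noise_upd: "i < m div n \<Longrightarrow> m \<le> l \<Longrightarrow> noise n k i (v(l := u)) = noise n k i v"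
proof -
  assume *: "i < m div n" "m \<le> l"
  then have "Suc i * n \<le> m div n * n" by (intro mult_right_mono) auto
  also have "\<dots> \<le> l" using * by (meson div_times_less_eq_dividend order_trans)
  finally have "i * n + j \<noteq> l" if "j < n" for j using that by auto
  then show ?thesis by (auto simp: noise_def intro!: arg_cong2[where f="(*)"] sum.cong)
qed

text \<open>In a null run the answers are pure noise. The sample enters the real run only through
  a predictable shift of the tape that turns the null answers into the real ones.\<close>

definition null_query :: "(real list \<Rightarrow> 'a query) \<Rightarrow> nat \<Rightarrow> nat \<Rightarrow> nat \<Rightarrow> tape \<Rightarrow> 'a query" where
  "null_query a n k j v = a (map (\<lambda>i. noise n k i v) [0..<j])"

text \<open>Draw \<open>m\<close> belongs to round \<open>m div n\<close>. Moving all
  \<open>n\<close> draws of a round by the query sum divided by k^(1/4) n moves their sum, scaled as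
  in \<open>noise\<close>, by exactly the query average. \<open>J\<close> lists the sample points
  that take part; leaving one out keeps the divisor \<open>n\<close>, so only that point's own term
  disappears.\<close>

definition sample_shift ::
    "(real list \<Rightarrow> 'a query) \<Rightarrow> nat \<Rightarrow> nat \<Rightarrow> nat set \<Rightarrow> (nat \<Rightarrow> 'a) \<Rightarrow> nat \<Rightarrow> tape \<Rightarrow> real" where
  "sample_shift a n k J x m v =
     (\<Sum>l\<in>J. of_bool (null_query a n k (m div n) v (x l))) / (sqrt (sqrt (real k)) * real n)"

lemma measurable_adversary_query:
  assumes "measurable_adversary A" and r: "r \<in> borel_measurable M"
    and z: "\<And>i. i < j \<Longrightarrow> z i \<in> borel_measurable M" and y: "y \<in> M \<rightarrow>\<^sub>M borel"
  shows "Measurable.pred M (\<lambda>p. A (r p) (map (\<lambda>i. z i p) [0..<j]) (y p))"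
proof -
  have "(\<lambda>p. \<lambda>i\<in>{..<j}. z i p) \<in> M \<rightarrow>\<^sub>M PiM {..<j} (\<lambda>_. borel)"
    using z by (intro measurable_restrict) auto
  with r y have "(\<lambda>p. (r p, (\<lambda>i\<in>{..<j}. z i p), y p)) \<in>
      M \<rightarrow>\<^sub>M borel \<Otimes>\<^sub>M (PiM {..<j} (\<lambda>_. borel) \<Otimes>\<^sub>M borel)"
    by (intro measurable_Pair)
  moreover have "(\<lambda>(r, z, x). A r (map z [0..<j]) x)
      \<in> borel \<Otimes>\<^sub>M (PiM {..<j} (\<lambda>_. borel) \<Otimes>\<^sub>M borel) \<rightarrow>\<^sub>M count_space UNIV"
    using assms(1) by (simp add: measurable_adversary_def)
  ultimately have "(\<lambda>p. (\<lambda>(r, z, x). A r (map z [0..<j]) x) (r p, (\<lambda>i\<in>{..<j}. z i p), y p))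
      \<in> M \<rightarrow>\<^sub>M count_space UNIV"
    by (rule measurable_compose)
  then have "(\<lambda>p. A (r p) (map (\<lambda>i\<in>{..<j}. z i p) [0..<j]) (y p)) \<in> M \<rightarrow>\<^sub>M count_space UNIV"
    by simp
  moreover have "map (\<lambda>i\<in>{..<j}. z i p) [0..<j] = map (\<lambda>i. z i p) [0..<j]" for p
    by simp
  ultimately show ?thesis by (simp only:)
qed

lemma measurable_null_query:
  assumes A: "measurable_adversary A" and f: "f \<in> M \<rightarrow>\<^sub>M tape_space" and y: "y \<in> M \<rightarrow>\<^sub>M borel"
  shows "Measurable.pred M (\<lambda>p. null_query (A r) n k j (f p) (y p))"
  unfolding null_query_def
  by (rule measurable_adversary_query[OF A _ _ y])
    (auto intro!: measurable_compose[OF f measurable_noise])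

lemma measurable_of_bool_pred:
  assumes "Measurable.pred M P"
  shows "(\<lambda>x. of_bool (P x) :: real) \<in> borel_measurable M"
  using assms by (auto intro!: measurable_compose[OF assms])

lemma measurable_sample_shift:
  assumes A: "measurable_adversary A" and f: "f \<in> M \<rightarrow>\<^sub>M tape_space"
    and x: "\<And>l. l \<in> J \<Longrightarrow> (\<lambda>p. x p l) \<in> M \<rightarrow>\<^sub>M borel"
  shows "(\<lambda>p. sample_shift (A r) n k J (x p) m (f p)) \<in> borel_measurable M"
  unfolding sample_shift_def
  by (intro borel_measurable_divide borel_measurable_sum borel_measurable_const
      measurable_of_bool_pred measurable_null_query[OF A f x])

lemma predictable_sample_shift:
  assumes A: "measurable_adversary A"
  shows "predictable (sample_shift (A r) n k J x)"
  unfolding predictable_def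
proof (intro conjI allI impI)
  show "sample_shift (A r) n k J x m \<in> borel_measurable tape_space" for m
    using measurable_sample_shift[OF A, of "\<lambda>v. v" tape_space J "\<lambda>_. x" r n k m] by simp
  fix m l :: nat and v :: tape and u :: real
  assume "m \<le> l"
  then have "null_query (A r) n k (m div n) (v(l := u)) = null_query (A r) n k (m div n) v"
    unfolding null_query_def by (intro arg_cong[where f="A r"]) (auto simp: noise_upd)
  then show "sample_shift (A r) n k J x m (v(l := u)) = sample_shift (A r) n k J x m v"
    by (simp add: sample_shift_def)
qed

lemma measurable_sample_likelihood:
  assumes A: "measurable_adversary A" and f: "f \<in> M \<rightarrow>\<^sub>M tape_space"
    and x: "\<And>l. l \<in> J \<Longrightarrow> (\<lambda>p. x p l) \<in> M \<rightarrow>\<^sub>M borel"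
  shows "(\<lambda>p. likelihood (sample_shift (A r) n k J (x p)) K (f p)) \<in> borel_measurable M"
proof -
  note [measurable] = measurable_sample_shift[OF A f x]
  have [measurable]: "(\<lambda>p. f p m) \<in> borel_measurable M" for m
    by (rule measurable_compose[OF f measurable_tape_coord])
  show ?thesis unfolding likelihood_def logistic_density_def by measurable
qed

lemma sample_shift_cong:
  "(\<And>l. l \<in> J \<Longrightarrow> x l = y l) \<Longrightarrow> sample_shift a n k J x = sample_shift a n k J y"
  by (auto simp: sample_shift_def fun_eq_iff intro!: sum.cong)

lemma sample_shift_leave_one_out:
  assumes "1 \<le> n" "1 \<le> k" "i < n"
  shows "\<bar>sample_shift a n k {..<n} x m v - sample_shift a n k ({..<n} - {i}) x m v\<bar>
    \<le> 1 / (sqrt (sqrt (real k)) * real n)"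
proof -
  have "(\<Sum>l<n. of_bool (null_query a n k (m div n) v (x l)) :: real) =
      of_bool (null_query a n k (m div n) v (x i)) +
      (\<Sum>l\<in>{..<n}-{i}. of_bool (null_query a n k (m div n) v (x l)))"
    using assms by (intro sum.remove) auto
  then have "sample_shift a n k {..<n} x m v - sample_shift a n k ({..<n} - {i}) x m v =
      of_bool (null_query a n k (m div n) v (x i)) / (sqrt (sqrt (real k)) * real n)"
    by (simp only: sample_shift_def diff_divide_distrib[symmetric]) simp
  then show ?thesis by (simp add: divide_right_mono)
qed

text \<open>The query of round \<open>j\<close> is the same for all its draws and may be read off
  the final tape \<open>Y\<close>, by \<open>adaptive_shift_coord\<close>. So the round's draws move
  by a common amount, chosen to cancel the scale of the noise.\<close>

lemma noise_adaptive_shift: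
  fixes A :: "'a::metric_space adversary" and x :: "nat \<Rightarrow> 'a" and r :: real
  assumes A: "measurable_adversary A" and nk: "1 \<le> n" "1 \<le> k" and j: "j < k"
    and \<omega>: "\<And>m. 0 < \<omega> m \<and> \<omega> m < 1"
  defines "Y \<equiv> adaptive_shift (sample_shift (A r) n k {..<n} x) (k * n) \<omega>"
  shows "noise n k j Y = query_avg n (null_query (A r) n k j Y) x + noise n k j \<omega>"
proof -
  define S where "S = (\<Sum>l<n. of_bool (null_query (A r) n k j Y (x l)) :: real)"
  have "logit (Y (j * n + l)) = logit (\<omega> (j * n + l)) + S / (sqrt (sqrt (real k)) * real n)"
    if "l < n" for l
  proof -
    have "j * n + l < Suc j * n" using that by simp
    also have "\<dots> \<le> k * n" using j by (intro mult_right_mono) auto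
    finally have "Y (j * n + l) =
        logistic_shift (sample_shift (A r) n k {..<n} x (j * n + l) Y) (\<omega> (j * n + l))"
      unfolding Y_def by (intro adaptive_shift_coord predictable_sample_shift[OF A])
    moreover have "(j * n + l) div n = j" using that by simp
    ultimately show ?thesis
      using \<omega> by (simp add: shift_interior sample_shift_def S_def)
  qed
  then have "noise n k j Y = noise n k j \<omega> + sqrt (sqrt (real k)) / n * (n * (S / (sqrt (sqrt (real k)) * real n)))"
    by (simp add: noise_def sum.distrib distrib_left)
  also have "\<dots> = noise n k j \<omega> + S / n"
    using nk by simp
  finally show ?thesis by (simp add: query_avg_def S_def)
qed

section \<open>The rounds of the interaction, identified with those of the null run on the shifted
  tape\<close>

definition game_query :: "(real list \<Rightarrow> 'a query) \<Rightarrow> ('a query list \<Rightarrow> real) \<Rightarrow> nat \<Rightarrow> 'a query" where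
  "game_query a M j = a (map snd (interaction a M j))"

definition game_answer :: "(real list \<Rightarrow> 'a query) \<Rightarrow> ('a query list \<Rightarrow> real) \<Rightarrow> nat \<Rightarrow> real" where
  "game_answer a M j = M (map fst (interaction a M j) @ [game_query a M j])"

lemma interaction_eq: "interaction a M j = map (\<lambda>i. (game_query a M i, game_answer a M i)) [0..<j]"
proof (induction j)
  case (Suc j)
  have "interaction a M (Suc j) = interaction a M j @ [(game_query a M j, game_answer a M j)]"
    by (simp add: Let_def game_query_def game_answer_def)
  then show ?case by (simp only: Suc.IH) simp
qed simp

lemma game_query_eq: "game_query a M j = a (map (game_answer a M) [0..<j])"
  unfolding game_query_def[of a M j] interaction_eq by (simp add: comp_def)

lemma game_answer_noisy_mean:
  "game_answer a (noisy_mean n k \<alpha> \<beta> \<omega> x) j =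
     query_avg n (game_query a (noisy_mean n k \<alpha> \<beta> \<omega> x) j) x + noise n k j \<omega>"
  unfolding game_answer_def[of _ _ j] interaction_eq by (simp add: noisy_mean_def)

text \<open>Agreement of the earlier answers forces agreement of the current query;
  \<open>noise_adaptive_shift\<close> then gives agreement of the current answer.\<close>

lemma game_eq_null:
  fixes A :: "'a::metric_space adversary" and x :: "nat \<Rightarrow> 'a" and r :: real
  assumes A: "measurable_adversary A" and nk: "1 \<le> n" "1 \<le> k" and "j < k"
    and \<omega>: "\<And>m. 0 < \<omega> m \<and> \<omega> m < 1"
  defines "Y \<equiv> adaptive_shift (sample_shift (A r) n k {..<n} x) (k * n) \<omega>"
  shows "game_answer (A r) (noisy_mean n k \<alpha> \<beta> \<omega> x) j = noise n k j Y \<and>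
    game_query (A r) (noisy_mean n k \<alpha> \<beta> \<omega> x) j = null_query (A r) n k j Y"
  using \<open>j < k\<close>
proof (induction j rule: less_induct)
  case (less j)
  have "game_query (A r) (noisy_mean n k \<alpha> \<beta> \<omega> x) j = null_query (A r) n k j Y"
    unfolding game_query_eq[of _ _ j] null_query_def using less by (intro arg_cong[where f="A r"]) auto
  then show ?case
    using noise_adaptive_shift[OF A nk less.prems \<omega>, of r x]
    by (simp add: game_answer_noisy_mean Y_def)
qed

text \<open>Queries are measured only through their values. The map \<open>g\<close> allows the
  query to be evaluated at a point that the state \<open>g p\<close> does not determine, such as a
  coordinate of an independent second sample.\<close>

lemma measurable_game:
  assumes A: "measurable_adversary A"
    and r: "r \<in> borel_measurable M" and f: "f \<in> M \<rightarrow>\<^sub>M tape_space"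
    and x: "\<And>l. l < n \<Longrightarrow> (\<lambda>p. x p l) \<in> M \<rightarrow>\<^sub>M borel"
  shows measurable_game_answer:
      "(\<lambda>p. game_answer (A (r p)) (noisy_mean n k \<alpha> \<beta> (f p) (x p)) j) \<in> borel_measurable M"
    and measurable_game_query:
      "y \<in> N \<rightarrow>\<^sub>M borel \<Longrightarrow> g \<in> N \<rightarrow>\<^sub>M M \<Longrightarrow> Measurable.pred N
        (\<lambda>p. game_query (A (r (g p))) (noisy_mean n k \<alpha> \<beta> (f (g p)) (x (g p))) j (y p))"
proof -
  have answer: "(\<lambda>p. game_answer (A (r p)) (noisy_mean n k \<alpha> \<beta> (f p) (x p)) j) \<in> borel_measurable M" for j
  proof (induction j rule: less_induct)
    case (less j)
    have "Measurable.pred M (\<lambda>p. A (r p) (map (\<lambda>i.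
        game_answer (A (r p)) (noisy_mean n k \<alpha> \<beta> (f p) (x p)) i) [0..<j]) (x p l))" if "l < n" for l
      using less by (intro measurable_adversary_query[OF A r] x that) auto
    then show ?case
      unfolding game_answer_noisy_mean[where j=j] query_avg_def game_query_eq[of _ _ j]
      by (intro borel_measurable_add borel_measurable_divide borel_measurable_sum
          borel_measurable_const measurable_of_bool_pred measurable_compose[OF f measurable_noise]) simp
  qed
  then show "(\<lambda>p. game_answer (A (r p)) (noisy_mean n k \<alpha> \<beta> (f p) (x p)) j) \<in> borel_measurable M" .
  assume y: "y \<in> N \<rightarrow>\<^sub>M borel" and g: "g \<in> N \<rightarrow>\<^sub>M M"
  show "Measurable.pred N
        (\<lambda>p. game_query (A (r (g p))) (noisy_mean n k \<alpha> \<beta> (f (g p)) (x (g p))) j (y p))"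
    unfolding game_query_eq[of _ _ j]
    by (rule measurable_adversary_query[OF A _ _ y])
      (auto intro: measurable_compose[OF g] r answer)
qed

section \<open>Conditional marginals\<close>

lemma tv_dist_bounds:
  assumes "prob_space P" "prob_space Q"
  shows tv_dist_upper: "A \<in> sets P \<Longrightarrow> \<bar>measure P A - measure Q A\<bar> \<le> tv_dist P Q"
    and tv_dist_nonneg: "0 \<le> tv_dist P Q"
    and tv_dist_le_1: "tv_dist P Q \<le> 1"
proof -
  have le: "\<bar>measure P A - measure Q A\<bar> \<le> 1" for A
    using prob_space.prob_le_1[OF assms(1), of A] prob_space.prob_le_1[OF assms(2), of A]
      measure_nonneg[of P A] measure_nonneg[of Q A] by linarith
  then have bdd: "bdd_above ((\<lambda>A. \<bar>measure P A - measure Q A\<bar>) ` sets P)"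
    by (intro bdd_aboveI2) auto
  show upper: "\<bar>measure P A - measure Q A\<bar> \<le> tv_dist P Q" if "A \<in> sets P" for A
    unfolding tv_dist_def by (rule cSUP_upper[OF that bdd])
  show "0 \<le> tv_dist P Q" using upper[of "{}"] by simp
  show "tv_dist P Q \<le> 1" unfolding tv_dist_def
    by (rule cSUP_least) (use le in auto)
qed

text \<open>\<open>\<psi>\<close> is the dependency of the chosen version itself, not an upper bound
  for it. As a supremum of averages of total variation distances it lies in [0, 1], which the final
  arithmetic relies on.\<close>

locale gibbs_sample =
  fixes n k :: nat and \<mu> :: "(nat \<Rightarrow> 'a::metric_space) measure"
    and \<kappa> :: "nat \<Rightarrow> (nat \<Rightarrow> 'a) \<Rightarrow> 'a measure" and \<psi> :: real and A :: "'a adversary"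
  assumes n: "1 \<le> n" and k: "1 \<le> k"
    and \<mu>: "measure_on_tuples n \<mu>"
    and \<kappa>: "conditional_marginals n \<mu> \<kappa>"
    and \<psi>_def: "\<psi> = gibbs_dependency n \<mu> \<kappa>"
    and A: "measurable_adversary A"
begin

lemma prob_space_\<mu>: "prob_space \<mu>" and sets_\<mu> [measurable_cong]: "sets \<mu> = sets (tuples {..<n})"
  using \<mu> by (auto simp: measure_on_tuples_def)

lemma space_\<mu>: "space \<mu> = space (tuples {..<n})"
  by (rule sets_eq_imp_space_eq[OF sets_\<mu>])

sublocale mu: prob_space \<mu> by (rule prob_space_\<mu>)
sublocale tape: prob_space tape_space by (rule prob_space_tape_space)
sublocale mu_tape: pair_prob_space \<mu> tape_space ..

lemma coord_measurable: "l < n \<Longrightarrow> (\<lambda>x. x l) \<in> \<mu> \<rightarrow>\<^sub>M borel"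
  unfolding measurable_cong_sets[OF sets_\<mu> refl] by (rule measurable_component_singleton) simp

lemma drop_measurable: "drop_coord n i \<in> \<mu> \<rightarrow>\<^sub>M tuples ({..<n} - {i})"
  unfolding measurable_cong_sets[OF sets_\<mu> refl] drop_coord_def[abs_def]
  by (rule measurable_restrict_subset) auto

lemma drop_space: "x \<in> space \<mu> \<Longrightarrow> drop_coord n i x \<in> space (tuples ({..<n} - {i}))"
  by (rule measurable_space[OF drop_measurable])

lemma \<kappa>_measurable: "i < n \<Longrightarrow> \<kappa> i \<in> tuples ({..<n} - {i}) \<rightarrow>\<^sub>M prob_algebra borel"
  using \<kappa> by (simp add: conditional_marginals_def)

lemma \<kappa>_prob:
  assumes "i < n" "w \<in> space (tuples ({..<n} - {i}))"
  shows "prob_space (\<kappa> i w)" "sets (\<kappa> i w) = sets borel"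
  using measurable_space[OF \<kappa>_measurable[OF assms(1)] assms(2)]
  by (auto simp: space_prob_algebra)

lemma marginal_prob: "i < n \<Longrightarrow> prob_space (marginal \<mu> i)"
  unfolding marginal_def by (intro mu.prob_space_distr coord_measurable)

lemma sets_marginal [simp]: "sets (marginal \<mu> i) = sets borel"
  by (simp add: marginal_def)

lemma kernel_measure_measurable:
  assumes "i < n" "B \<in> sets borel"
  shows "(\<lambda>x. emeasure (\<kappa> i (drop_coord n i x)) B) \<in> borel_measurable \<mu>"
proof -
  have "(\<lambda>M. emeasure M B) \<in> borel_measurable (subprob_algebra borel)"
    by (rule measurable_emeasure_subprob_algebra) (rule assms(2))
  with measurable_prob_algebraD[OF \<kappa>_measurable[OF assms(1)]]
  have "(\<lambda>w. emeasure (\<kappa> i w) B) \<in> borel_measurable (tuples ({..<n} - {i}))"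
    by (rule measurable_compose)
  with drop_measurable show ?thesis by (rule measurable_compose)
qed

text \<open>The defining identity of a conditional marginal covers indicator weights. It says that
  two weighted copies of \<mu>, projected to the other coordinates, are the same measure, and equal
  measures integrate every measurable weight equally.\<close>

lemma nn_integral_conditional:
  assumes i: "i < n" and B: "B \<in> sets borel"
    and W [measurable]: "W \<in> borel_measurable (tuples ({..<n} - {i}))"
  shows "(\<integral>\<^sup>+x. indicator B (x i) * W (drop_coord n i x) \<partial>\<mu>) =
    (\<integral>\<^sup>+x. emeasure (\<kappa> i (drop_coord n i x)) B * W (drop_coord n i x) \<partial>\<mu>)"
proof -
  let ?T = "tuples ({..<n} - {i})"
  note [measurable] = drop_measurable coord_measurable[OF i] kernel_measure_measurable[OF i B]
  have [measurable]: "(\<lambda>x. indicator B (x i) :: ennreal) \<in> borel_measurable \<mu>"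
    using B by measurable
  have "distr (density \<mu> (\<lambda>x. indicator B (x i))) ?T (drop_coord n i) =
      distr (density \<mu> (\<lambda>x. emeasure (\<kappa> i (drop_coord n i x)) B)) ?T (drop_coord n i)"
  proof (rule measure_eqI)
    fix C assume "C \<in> sets (distr (density \<mu> (\<lambda>x. indicator B (x i))) ?T (drop_coord n i))"
    then have C: "C \<in> sets ?T" by simp
    have vimage: "drop_coord n i -` C \<inter> space \<mu> \<in> sets \<mu>"
      using drop_measurable C by (rule measurable_sets)
    have "{x \<in> space \<mu>. x i \<in> B \<and> drop_coord n i x \<in> C} \<in> sets \<mu>"
    proof -
      have "{x \<in> space \<mu>. x i \<in> B \<and> drop_coord n i x \<in> C} =
          ((\<lambda>x. x i) -` B \<inter> space \<mu>) \<inter> (drop_coord n i -` C \<inter> space \<mu>)" by auto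
      then show ?thesis
        using vimage measurable_sets[OF coord_measurable[OF i] B] by auto
    qed
    note set = this
    have "emeasure (distr (density \<mu> (\<lambda>x. indicator B (x i))) ?T (drop_coord n i)) C =
        (\<integral>\<^sup>+x. indicator B (x i) * indicator (drop_coord n i -` C \<inter> space \<mu>) x \<partial>\<mu>)"
      using C vimage by (subst emeasure_distr) (auto simp: emeasure_density)
    also have "\<dots> = (\<integral>\<^sup>+x. indicator {x \<in> space \<mu>. x i \<in> B \<and> drop_coord n i x \<in> C} x \<partial>\<mu>)"
      by (intro nn_integral_cong) (auto split: split_indicator)
    also have "\<dots> = emeasure \<mu> {x \<in> space \<mu>. x i \<in> B \<and> drop_coord n i x \<in> C}"
      by (rule nn_integral_indicator[OF set])
    also have "\<dots> = (\<integral>\<^sup>+x. emeasure (\<kappa> i (drop_coord n i x)) B * indicator C (drop_coord n i x) \<partial>\<mu>)"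
      using \<kappa> i B C by (simp add: conditional_marginals_def)
    also have "\<dots> = (\<integral>\<^sup>+x. emeasure (\<kappa> i (drop_coord n i x)) B * indicator (drop_coord n i -` C \<inter> space \<mu>) x \<partial>\<mu>)"
      by (intro nn_integral_cong) (auto split: split_indicator)
    also have "\<dots> = emeasure (distr (density \<mu> (\<lambda>x. emeasure (\<kappa> i (drop_coord n i x)) B)) ?T (drop_coord n i)) C"
      using C vimage by (subst emeasure_distr) (auto simp: emeasure_density)
    finally show "emeasure (distr (density \<mu> (\<lambda>x. indicator B (x i))) ?T (drop_coord n i)) C =
        emeasure (distr (density \<mu> (\<lambda>x. emeasure (\<kappa> i (drop_coord n i x)) B)) ?T (drop_coord n i)) C" .
  qed simp
  then have "(\<integral>\<^sup>+w. W w \<partial>distr (density \<mu> (\<lambda>x. indicator B (x i))) ?T (drop_coord n i)) =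
      (\<integral>\<^sup>+w. W w \<partial>distr (density \<mu> (\<lambda>x. emeasure (\<kappa> i (drop_coord n i x)) B)) ?T (drop_coord n i))"
    by simp
  then show ?thesis
    by (simp add: nn_integral_distr nn_integral_density)
qed

lemma \<psi>_bounds:
  assumes "x \<in> space \<mu>"
  shows sum_tv_le: "(\<Sum>i<n. tv_dist (marginal \<mu> i) (\<kappa> i (drop_coord n i x))) \<le> n * \<psi>"
    and \<psi>_nonneg: "0 \<le> \<psi>" and \<psi>_le_1: "\<psi> \<le> 1"
proof -
  let ?f = "\<lambda>x. (\<Sum>i<n. tv_dist (marginal \<mu> i) (\<kappa> i (drop_coord n i x))) / real n"
  have f: "0 \<le> ?f x" "?f x \<le> 1" if "x \<in> space \<mu>" for x
  proof -
    show "0 \<le> ?f x"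
      by (intro divide_nonneg_nonneg sum_nonneg tv_dist_nonneg marginal_prob \<kappa>_prob drop_space)
        (use that in auto)
    have "(\<Sum>i<n. tv_dist (marginal \<mu> i) (\<kappa> i (drop_coord n i x))) \<le> (\<Sum>i<n. 1)"
      by (intro sum_mono tv_dist_le_1 marginal_prob \<kappa>_prob drop_space) (use that in auto)
    then show "?f x \<le> 1" using n by simp
  qed
  have bdd: "bdd_above (?f ` space \<mu>)"
    by (rule bdd_aboveI2[of _ _ 1]) (use f in auto)
  have le: "?f x \<le> \<psi>"
    unfolding \<psi>_def gibbs_dependency_def space_\<mu>[symmetric] by (rule cSUP_upper[OF assms bdd])
  then show "(\<Sum>i<n. tv_dist (marginal \<mu> i) (\<kappa> i (drop_coord n i x))) \<le> n * \<psi>"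
    using n by (simp add: field_simps)
  show "0 \<le> \<psi>" using f(1)[OF assms] le by simp
  show "\<psi> \<le> 1" unfolding \<psi>_def gibbs_dependency_def space_\<mu>[symmetric]
    by (rule cSUP_least) (use assms f in auto)
qed

end

section \<open>Exchanging one coordinate\<close>

context gibbs_sample
begin

abbreviation lik :: "real \<Rightarrow> nat set \<Rightarrow> (nat \<Rightarrow> 'a) \<Rightarrow> tape \<Rightarrow> real" where
  "lik r J x v \<equiv> likelihood (sample_shift (A r) n k J x) (k * n) v"

lemma lik_measurable:
  assumes "J \<subseteq> {..<n}"
  shows "(\<lambda>p. lik r J (fst p) (snd p)) \<in> borel_measurable (\<mu> \<Otimes>\<^sub>M tape_space)"
  by (rule measurable_sample_likelihood[OF A measurable_snd])
    (use assms in \<open>auto intro!: measurable_compose[OF measurable_fst coord_measurable]\<close>)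

lemma nn_integral_snd_measurable:
  assumes "(\<lambda>p. F (fst p) (snd p)) \<in> borel_measurable (\<mu> \<Otimes>\<^sub>M tape_space)"
  shows "(\<lambda>x. \<integral>\<^sup>+v. F x v \<partial>tape_space) \<in> borel_measurable \<mu>"
  by (rule tape.borel_measurable_nn_integral) (use assms in \<open>simp add: case_prod_beta'\<close>)

lemma slice_measurable:
  assumes "(\<lambda>p. F (fst p) (snd p)) \<in> \<mu> \<Otimes>\<^sub>M tape_space \<rightarrow>\<^sub>M N"
  shows "x \<in> space \<mu> \<Longrightarrow> F x \<in> tape_space \<rightarrow>\<^sub>M N"
  using measurable_compose[OF measurable_Pair1' assms] by simp

lemma nn_integral_add_const:
  fixes c d :: real and I :: "(nat \<Rightarrow> 'a) \<Rightarrow> ennreal"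
  assumes "I \<in> borel_measurable \<mu>"
    and "\<And>x. x \<in> space \<mu> \<Longrightarrow> J x \<le> ennreal c * I x + ennreal d"
  shows "(\<integral>\<^sup>+x. J x \<partial>\<mu>) \<le> ennreal c * (\<integral>\<^sup>+x. I x \<partial>\<mu>) + ennreal d"
proof -
  have "(\<integral>\<^sup>+x. J x \<partial>\<mu>) \<le> (\<integral>\<^sup>+x. ennreal c * I x + ennreal d \<partial>\<mu>)"
    by (rule nn_integral_mono) (rule assms(2))
  also have "\<dots> = ennreal c * (\<integral>\<^sup>+x. I x \<partial>\<mu>) + ennreal d"
    using assms(1) by (subst nn_integral_add) (auto simp: nn_integral_cmult mu.emeasure_space_1)
  finally show ?thesis .
qed

lemma query_sets:
  assumes "Measurable.pred (tape_space \<Otimes>\<^sub>M borel) (\<lambda>p. g (fst p) (snd p))"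
  shows "{y. g v y} \<in> sets borel"
proof -
  have "(\<lambda>y. (v, y)) \<in> borel \<rightarrow>\<^sub>M tape_space \<Otimes>\<^sub>M borel" by (rule measurable_Pair1') simp
  from measurable_compose[OF this assms] have "Measurable.pred borel (g v)" by simp
  then show ?thesis by (simp add: pred_def)
qed

lemma query_kernel_measurable:
  assumes g: "Measurable.pred (tape_space \<Otimes>\<^sub>M borel) (\<lambda>p. g (fst p) (snd p))"
    and L: "L \<in> M \<rightarrow>\<^sub>M subprob_algebra borel" and f: "f \<in> M \<rightarrow>\<^sub>M tape_space"
  shows "(\<lambda>p. measure (L p) {y. g (f p) y}) \<in> borel_measurable M"
proof (rule measure_measurable_subprob_algebra2[OF _ L])
  have "(\<lambda>z. (f (fst z), snd z)) \<in> M \<Otimes>\<^sub>M borel \<rightarrow>\<^sub>M tape_space \<Otimes>\<^sub>M borel"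
    by (intro measurable_Pair measurable_snd measurable_compose[OF measurable_fst f])
  from measurable_compose[OF this g]
  have "Measurable.pred (M \<Otimes>\<^sub>M borel) (\<lambda>z. g (f (fst z)) (snd z))" by simp
  moreover have "Sigma (space M) (\<lambda>p. {y. g (f p) y}) = {z \<in> space (M \<Otimes>\<^sub>M borel). g (f (fst z)) (snd z)}"
    by (auto simp: space_pair_measure)
  ultimately show "Sigma (space M) (\<lambda>p. {y. g (f p) y}) \<in> sets (M \<Otimes>\<^sub>M borel)"
    by (simp add: pred_def)
qed

definition marg :: "(tape \<Rightarrow> 'a query) \<Rightarrow> nat \<Rightarrow> tape \<Rightarrow> real" where
  "marg g i v = measure (marginal \<mu> i) {y. g v y}"

definition cond :: "(tape \<Rightarrow> 'a query) \<Rightarrow> nat \<Rightarrow> (nat \<Rightarrow> 'a) \<Rightarrow> tape \<Rightarrow> real" where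
  "cond g i x v = measure (\<kappa> i (drop_coord n i x)) {y. g v y}"

lemma marg_bounds: "i < n \<Longrightarrow> 0 \<le> marg g i v \<and> marg g i v \<le> 1"
  unfolding marg_def by (simp add: prob_space.prob_le_1[OF marginal_prob])

lemma cond_bounds: "i < n \<Longrightarrow> x \<in> space \<mu> \<Longrightarrow> 0 \<le> cond g i x v \<and> cond g i x v \<le> 1"
  unfolding cond_def by (simp add: prob_space.prob_le_1[OF \<kappa>_prob(1)] drop_space)

context
  fixes g :: "tape \<Rightarrow> 'a query"
  assumes g: "Measurable.pred (tape_space \<Otimes>\<^sub>M borel) (\<lambda>p. g (fst p) (snd p))"
begin

lemma marg_measurable: "i < n \<Longrightarrow> marg g i \<in> borel_measurable tape_space"
  unfolding marg_def
  by (rule query_kernel_measurable[OF g _ measurable_ident_sets[OF refl], unfolded id_def])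
    (auto simp: space_subprob_algebra intro!: measurable_const prob_space_imp_subprob_space marginal_prob)

lemma cond_measurable:
  assumes "i < n"
  shows "(\<lambda>p. cond g i (fst p) (snd p)) \<in> borel_measurable (\<mu> \<Otimes>\<^sub>M tape_space)"
  unfolding cond_def
  by (rule query_kernel_measurable[OF g _ measurable_snd])
    (intro measurable_compose[OF measurable_compose[OF measurable_fst drop_measurable]
      measurable_prob_algebraD[OF \<kappa>_measurable[OF assms]]])

text \<open>With point \<open>i\<close> left out, the likelihood is a function of the other
  coordinates alone, and given these \<open>x i\<close> has law \<open>\<kappa> i\<close>. The
  summand \<open>1 - marg g i v\<close> keeps the integrand nonnegative.\<close>

lemma resample_coord:
  assumes i: "i < n"
  shows "(\<integral>\<^sup>+x. ennreal (of_bool (g v (x i)) + (1 - marg g i v)) * ennreal (lik r ({..<n} - {i}) x v) \<partial>\<mu>) =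
    (\<integral>\<^sup>+x. ennreal (cond g i x v + (1 - marg g i v)) * ennreal (lik r ({..<n} - {i}) x v) \<partial>\<mu>)"
proof -
  let ?T = "tuples ({..<n} - {i})" and ?B = "{y. g v y}"
  define W where "W w = ennreal (lik r ({..<n} - {i}) w v)" for w
  have W [measurable]: "W \<in> borel_measurable ?T"
  proof -
    have "(\<lambda>w. lik r ({..<n} - {i}) w v) \<in> borel_measurable ?T"
      by (rule measurable_sample_likelihood[OF A]) (auto intro: measurable_component_singleton)
    then show ?thesis unfolding W_def by measurable
  qed
  have W_drop: "ennreal (lik r ({..<n} - {i}) x v) = W (drop_coord n i x)" for x
    unfolding W_def using sample_shift_cong[of "{..<n} - {i}" x "drop_coord n i x" "A r" n k]
    by (simp add: drop_coord_def)
  have [measurable]: "(\<lambda>x. W (drop_coord n i x)) \<in> borel_measurable \<mu>"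
    by (rule measurable_compose[OF drop_measurable W])
  note B = query_sets[OF g, of v]
  have [measurable]: "(\<lambda>x. indicator ?B (x i) :: ennreal) \<in> borel_measurable \<mu>"
    by (rule measurable_compose[OF coord_measurable[OF i]]) (use B in measurable)
  note [measurable] = kernel_measure_measurable[OF i B]
  have "(\<integral>\<^sup>+x. ennreal (of_bool (g v (x i)) + (1 - marg g i v)) * W (drop_coord n i x) \<partial>\<mu>) =
      (\<integral>\<^sup>+x. indicator ?B (x i) * W (drop_coord n i x) + ennreal (1 - marg g i v) * W (drop_coord n i x) \<partial>\<mu>)"
    by (intro nn_integral_cong) (use marg_bounds[OF i, of g v] in \<open>auto simp: distrib_right split: split_indicator\<close>)
  also have "\<dots> = (\<integral>\<^sup>+x. indicator ?B (x i) * W (drop_coord n i x) \<partial>\<mu>) +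
      (\<integral>\<^sup>+x. ennreal (1 - marg g i v) * W (drop_coord n i x) \<partial>\<mu>)"
    by (rule nn_integral_add) measurable
  also have "\<dots> = (\<integral>\<^sup>+x. emeasure (\<kappa> i (drop_coord n i x)) ?B * W (drop_coord n i x) \<partial>\<mu>) +
      (\<integral>\<^sup>+x. ennreal (1 - marg g i v) * W (drop_coord n i x) \<partial>\<mu>)"
    by (simp only: nn_integral_conditional[OF i B W])
  also have "\<dots> = (\<integral>\<^sup>+x. emeasure (\<kappa> i (drop_coord n i x)) ?B * W (drop_coord n i x) +
      ennreal (1 - marg g i v) * W (drop_coord n i x) \<partial>\<mu>)"
    by (rule nn_integral_add[symmetric]) measurable
  also have "\<dots> = (\<integral>\<^sup>+x. ennreal (cond g i x v + (1 - marg g i v)) * W (drop_coord n i x) \<partial>\<mu>)"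
  proof (intro nn_integral_cong)
    fix x assume x: "x \<in> space \<mu>"
    interpret K: prob_space "\<kappa> i (drop_coord n i x)" by (rule \<kappa>_prob(1)[OF i drop_space[OF x]])
    show "emeasure (\<kappa> i (drop_coord n i x)) ?B * W (drop_coord n i x) +
        ennreal (1 - marg g i v) * W (drop_coord n i x) =
        ennreal (cond g i x v + (1 - marg g i v)) * W (drop_coord n i x)"
      using marg_bounds[OF i, of g v] by (simp add: K.emeasure_eq_measure cond_def distrib_right)
  qed
  finally show ?thesis by (simp only: W_drop)
qed

lemma of_bool_g_measurable:
  assumes "i < n"
  shows "(\<lambda>p. of_bool (g (snd p) (fst p i)) :: real) \<in> borel_measurable (\<mu> \<Otimes>\<^sub>M tape_space)"
proof (rule measurable_of_bool_pred)
  have "(\<lambda>p. (snd p, fst p i)) \<in> \<mu> \<Otimes>\<^sub>M tape_space \<rightarrow>\<^sub>M tape_space \<Otimes>\<^sub>M borel"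
    by (intro measurable_Pair measurable_snd measurable_compose[OF measurable_fst coord_measurable[OF assms]])
  from measurable_compose[OF this g]
  show "Measurable.pred (\<mu> \<Otimes>\<^sub>M tape_space) (\<lambda>p. g (snd p) (fst p i))" by simp
qed

end

context
  fixes r :: real and t :: nat and \<epsilon> \<delta> :: real
    and E :: "tape set" and g :: "tape \<Rightarrow> 'a query"
  assumes t: "t * (1 / (sqrt (sqrt (real k)) * real n)) \<le> 1"
    and \<delta>: "exp (- (t * \<epsilon>)) *
      (1 + (t + (real t)\<^sup>2) * (1 / (sqrt (sqrt (real k)) * real n))\<^sup>2) ^ (k * n) \<le> \<delta>"
    and E: "E \<in> sets tape_space"
    and g: "Measurable.pred (tape_space \<Otimes>\<^sub>M borel) (\<lambda>p. g (fst p) (snd p))"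
begin

lemma step_le_1: "1 / (sqrt (sqrt (real k)) * real n) \<le> 1"
proof -
  have "1 * 1 \<le> sqrt (sqrt (real k)) * real n" using n k by (intro mult_mono) auto
  then show ?thesis by simp
qed

text \<open>Leaving out one point moves every draw by at most 1 / (k^(1/4) n), and the comparison is
  symmetric in the two likelihoods. The bound 2 fits the integrands 1 + value - mean and causes the
  factor 2 of \<open>\<delta>\<close>.\<close>

lemma privacy:
  assumes i: "i < n" and G: "G \<in> borel_measurable tape_space" "\<And>v. G v \<le> ennreal 2"
  shows privacy_remove: "(\<integral>\<^sup>+v. G v * ennreal (lik r {..<n} x v) \<partial>tape_space) \<le>
      ennreal (exp \<epsilon>) * (\<integral>\<^sup>+v. G v * ennreal (lik r ({..<n} - {i}) x v) \<partial>tape_space) + ennreal (2 * \<delta>)"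
    and privacy_restore: "(\<integral>\<^sup>+v. G v * ennreal (lik r ({..<n} - {i}) x v) \<partial>tape_space) \<le>
      ennreal (exp \<epsilon>) * (\<integral>\<^sup>+v. G v * ennreal (lik r {..<n} x v) \<partial>tape_space) + ennreal (2 * \<delta>)"
proof -
  note P = predictable_sample_shift[OF A]
  have \<delta>2: "ennreal (2 * (exp (- (t * \<epsilon>)) *
      (1 + (t + (real t)\<^sup>2) * (1 / (sqrt (sqrt (real k)) * real n))\<^sup>2) ^ (k * n))) \<le> ennreal (2 * \<delta>)"
    using \<delta> by (intro ennreal_leI) simp
  note leave = sample_shift_leave_one_out[OF n k i]
  have "(\<integral>\<^sup>+v. G v * ennreal (lik r {..<n} x v) \<partial>tape_space) \<le>
      ennreal (exp \<epsilon>) * (\<integral>\<^sup>+v. G v * ennreal (lik r ({..<n} - {i}) x v) \<partial>tape_space) +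
      ennreal (2 * (exp (- (t * \<epsilon>)) *
      (1 + (t + (real t)\<^sup>2) * (1 / (sqrt (sqrt (real k)) * real n))\<^sup>2) ^ (k * n)))"
    by (rule likelihood_differential_privacy[OF P P leave step_le_1 t G]) simp
  then show "(\<integral>\<^sup>+v. G v * ennreal (lik r {..<n} x v) \<partial>tape_space) \<le>
      ennreal (exp \<epsilon>) * (\<integral>\<^sup>+v. G v * ennreal (lik r ({..<n} - {i}) x v) \<partial>tape_space) + ennreal (2 * \<delta>)"
    by (rule order_trans) (intro add_left_mono \<delta>2)
  have leave': "\<bar>sample_shift (A r) n k ({..<n} - {i}) x m v - sample_shift (A r) n k {..<n} x m v\<bar>
    \<le> 1 / (sqrt (sqrt (real k)) * real n)" for m v
    using leave[of "A r" x m v] by (simp add: abs_minus_commute)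
  have "(\<integral>\<^sup>+v. G v * ennreal (lik r ({..<n} - {i}) x v) \<partial>tape_space) \<le>
      ennreal (exp \<epsilon>) * (\<integral>\<^sup>+v. G v * ennreal (lik r {..<n} x v) \<partial>tape_space) +
      ennreal (2 * (exp (- (t * \<epsilon>)) *
      (1 + (t + (real t)\<^sup>2) * (1 / (sqrt (sqrt (real k)) * real n))\<^sup>2) ^ (k * n)))"
    by (rule likelihood_differential_privacy[OF P P leave' step_le_1 t G]) simp
  then show "(\<integral>\<^sup>+v. G v * ennreal (lik r ({..<n} - {i}) x v) \<partial>tape_space) \<le>
      ennreal (exp \<epsilon>) * (\<integral>\<^sup>+v. G v * ennreal (lik r {..<n} x v) \<partial>tape_space) + ennreal (2 * \<delta>)"
    by (rule order_trans) (intro add_left_mono \<delta>2)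
qed

text \<open>Point \<open>i\<close> is removed from the likelihood, its query value is replaced by
  the conditional mean, and then the point is put back, so that both sides refer to the law of the
  real run. Two uses of privacy give two factors exp \<epsilon> and two terms 2 \<delta>.\<close>

lemma coordinate_bound:
  assumes i: "i < n"
  shows "(\<integral>\<^sup>+x. (\<integral>\<^sup>+v. indicator E v * ennreal (of_bool (g v (x i)) + (1 - marg g i v)) *
        ennreal (lik r {..<n} x v) \<partial>tape_space) \<partial>\<mu>) \<le>
    ennreal (exp \<epsilon>) * (ennreal (exp \<epsilon>) *
      (\<integral>\<^sup>+x. (\<integral>\<^sup>+v. indicator E v * ennreal (cond g i x v + (1 - marg g i v)) *
        ennreal (lik r {..<n} x v) \<partial>tape_space) \<partial>\<mu>) + ennreal (2 * \<delta>)) + ennreal (2 * \<delta>)"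
proof -
  let ?\<phi> = "\<lambda>x v. indicator E v * ennreal (of_bool (g v (x i)) + (1 - marg g i v))"
  let ?\<gamma> = "\<lambda>x v. indicator E v * ennreal (cond g i x v + (1 - marg g i v))"
  let ?J = "{..<n} - {i}"
  have [measurable]: "(\<lambda>p. indicator E (snd p) :: ennreal) \<in> borel_measurable (\<mu> \<Otimes>\<^sub>M tape_space)"
    by (rule measurable_compose[OF measurable_snd]) (use E in measurable)
  have [measurable]: "(\<lambda>p. marg g i (snd p)) \<in> borel_measurable (\<mu> \<Otimes>\<^sub>M tape_space)"
    by (rule measurable_compose[OF measurable_snd marg_measurable[OF g i]])
  note [measurable] = of_bool_g_measurable[OF g i]
  note [measurable] = cond_measurable[OF g i] lik_measurable[of ?J, OF Diff_subset] lik_measurable[OF order_refl]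
  have \<phi>: "(\<lambda>p. ?\<phi> (fst p) (snd p)) \<in> borel_measurable (\<mu> \<Otimes>\<^sub>M tape_space)"
    and \<gamma>: "(\<lambda>p. ?\<gamma> (fst p) (snd p)) \<in> borel_measurable (\<mu> \<Otimes>\<^sub>M tape_space)"
    and \<phi>J: "(\<lambda>p. ?\<phi> (fst p) (snd p) * ennreal (lik r ?J (fst p) (snd p))) \<in> borel_measurable (\<mu> \<Otimes>\<^sub>M tape_space)"
    and \<gamma>J: "(\<lambda>p. ?\<gamma> (fst p) (snd p) * ennreal (lik r ?J (fst p) (snd p))) \<in> borel_measurable (\<mu> \<Otimes>\<^sub>M tape_space)"
    and \<gamma>n: "(\<lambda>p. ?\<gamma> (fst p) (snd p) * ennreal (lik r {..<n} (fst p) (snd p))) \<in> borel_measurable (\<mu> \<Otimes>\<^sub>M tape_space)"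
    by measurable
  have ind2: "indicator E v * ennreal a \<le> ennreal 2" if "a \<le> 2" for v a
    using ennreal_leI[OF that] by (simp split: split_indicator)
  have \<phi>2: "?\<phi> x v \<le> ennreal 2" for x v
    using marg_bounds[OF i, of g v] by (intro ind2) auto
  have \<gamma>2: "?\<gamma> x v \<le> ennreal 2" if "x \<in> space \<mu>" for x v
    using marg_bounds[OF i, of g v] cond_bounds[OF i that, of g v] by (intro ind2) auto
  have "(\<integral>\<^sup>+x. (\<integral>\<^sup>+v. ?\<phi> x v * ennreal (lik r {..<n} x v) \<partial>tape_space) \<partial>\<mu>) \<le>
      ennreal (exp \<epsilon>) * (\<integral>\<^sup>+x. (\<integral>\<^sup>+v. ?\<phi> x v * ennreal (lik r ?J x v) \<partial>tape_space) \<partial>\<mu>) + ennreal (2 * \<delta>)"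
    by (intro nn_integral_add_const nn_integral_snd_measurable \<phi>J privacy_remove[OF i] \<phi>2
        slice_measurable[of ?\<phi>, OF \<phi>])
  \<comment> \<open>Fubini: with the tape fixed, the query is a fixed function, and conditioning on
    the other coordinates applies to the inner integral over the sample.\<close>
  also have "(\<integral>\<^sup>+x. (\<integral>\<^sup>+v. ?\<phi> x v * ennreal (lik r ?J x v) \<partial>tape_space) \<partial>\<mu>) =
      (\<integral>\<^sup>+v. (\<integral>\<^sup>+x. ?\<phi> x v * ennreal (lik r ?J x v) \<partial>\<mu>) \<partial>tape_space)"
    by (rule mu_tape.Fubini'[symmetric]) (use \<phi>J in \<open>simp add: case_prod_beta'\<close>)
  also have "\<dots> = (\<integral>\<^sup>+v. (\<integral>\<^sup>+x. ?\<gamma> x v * ennreal (lik r ?J x v) \<partial>\<mu>) \<partial>tape_space)"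
  proof (rule nn_integral_cong)
    fix v
    show "(\<integral>\<^sup>+x. ?\<phi> x v * ennreal (lik r ?J x v) \<partial>\<mu>) = (\<integral>\<^sup>+x. ?\<gamma> x v * ennreal (lik r ?J x v) \<partial>\<mu>)"
      using resample_coord[OF g i, of v] by (cases "v \<in> E") simp_all
  qed
  also have "\<dots> = (\<integral>\<^sup>+x. (\<integral>\<^sup>+v. ?\<gamma> x v * ennreal (lik r ?J x v) \<partial>tape_space) \<partial>\<mu>)"
    by (rule mu_tape.Fubini') (use \<gamma>J in \<open>simp add: case_prod_beta'\<close>)
  also have "\<dots> \<le> ennreal (exp \<epsilon>) *
      (\<integral>\<^sup>+x. (\<integral>\<^sup>+v. ?\<gamma> x v * ennreal (lik r {..<n} x v) \<partial>tape_space) \<partial>\<mu>) + ennreal (2 * \<delta>)"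
    by (intro nn_integral_add_const nn_integral_snd_measurable \<gamma>n privacy_restore[OF i] \<gamma>2
        slice_measurable[of ?\<gamma>, OF \<gamma>])
  finally show ?thesis by (auto simp: add_right_mono mult_left_mono)
qed

end

end

section \<open>Accuracy of one round\<close>

text \<open>The choice of \<epsilon> gives exp (2 \<epsilon>) \<le> 1 + \<alpha> / 8, which raises
  the term (1 + \<psi>) P by at most \<alpha> P / 4. Against the 3 \<alpha> / 4 on the left,
  \<alpha> P / 2 remains to be paid for by 6 \<delta> + 3 \<eta>.\<close>

lemma accuracy_arithmetic:
  fixes \<alpha> \<psi> \<epsilon> \<delta> \<eta> P :: real
  assumes \<alpha>: "0 < \<alpha>" "\<alpha> \<le> 1" and \<psi>: "0 \<le> \<psi>" "\<psi> \<le> 1" and nonneg: "0 \<le> P" "0 \<le> \<delta>" "0 \<le> \<eta>"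
    and \<epsilon>: "\<epsilon> = \<alpha> / 32"
    and le: "(1 + (3 * \<alpha> / 4 + \<psi>)) * P \<le>
      exp \<epsilon> * (exp \<epsilon> * ((1 + \<psi>) * P) + 2 * \<delta>) + 2 * \<delta> + (1 + (3 * \<alpha> / 4 + \<psi>)) * \<eta>"
  shows "P \<le> (12 * \<delta> + 6 * \<eta>) / \<alpha>"
proof -
  have e: "exp \<epsilon> * exp \<epsilon> \<le> 1 + \<alpha> / 8"
  proof -
    have "exp (2 * \<epsilon>) \<le> 1 + 2 * \<epsilon> + (2 * \<epsilon>)\<^sup>2"
      by (rule exp_bound) (use \<alpha> \<epsilon> in auto)
    also have "(2 * \<epsilon>)\<^sup>2 \<le> 2 * \<epsilon>"
      unfolding power2_eq_square by (rule mult_left_le) (use \<alpha> \<epsilon> in auto)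
    finally have "exp (2 * \<epsilon>) \<le> 1 + 4 * \<epsilon>" by simp
    moreover have "exp \<epsilon> * exp \<epsilon> = exp (2 * \<epsilon>)" by (simp add: exp_add[symmetric])
    ultimately show ?thesis using \<epsilon> by linarith
  qed
  have e1: "exp \<epsilon> \<le> 2"
  proof -
    have "exp \<epsilon> * 1 \<le> exp \<epsilon> * exp \<epsilon>" by (rule mult_left_mono) (use \<alpha> \<epsilon> in auto)
    then show ?thesis using e \<alpha> by linarith
  qed
  have "exp \<epsilon> * exp \<epsilon> * ((1 + \<psi>) * P) \<le> (1 + \<alpha> / 8) * ((1 + \<psi>) * P)"
    by (intro mult_right_mono e mult_nonneg_nonneg) (use \<psi> nonneg in auto)
  also have "\<dots> = (1 + \<psi>) * P + \<alpha> / 8 * ((1 + \<psi>) * P)" by (simp add: algebra_simps)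
  also have "\<alpha> / 8 * ((1 + \<psi>) * P) \<le> \<alpha> / 8 * (2 * P)"
    by (intro mult_left_mono mult_right_mono) (use \<psi> \<alpha> nonneg in auto)
  finally have 1: "exp \<epsilon> * exp \<epsilon> * ((1 + \<psi>) * P) \<le> (1 + \<psi>) * P + \<alpha> * P / 4"
    by (simp add: mult.commute)
  have 2: "exp \<epsilon> * (2 * \<delta>) \<le> 2 * (2 * \<delta>)"
    by (intro mult_right_mono e1) (use nonneg in auto)
  have 3: "(1 + (3 * \<alpha> / 4 + \<psi>)) * \<eta> \<le> 3 * \<eta>"
    by (intro mult_right_mono) (use \<psi> \<alpha> nonneg in auto)
  have "(1 + (3 * \<alpha> / 4 + \<psi>)) * P = (1 + \<psi>) * P + 3 * (\<alpha> * P) / 4"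
    by (simp add: algebra_simps)
  moreover from le have "(1 + (3 * \<alpha> / 4 + \<psi>)) * P \<le>
      exp \<epsilon> * exp \<epsilon> * ((1 + \<psi>) * P) + exp \<epsilon> * (2 * \<delta>) + 2 * \<delta> + (1 + (3 * \<alpha> / 4 + \<psi>)) * \<eta>"
    by (simp only: distrib_left mult.assoc)
  ultimately have "\<alpha> * P / 2 \<le> 6 * \<delta> + 3 * \<eta>"
    using 1 2 3 by linarith
  then show ?thesis using \<alpha> by (simp add: field_simps)
qed

context gibbs_sample
begin

lemma query_mean_eq_marg:
  assumes g: "Measurable.pred (tape_space \<Otimes>\<^sub>M borel) (\<lambda>p. g (fst p) (snd p))"
  shows "query_mean n \<mu> (g v) = (\<Sum>i<n. marg g i v) / n"
proof -
  note B = query_sets[OF g, of v]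
  have meas: "{x \<in> space \<mu>. g v (x i)} \<in> sets \<mu>" if "i < n" for i
    using measurable_sets[OF coord_measurable[OF that] B] by (simp add: vimage_def Collect_conj_eq Int_commute)
  have int: "integrable \<mu> (\<lambda>x. of_bool (g v (x i)) :: real)"
    and val: "(\<integral>x. of_bool (g v (x i)) \<partial>\<mu>) = marg g i v" if "i < n" for i
  proof -
    have ind: "(of_bool (g v (x i)) :: real) = indicator {x \<in> space \<mu>. g v (x i)} x" if "x \<in> space \<mu>" for x
      using that by (simp add: indicator_def)
    have "integrable \<mu> (indicator {x \<in> space \<mu>. g v (x i)} :: _ \<Rightarrow> real)"
      using meas[OF that] by (simp add: mu.emeasure_finite less_top[symmetric])
    then show "integrable \<mu> (\<lambda>x. of_bool (g v (x i)) :: real)"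
      by (subst Bochner_Integration.integrable_cong[OF refl ind])
    have "(\<integral>x. of_bool (g v (x i)) \<partial>\<mu>) = (\<integral>x. indicator {x \<in> space \<mu>. g v (x i)} x \<partial>\<mu>)"
      by (rule Bochner_Integration.integral_cong[OF refl]) (simp add: indicator_def)
    also have "\<dots> = measure \<mu> {x \<in> space \<mu>. g v (x i)}" using meas[OF that] by simp
    also have "{x \<in> space \<mu>. g v (x i)} = (\<lambda>x. x i) -` {y. g v y} \<inter> space \<mu>" by auto
    also have "measure \<mu> \<dots> = marg g i v"
      unfolding marg_def marginal_def
      by (rule measure_distr[symmetric, OF coord_measurable[OF that] B])
    finally show "(\<integral>x. of_bool (g v (x i)) \<partial>\<mu>) = marg g i v" .
  qed
  show ?thesis
    unfolding query_mean_def query_avg_def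
    using int val by (simp add: Bochner_Integration.integral_sum del: sum_of_bool_eq)
qed

lemma lik_prob: "(\<integral>\<^sup>+v. ennreal (lik r J x v) \<partial>tape_space) = 1"
  using nn_integral_adaptive_shift[OF predictable_sample_shift[OF A], of "\<lambda>_. 1" r n k J x "k * n"]
  by (simp add: tape.emeasure_space_1[simplified])

text \<open>Summed over the coordinates, \<open>coordinate_bound\<close> bounds the correlation between the event
  \<open>E\<close> and the deviation of the sample average of \<open>g\<close> from its mean by little more than \<open>\<psi>\<close> times the
  probability of \<open>E\<close>. If \<open>E\<close> forces a larger deviation, \<open>E\<close> must be rare.\<close>

lemma one_sided:
  fixes r :: real and t :: nat and \<epsilon> \<delta> \<eta> \<alpha> :: real
  assumes t: "t * (1 / (sqrt (sqrt (real k)) * real n)) \<le> 1"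
    and \<delta>: "exp (- (t * \<epsilon>)) *
      (1 + (t + (real t)\<^sup>2) * (1 / (sqrt (sqrt (real k)) * real n))\<^sup>2) ^ (k * n) \<le> \<delta>"
    and E: "E \<in> sets tape_space"
    and g: "Measurable.pred (tape_space \<Otimes>\<^sub>M borel) (\<lambda>p. g (fst p) (snd p))"
    and \<alpha>: "0 < \<alpha>" "\<alpha> \<le> 1" and \<epsilon>: "\<epsilon> = \<alpha> / 32"
    and \<eta>: "emeasure tape_space {\<omega>. \<alpha> / 4 < \<bar>noise n k j \<omega>\<bar>} \<le> ennreal \<eta>" "0 \<le> \<eta>"
    and gap: "\<And>x \<omega>. x \<in> space \<mu> \<Longrightarrow> (\<And>m. 0 < \<omega> m \<and> \<omega> m < 1) \<Longrightarrow>
      \<bar>noise n k j \<omega>\<bar> \<le> \<alpha> / 4 \<Longrightarrow>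
      adaptive_shift (sample_shift (A r) n k {..<n} x) (k * n) \<omega> \<in> E \<Longrightarrow>
      3 * \<alpha> / 4 + \<psi> \<le> query_avg n (g (adaptive_shift (sample_shift (A r) n k {..<n} x) (k * n) \<omega>)) x -
        query_mean n \<mu> (g (adaptive_shift (sample_shift (A r) n k {..<n} x) (k * n) \<omega>))"
  shows "(\<integral>\<^sup>+x. (\<integral>\<^sup>+v. indicator E v * ennreal (lik r {..<n} x v) \<partial>tape_space) \<partial>\<mu>)
    \<le> ennreal ((12 * \<delta> + 6 * \<eta>) / \<alpha>)"
proof -
  let ?L = "\<lambda>x v. ennreal (lik r {..<n} x v)"
  let ?marg = "marg g" and ?cond = "cond g"
  let ?\<phi> = "\<lambda>i x v. indicator E v * ennreal (of_bool (g v (x i)) + (1 - ?marg i v))"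
  let ?\<gamma> = "\<lambda>i x v. indicator E v * ennreal (?cond i x v + (1 - ?marg i v))"
  define p where "p = (\<integral>\<^sup>+x. (\<integral>\<^sup>+v. indicator E v * ?L x v \<partial>tape_space) \<partial>\<mu>)"
  \<comment> \<open>On \<open>E\<close> the answer is off by \<alpha> + \<psi>; noise of size at
    most \<alpha> / 4 leaves this much for the empirical mean.\<close>
  define c where "c = 3 * \<alpha> / 4 + \<psi>"
  obtain x0 where x0: "x0 \<in> space \<mu>" using mu.not_empty by blast
  note \<psi>01 = \<psi>_nonneg[OF x0] \<psi>_le_1[OF x0]
  have c: "0 \<le> c" using \<psi>01 \<alpha> by (simp add: c_def)
  have [measurable]: "(\<lambda>p. indicator E (snd p) :: ennreal) \<in> borel_measurable (\<mu> \<Otimes>\<^sub>M tape_space)"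
    by (rule measurable_compose[OF measurable_snd]) (use E in measurable)
  have [measurable]: "(\<lambda>p. ?marg i (snd p)) \<in> borel_measurable (\<mu> \<Otimes>\<^sub>M tape_space)" if "i < n" for i
    by (rule measurable_compose[OF measurable_snd marg_measurable[OF g that]])
  note [measurable] = of_bool_g_measurable[OF g] cond_measurable[OF g] lik_measurable[OF order_refl]
  have \<phi>: "(\<lambda>p. ?\<phi> i (fst p) (snd p)) \<in> borel_measurable (\<mu> \<Otimes>\<^sub>M tape_space)"
    and \<phi>L: "(\<lambda>p. ?\<phi> i (fst p) (snd p) * ?L (fst p) (snd p)) \<in> borel_measurable (\<mu> \<Otimes>\<^sub>M tape_space)"
    and \<gamma>L: "(\<lambda>p. ?\<gamma> i (fst p) (snd p) * ?L (fst p) (snd p)) \<in> borel_measurable (\<mu> \<Otimes>\<^sub>M tape_space)"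
    if [simp]: "i < n" for i
    by measurable
  have EL: "(\<lambda>p. indicator E (snd p) * ?L (fst p) (snd p)) \<in> borel_measurable (\<mu> \<Otimes>\<^sub>M tape_space)"
    by measurable
  \<comment> \<open>The size of the noise is a property of the raw tape, so the likelihood is traded
    back for the shifted tape \<open>Y\<close>. On \<open>E\<close> with small noise the sum of the
    integrands is at least n (1 + c); raw tapes with large noise cost at most n (1 + c)
    \<eta>.\<close>
  have lower: "ennreal (n * (1 + c)) * (\<integral>\<^sup>+v. indicator E v * ?L x v \<partial>tape_space) \<le>
      (\<Sum>i<n. \<integral>\<^sup>+v. ?\<phi> i x v * ?L x v \<partial>tape_space) + ennreal (n * (1 + c) * \<eta>)"
    if x: "x \<in> space \<mu>" for x
  proof -
    define Y where "Y = adaptive_shift (sample_shift (A r) n k {..<n} x) (k * n)"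
    note P = predictable_sample_shift[OF A, of r n k "{..<n}" x]
    have Y: "Y \<in> tape_space \<rightarrow>\<^sub>M tape_space"
      unfolding Y_def by (rule measurable_adaptive_shift[OF P])
    define G where "G v = (\<Sum>i<n. ?\<phi> i x v)" for v
    have \<phi>x: "?\<phi> i x \<in> borel_measurable tape_space" if "i < n" for i
      by (rule slice_measurable[of "?\<phi> i", OF \<phi>[OF that] x])
    then have G [measurable]: "G \<in> borel_measurable tape_space"
      unfolding G_def by (intro borel_measurable_sum) auto
    have G_eq: "G v = indicator E v * ennreal (n * (1 + (query_avg n (g v) x - query_mean n \<mu> (g v))))" for v
    proof -
      have "(\<Sum>i<n. of_bool (g v (x i)) + (1 - ?marg i v)) =
          n * (1 + (query_avg n (g v) x - query_mean n \<mu> (g v)))"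
        using n unfolding query_mean_eq_marg[OF g] query_avg_def
        by (simp add: sum.distrib sum_subtractf field_simps del: sum_of_bool_eq)
      then show ?thesis
        unfolding G_def sum_distrib_left[symmetric]
        using marg_bounds[of _ g v] by (subst sum_ennreal) auto
    qed
    have [measurable]: "(\<lambda>\<omega>. indicator E (Y \<omega>) :: ennreal) \<in> borel_measurable tape_space"
      by (rule measurable_compose[OF Y]) (use E in measurable)
    have bad: "{\<omega>. \<alpha> / 4 < \<bar>noise n k j \<omega>\<bar>} \<in> sets tape_space"
    proof -
      have "Measurable.pred tape_space (\<lambda>\<omega>. \<alpha> / 4 < \<bar>noise n k j \<omega>\<bar>)" by measurable
      then show ?thesis by (simp add: pred_def)
    qed
    have "ennreal (n * (1 + c)) * (\<integral>\<^sup>+v. indicator E v * ?L x v \<partial>tape_space) =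
        ennreal (n * (1 + c)) * (\<integral>\<^sup>+\<omega>. indicator E (Y \<omega>) \<partial>tape_space)"
      unfolding Y_def using E by (subst nn_integral_adaptive_shift[OF P]) auto
    also have "\<dots> = (\<integral>\<^sup>+\<omega>. ennreal (n * (1 + c)) * indicator E (Y \<omega>) \<partial>tape_space)"
      by (rule nn_integral_cmult[symmetric]) measurable
    also have "\<dots> \<le> (\<integral>\<^sup>+\<omega>. G (Y \<omega>) + ennreal (n * (1 + c)) *
        indicator {\<omega>. \<alpha> / 4 < \<bar>noise n k j \<omega>\<bar>} \<omega> \<partial>tape_space)"
    proof (rule nn_integral_mono_AE)
      show "AE \<omega> in tape_space. ennreal (n * (1 + c)) * indicator E (Y \<omega>) \<le>
          G (Y \<omega>) + ennreal (n * (1 + c)) * indicator {\<omega>. \<alpha> / 4 < \<bar>noise n k j \<omega>\<bar>} \<omega>"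
        using AE_tape_space
      proof eventually_elim
        case (elim \<omega>)
        show ?case
        proof (cases "Y \<omega> \<in> E \<and> \<bar>noise n k j \<omega>\<bar> \<le> \<alpha> / 4")
          case True
          then have "c \<le> query_avg n (g (Y \<omega>)) x - query_mean n \<mu> (g (Y \<omega>))"
            unfolding c_def Y_def using elim by (intro gap[OF x]) auto
          then have "ennreal (n * (1 + c)) \<le>
              ennreal (n * (1 + (query_avg n (g (Y \<omega>)) x - query_mean n \<mu> (g (Y \<omega>)))))"
            by (intro ennreal_leI mult_left_mono) auto
          then show ?thesis using True by (simp add: G_eq)
        next
          case False
          then show ?thesis by (auto split: split_indicator)
        qed
      qed
    qed
    also have "\<dots> = (\<integral>\<^sup>+\<omega>. G (Y \<omega>) \<partial>tape_space) +
        ennreal (n * (1 + c)) * emeasure tape_space {\<omega>. \<alpha> / 4 < \<bar>noise n k j \<omega>\<bar>}"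
      using bad measurable_compose[OF Y G]
      by (subst nn_integral_add) (auto simp: nn_integral_cmult)
    also have "(\<integral>\<^sup>+\<omega>. G (Y \<omega>) \<partial>tape_space) = (\<integral>\<^sup>+v. G v * ?L x v \<partial>tape_space)"
      unfolding Y_def by (rule nn_integral_adaptive_shift[OF P G])
    also have "\<dots> = (\<Sum>i<n. \<integral>\<^sup>+v. ?\<phi> i x v * ?L x v \<partial>tape_space)"
      unfolding G_def sum_distrib_right
      by (rule nn_integral_sum) (auto intro: slice_measurable[of "\<lambda>x v. ?\<phi> i x v * ?L x v" for i, OF \<phi>L x])
    also have "ennreal (n * (1 + c)) * emeasure tape_space {\<omega>. \<alpha> / 4 < \<bar>noise n k j \<omega>\<bar>} \<le>
        ennreal (n * (1 + c)) * ennreal \<eta>"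
      by (rule mult_left_mono[OF \<eta>(1)]) simp
    also have "\<dots> = ennreal (n * (1 + c) * \<eta>)"
      using c \<eta>(2) by (simp add: ennreal_mult)
    finally show ?thesis by (simp add: add_left_mono)
  qed
  \<comment> \<open>In each coordinate the conditional mean exceeds the marginal mean by at most
    their total variation distance. These distances sum to at most n \<psi> for every single
    \<open>x\<close>, so the bound survives the weighting by \<open>E\<close> and the
    likelihood.\<close>
  have upper: "(\<Sum>i<n. \<integral>\<^sup>+x. (\<integral>\<^sup>+v. ?\<gamma> i x v * ?L x v \<partial>tape_space) \<partial>\<mu>) \<le> ennreal (n * (1 + \<psi>)) * p"
  proof -
    have "(\<Sum>i<n. \<integral>\<^sup>+x. (\<integral>\<^sup>+v. ?\<gamma> i x v * ?L x v \<partial>tape_space) \<partial>\<mu>) =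
        (\<integral>\<^sup>+x. (\<Sum>i<n. \<integral>\<^sup>+v. ?\<gamma> i x v * ?L x v \<partial>tape_space) \<partial>\<mu>)"
      by (rule nn_integral_sum[symmetric]) (auto intro: nn_integral_snd_measurable[of "\<lambda>x v. ?\<gamma> i x v * ?L x v" for i, OF \<gamma>L])
    also have "\<dots> \<le> (\<integral>\<^sup>+x. ennreal (n * (1 + \<psi>)) * (\<integral>\<^sup>+v. indicator E v * ?L x v \<partial>tape_space) \<partial>\<mu>)"
    proof (rule nn_integral_mono)
      fix x assume x: "x \<in> space \<mu>"
      have "(\<Sum>i<n. \<integral>\<^sup>+v. ?\<gamma> i x v * ?L x v \<partial>tape_space) = (\<integral>\<^sup>+v. (\<Sum>i<n. ?\<gamma> i x v * ?L x v) \<partial>tape_space)"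
        by (rule nn_integral_sum[symmetric]) (auto intro: slice_measurable[of "\<lambda>x v. ?\<gamma> i x v * ?L x v" for i, OF \<gamma>L x])
      also have "\<dots> \<le> (\<integral>\<^sup>+v. ennreal (n * (1 + \<psi>)) * (indicator E v * ?L x v) \<partial>tape_space)"
      proof (rule nn_integral_mono)
        fix v
        have "(\<Sum>i<n. ?cond i x v + (1 - ?marg i v)) \<le>
            (\<Sum>i<n. 1 + tv_dist (marginal \<mu> i) (\<kappa> i (drop_coord n i x)))"
        proof (rule sum_mono)
          fix i assume "i \<in> {..<n}"
          then have i: "i < n" by simp
          have "\<bar>measure (marginal \<mu> i) {y. g v y} - measure (\<kappa> i (drop_coord n i x)) {y. g v y}\<bar>
              \<le> tv_dist (marginal \<mu> i) (\<kappa> i (drop_coord n i x))"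
            by (rule tv_dist_upper[OF marginal_prob[OF i] \<kappa>_prob(1)[OF i drop_space[OF x]]])
              (simp add: query_sets[OF g])
          then show "?cond i x v + (1 - ?marg i v) \<le> 1 + tv_dist (marginal \<mu> i) (\<kappa> i (drop_coord n i x))"
            unfolding cond_def marg_def by linarith
        qed
        also have "\<dots> \<le> n * (1 + \<psi>)"
          using sum_tv_le[OF x] by (simp add: sum.distrib algebra_simps)
        finally have le: "(\<Sum>i<n. ?cond i x v + (1 - ?marg i v)) \<le> n * (1 + \<psi>)" .
        have "(\<Sum>i<n. ?\<gamma> i x v * ?L x v) =
            indicator E v * ennreal (\<Sum>i<n. ?cond i x v + (1 - ?marg i v)) * ?L x v"
        proof -
          have "ennreal (\<Sum>i<n. ?cond i x v + (1 - ?marg i v)) = (\<Sum>i<n. ennreal (?cond i x v + (1 - ?marg i v)))"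
            using marg_bounds[of _ g v] cond_bounds[OF _ x, of _ g v]
            by (intro sum_ennreal[symmetric]) auto
          then show ?thesis by (simp only: sum_distrib_left sum_distrib_right)
        qed
        also have "\<dots> \<le> indicator E v * ennreal (n * (1 + \<psi>)) * ?L x v"
          by (intro mult_right_mono mult_left_mono ennreal_leI le) auto
        finally show "(\<Sum>i<n. ?\<gamma> i x v * ?L x v) \<le> ennreal (n * (1 + \<psi>)) * (indicator E v * ?L x v)"
          by (simp add: mult_ac)
      qed
      also have "\<dots> = ennreal (n * (1 + \<psi>)) * (\<integral>\<^sup>+v. indicator E v * ?L x v \<partial>tape_space)"
        by (rule nn_integral_cmult) (rule slice_measurable[of "\<lambda>x v. indicator E v * ?L x v", OF EL x])
      finally show "(\<Sum>i<n. \<integral>\<^sup>+v. ?\<gamma> i x v * ?L x v \<partial>tape_space) \<le>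
          ennreal (n * (1 + \<psi>)) * (\<integral>\<^sup>+v. indicator E v * ?L x v \<partial>tape_space)" .
    qed
    also have "\<dots> = ennreal (n * (1 + \<psi>)) * p"
      unfolding p_def by (rule nn_integral_cmult)
        (rule nn_integral_snd_measurable[of "\<lambda>x v. indicator E v * ?L x v", OF EL])
    finally show ?thesis .
  qed
  have \<delta>0: "0 \<le> \<delta>"
    by (rule order_trans[OF _ \<delta>]) (intro mult_nonneg_nonneg zero_le_power add_nonneg_nonneg, auto)
  have "ennreal (n * (1 + c)) * p =
      (\<integral>\<^sup>+x. ennreal (n * (1 + c)) * (\<integral>\<^sup>+v. indicator E v * ?L x v \<partial>tape_space) \<partial>\<mu>)"
    unfolding p_def by (rule nn_integral_cmult[symmetric])
      (rule nn_integral_snd_measurable[of "\<lambda>x v. indicator E v * ?L x v", OF EL])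
  also have "\<dots> \<le> ennreal 1 * (\<integral>\<^sup>+x. (\<Sum>i<n. \<integral>\<^sup>+v. ?\<phi> i x v * ?L x v \<partial>tape_space) \<partial>\<mu>) + ennreal (n * (1 + c) * \<eta>)"
    by (rule nn_integral_add_const)
      (use lower in \<open>auto intro!: borel_measurable_sum nn_integral_snd_measurable[of "\<lambda>x v. ?\<phi> i x v * ?L x v" for i, OF \<phi>L]\<close>)
  also have "(\<integral>\<^sup>+x. (\<Sum>i<n. \<integral>\<^sup>+v. ?\<phi> i x v * ?L x v \<partial>tape_space) \<partial>\<mu>) =
      (\<Sum>i<n. \<integral>\<^sup>+x. (\<integral>\<^sup>+v. ?\<phi> i x v * ?L x v \<partial>tape_space) \<partial>\<mu>)"
    by (rule nn_integral_sum) (auto intro: nn_integral_snd_measurable[of "\<lambda>x v. ?\<phi> i x v * ?L x v" for i, OF \<phi>L])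
  also have "\<dots> \<le> (\<Sum>i<n. ennreal (exp \<epsilon>) * (ennreal (exp \<epsilon>) *
      (\<integral>\<^sup>+x. (\<integral>\<^sup>+v. ?\<gamma> i x v * ?L x v \<partial>tape_space) \<partial>\<mu>) + ennreal (2 * \<delta>)) + ennreal (2 * \<delta>))"
    by (intro sum_mono coordinate_bound[OF t \<delta> E g]) simp
  also have "\<dots> = ennreal (exp \<epsilon>) * (ennreal (exp \<epsilon>) *
      (\<Sum>i<n. \<integral>\<^sup>+x. (\<integral>\<^sup>+v. ?\<gamma> i x v * ?L x v \<partial>tape_space) \<partial>\<mu>) + ennreal (n * (2 * \<delta>))) + ennreal (n * (2 * \<delta>))"
    using \<delta>0 by (simp add: sum.distrib sum_distrib_left[symmetric] ennreal_mult ennreal_of_nat_eq_real_of_nat)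
  also have "\<dots> \<le> ennreal (exp \<epsilon>) * (ennreal (exp \<epsilon>) *
      (ennreal (n * (1 + \<psi>)) * p) + ennreal (n * (2 * \<delta>))) + ennreal (n * (2 * \<delta>))"
    by (intro add_right_mono mult_left_mono upper) auto
  finally have main: "ennreal (n * (1 + c)) * p \<le> ennreal (exp \<epsilon>) * (ennreal (exp \<epsilon>) *
      (ennreal (n * (1 + \<psi>)) * p) + ennreal (n * (2 * \<delta>))) + ennreal (n * (2 * \<delta>)) + ennreal (n * (1 + c) * \<eta>)"
    by (simp add: add_right_mono)
  \<comment> \<open>\<open>p\<close> occurs on both sides of \<open>main\<close>; its finiteness
    allows the passage to reals, where the two occurrences can be subtracted.\<close>
  have "p \<le> (\<integral>\<^sup>+x. 1 \<partial>\<mu>)"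
    unfolding p_def
  proof (rule nn_integral_mono)
    fix x
    have "(\<integral>\<^sup>+v. indicator E v * ?L x v \<partial>tape_space) \<le> (\<integral>\<^sup>+v. ?L x v \<partial>tape_space)"
      by (intro nn_integral_mono) (auto split: split_indicator)
    then show "(\<integral>\<^sup>+v. indicator E v * ?L x v \<partial>tape_space) \<le> 1" by (simp add: lik_prob)
  qed
  then have p1: "p \<le> 1" by (simp add: mu.emeasure_space_1)
  then obtain P where P: "p = ennreal P" "0 \<le> P"
    by (cases p) (auto simp: top_unique)
  have "ennreal (n * ((1 + c) * P)) \<le> ennreal (n * (exp \<epsilon> * (exp \<epsilon> * ((1 + \<psi>) * P) + 2 * \<delta>) + 2 * \<delta> + (1 + c) * \<eta>))"
    using main P(2) \<psi>01 c \<delta>0 \<eta>(2)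
    by (simp add: P(1) ennreal_mult[symmetric] ennreal_plus[symmetric] algebra_simps del: ennreal_plus)
  then have "n * ((1 + c) * P) \<le> n * (exp \<epsilon> * (exp \<epsilon> * ((1 + \<psi>) * P) + 2 * \<delta>) + 2 * \<delta> + (1 + c) * \<eta>)"
    by (subst (asm) ennreal_le_iff) (use P(2) \<psi>01 c \<delta>0 \<eta>(2) in \<open>auto intro!: mult_nonneg_nonneg add_nonneg_nonneg\<close>)
  then have "(1 + c) * P \<le> exp \<epsilon> * (exp \<epsilon> * ((1 + \<psi>) * P) + 2 * \<delta>) + 2 * \<delta> + (1 + c) * \<eta>"
    using n by simp
  then have "P \<le> (12 * \<delta> + 6 * \<eta>) / \<alpha>"
    unfolding c_def by (rule accuracy_arithmetic[OF \<alpha> \<psi>01 P(2) \<delta>0 \<eta>(2) \<epsilon>])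
  then show ?thesis unfolding p_def[symmetric] P(1) by (rule ennreal_leI)
qed

end

section \<open>Accuracy of all rounds and the sample bound\<close>

lemma query_avg_not: "1 \<le> n \<Longrightarrow> query_avg n (\<lambda>y. \<not> h y) x = 1 - query_avg n h x"
  by (simp add: query_avg_def of_bool_not_iff sum_subtractf diff_divide_distrib del: sum_of_bool_eq)

context gibbs_sample
begin

lemma query_mean_measurable:
  assumes g: "Measurable.pred (tape_space \<Otimes>\<^sub>M borel) (\<lambda>p. g (fst p) (snd p))"
  shows "(\<lambda>v. query_mean n \<mu> (g v)) \<in> borel_measurable tape_space"
  unfolding query_mean_eq_marg[OF g]
  by (intro borel_measurable_divide borel_measurable_sum marg_measurable[OF g] borel_measurable_const) simp

lemma query_mean_not:
  assumes g: "Measurable.pred (tape_space \<Otimes>\<^sub>M borel) (\<lambda>p. g (fst p) (snd p))"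
    and ng: "Measurable.pred (tape_space \<Otimes>\<^sub>M borel) (\<lambda>p. \<not> g (fst p) (snd p))"
  shows "query_mean n \<mu> (\<lambda>y. \<not> g v y) = 1 - query_mean n \<mu> (g v)"
proof -
  have "marg (\<lambda>v y. \<not> g v y) i v = 1 - marg g i v" if "i < n" for i
  proof -
    interpret M: prob_space "marginal \<mu> i" by (rule marginal_prob[OF that])
    have "{y. \<not> g v y} = space (marginal \<mu> i) - {y. g v y}"
      by (auto simp: marginal_def)
    then show ?thesis
      unfolding marg_def using M.prob_compl[of "{y. g v y}"] query_sets[OF g, of v] by simp
  qed
  then have "(\<Sum>i<n. marg (\<lambda>v y. \<not> g v y) i v) = (\<Sum>i<n. 1 - marg g i v)"
    by (intro sum.cong) auto
  then show ?thesis
    unfolding query_mean_eq_marg[OF g] query_mean_eq_marg[of "\<lambda>v y. \<not> g v y", OF ng]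
    using n by (simp add: sum_subtractf diff_divide_distrib)
qed

text \<open>Answers that are too high form \<open>E1\<close>; those that are too low form
  \<open>E2\<close>, to which \<open>one_sided\<close> applies with the negated query, whose
  empirical and true means are one minus the original ones. The two signs give the factor 2.\<close>

lemma round_bound:
  fixes r :: real and t :: nat and \<epsilon> \<delta> \<eta> \<alpha> \<alpha>' a b :: real
  assumes t: "t * (1 / (sqrt (sqrt (real k)) * real n)) \<le> 1"
    and \<delta>: "exp (- (t * \<epsilon>)) *
      (1 + (t + (real t)\<^sup>2) * (1 / (sqrt (sqrt (real k)) * real n))\<^sup>2) ^ (k * n) \<le> \<delta>"
    and \<alpha>: "0 < \<alpha>" "\<alpha> \<le> 1" and \<epsilon>: "\<epsilon> = \<alpha> / 32"
    and \<eta>: "emeasure tape_space {\<omega>. \<alpha> / 4 < \<bar>noise n k j \<omega>\<bar>} \<le> ennreal \<eta>" "0 \<le> \<eta>"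
    and j: "j < k" and \<alpha>': "\<alpha> + \<psi> \<le> \<alpha>'"
  defines "bad \<equiv> \<lambda>x \<omega>. \<alpha>' < \<bar>game_answer (A r) (noisy_mean n k a b \<omega> x) j -
      query_mean n \<mu> (game_query (A r) (noisy_mean n k a b \<omega> x) j)\<bar>"
  shows "(\<integral>\<^sup>+x. (\<integral>\<^sup>+\<omega>. of_bool (bad x \<omega>) \<partial>tape_space) \<partial>\<mu>) \<le> ennreal (2 * ((12 * \<delta> + 6 * \<eta>) / \<alpha>))"
proof -
  let ?H = "null_query (A r) n k j"
  let ?m = "\<lambda>v. query_mean n \<mu> (?H v)"
  let ?Y = "\<lambda>x. adaptive_shift (sample_shift (A r) n k {..<n} x) (k * n)"
  define E1 where "E1 = {v. \<alpha> + \<psi> < noise n k j v - ?m v}"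
  define E2 where "E2 = {v. \<alpha> + \<psi> < ?m v - noise n k j v}"
  have g1: "Measurable.pred (tape_space \<Otimes>\<^sub>M borel) (\<lambda>p. ?H (fst p) (snd p))"
    by (rule measurable_null_query[OF A measurable_fst measurable_snd])
  then have g2: "Measurable.pred (tape_space \<Otimes>\<^sub>M borel) (\<lambda>p. \<not> ?H (fst p) (snd p))"
    by measurable
  note [measurable] = query_mean_measurable[OF g1]
  have "Measurable.pred tape_space (\<lambda>v. \<alpha> + \<psi> < noise n k j v - ?m v)"
    "Measurable.pred tape_space (\<lambda>v. \<alpha> + \<psi> < ?m v - noise n k j v)"
    by measurable
  then have E: "E1 \<in> sets tape_space" "E2 \<in> sets tape_space"
    by (auto simp: E1_def E2_def pred_def)
  have \<delta>0: "0 \<le> \<delta>"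
    by (rule order_trans[OF _ \<delta>]) (intro mult_nonneg_nonneg zero_le_power add_nonneg_nonneg, auto)
  have 1: "(\<integral>\<^sup>+x. (\<integral>\<^sup>+v. indicator E1 v * ennreal (lik r {..<n} x v) \<partial>tape_space) \<partial>\<mu>)
    \<le> ennreal ((12 * \<delta> + 6 * \<eta>) / \<alpha>)"
  proof (rule one_sided[OF t \<delta> E(1) g1 \<alpha> \<epsilon> \<eta>])
    fix x and \<omega> :: tape
    assume \<omega>: "\<And>m. 0 < \<omega> m \<and> \<omega> m < 1" and "\<bar>noise n k j \<omega>\<bar> \<le> \<alpha> / 4" "?Y x \<omega> \<in> E1"
    then show "3 * \<alpha> / 4 + \<psi> \<le> query_avg n (?H (?Y x \<omega>)) x - ?m (?Y x \<omega>)"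
      using noise_adaptive_shift[OF A n k j \<omega>, of r x] by (simp add: E1_def)
  qed
  have 2: "(\<integral>\<^sup>+x. (\<integral>\<^sup>+v. indicator E2 v * ennreal (lik r {..<n} x v) \<partial>tape_space) \<partial>\<mu>)
    \<le> ennreal ((12 * \<delta> + 6 * \<eta>) / \<alpha>)"
  proof (rule one_sided[where g = "\<lambda>v y. \<not> ?H v y", OF t \<delta> E(2) g2 \<alpha> \<epsilon> \<eta>])
    fix x and \<omega> :: tape
    assume \<omega>: "\<And>m. 0 < \<omega> m \<and> \<omega> m < 1" and "\<bar>noise n k j \<omega>\<bar> \<le> \<alpha> / 4" "?Y x \<omega> \<in> E2"
    then show "3 * \<alpha> / 4 + \<psi> \<le> query_avg n (\<lambda>y. \<not> ?H (?Y x \<omega>) y) x -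
        query_mean n \<mu> (\<lambda>y. \<not> ?H (?Y x \<omega>) y)"
      unfolding query_avg_not[OF n] query_mean_not[of ?H, OF g1 g2]
      using noise_adaptive_shift[OF A n k j \<omega>, of r x] by (simp add: E2_def)
  qed
  have L: "(\<lambda>p. ennreal (lik r {..<n} (fst p) (snd p))) \<in> borel_measurable (\<mu> \<Otimes>\<^sub>M tape_space)"
    using lik_measurable[OF order_refl, of r] by measurable
  have EL: "(\<lambda>p. indicator F (snd p) * ennreal (lik r {..<n} (fst p) (snd p))) \<in> borel_measurable (\<mu> \<Otimes>\<^sub>M tape_space)"
    if "F \<in> sets tape_space" for F
    using L that by (intro borel_measurable_times_ennreal measurable_compose[OF measurable_snd]) auto
  have "(\<integral>\<^sup>+x. (\<integral>\<^sup>+\<omega>. of_bool (bad x \<omega>) \<partial>tape_space) \<partial>\<mu>) \<le>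
      (\<integral>\<^sup>+x. (\<integral>\<^sup>+v. indicator E1 v * ennreal (lik r {..<n} x v) \<partial>tape_space) +
        (\<integral>\<^sup>+v. indicator E2 v * ennreal (lik r {..<n} x v) \<partial>tape_space) \<partial>\<mu>)"
  proof (rule nn_integral_mono)
    fix x assume x: "x \<in> space \<mu>"
    note P = predictable_sample_shift[OF A, of r n k "{..<n}" x]
    have Y: "?Y x \<in> tape_space \<rightarrow>\<^sub>M tape_space" by (rule measurable_adaptive_shift[OF P])
    have ind: "(\<lambda>\<omega>. indicator F (?Y x \<omega>) :: ennreal) \<in> borel_measurable tape_space"
      if "F \<in> sets tape_space" for F
      by (rule measurable_compose[OF Y]) (use that in auto)
    have "(\<integral>\<^sup>+\<omega>. of_bool (bad x \<omega>) \<partial>tape_space) \<le>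
        (\<integral>\<^sup>+\<omega>. indicator E1 (?Y x \<omega>) + indicator E2 (?Y x \<omega>) \<partial>tape_space)"
    proof (rule nn_integral_mono_AE)
      show "AE \<omega> in tape_space. of_bool (bad x \<omega>) \<le> (indicator E1 (?Y x \<omega>) + indicator E2 (?Y x \<omega>) :: ennreal)"
        using AE_tape_space
      proof eventually_elim
        case (elim \<omega>)
        have "?Y x \<omega> \<in> E1 \<or> ?Y x \<omega> \<in> E2" if "bad x \<omega>"
          using that game_eq_null[OF A n k j, of \<omega> r a b x] elim \<alpha>'
          unfolding bad_def E1_def E2_def by (auto simp: abs_if split: if_splits)
        then show ?case by (auto split: split_indicator)
      qed
    qed
    also have "\<dots> = (\<integral>\<^sup>+\<omega>. indicator E1 (?Y x \<omega>) \<partial>tape_space) + (\<integral>\<^sup>+\<omega>. indicator E2 (?Y x \<omega>) \<partial>tape_space)"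
      by (intro nn_integral_add ind E)
    also have "\<dots> = (\<integral>\<^sup>+v. indicator E1 v * ennreal (lik r {..<n} x v) \<partial>tape_space) +
        (\<integral>\<^sup>+v. indicator E2 v * ennreal (lik r {..<n} x v) \<partial>tape_space)"
      using E by (intro arg_cong2[where f="(+)"] nn_integral_adaptive_shift[OF P]) auto
    finally show "(\<integral>\<^sup>+\<omega>. of_bool (bad x \<omega>) \<partial>tape_space) \<le> \<dots>" .
  qed
  also have "\<dots> = (\<integral>\<^sup>+x. (\<integral>\<^sup>+v. indicator E1 v * ennreal (lik r {..<n} x v) \<partial>tape_space) \<partial>\<mu>) +
      (\<integral>\<^sup>+x. (\<integral>\<^sup>+v. indicator E2 v * ennreal (lik r {..<n} x v) \<partial>tape_space) \<partial>\<mu>)"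
    by (intro nn_integral_add
        nn_integral_snd_measurable[of "\<lambda>x v. indicator E1 v * ennreal (lik r {..<n} x v)", OF EL[OF E(1)]]
        nn_integral_snd_measurable[of "\<lambda>x v. indicator E2 v * ennreal (lik r {..<n} x v)", OF EL[OF E(2)]])
  also have "\<dots> \<le> ennreal ((12 * \<delta> + 6 * \<eta>) / \<alpha>) + ennreal ((12 * \<delta> + 6 * \<eta>) / \<alpha>)"
    by (intro add_mono 1 2)
  also have "\<dots> = ennreal (2 * ((12 * \<delta> + 6 * \<eta>) / \<alpha>))"
    using \<delta>0 \<eta>(2) \<alpha> by (simp add: ennreal_plus[symmetric] del: ennreal_plus)
  finally show ?thesis .
qed

text \<open>By Fubini the seed can be fixed, so a bound for each deterministic adversary
  \<open>A r\<close> suffices; a union bound over the rounds follows.\<close>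

lemma accuracy_event:
  fixes \<rho> :: "real measure" and \<alpha>' a b c :: real
  assumes \<rho>: "prob_space \<rho>" "sets \<rho> = sets borel" and c: "0 \<le> c"
    and round: "\<And>r j. j < k \<Longrightarrow> (\<integral>\<^sup>+x. (\<integral>\<^sup>+\<omega>. of_bool
        (\<alpha>' < \<bar>game_answer (A r) (noisy_mean n k a b \<omega> x) j -
          query_mean n \<mu> (game_query (A r) (noisy_mean n k a b \<omega> x) j)\<bar>) \<partial>tape_space) \<partial>\<mu>) \<le> ennreal c"
  shows "1 - k * c \<le> measure (\<rho> \<Otimes>\<^sub>M (\<mu> \<Otimes>\<^sub>M tape_space))
    {(r, x, \<omega>) \<in> space (\<rho> \<Otimes>\<^sub>M (\<mu> \<Otimes>\<^sub>M tape_space)).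
      \<forall>(h, z) \<in> set (interaction (A r) (noisy_mean n k a b \<omega> x) k). \<bar>z - query_mean n \<mu> h\<bar> \<le> \<alpha>'}"
    (is "_ \<le> measure ?M ?good")
proof -
  interpret rho: prob_space \<rho> by (rule \<rho>(1))
  interpret rmt: pair_prob_space \<rho> "\<mu> \<Otimes>\<^sub>M tape_space" ..
  note [measurable_cong] = \<rho>(2)
  define ans where "ans j p = game_answer (A (fst p)) (noisy_mean n k a b (snd (snd p)) (fst (snd p))) j" for j p
  define qry where "qry j p = game_query (A (fst p)) (noisy_mean n k a b (snd (snd p)) (fst (snd p))) j" for j p
  define bad where "bad j = {p \<in> space ?M. \<alpha>' < \<bar>ans j p - query_mean n \<mu> (qry j p)\<bar>}" for j
  have fst_m: "fst \<in> borel_measurable ?M"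
    using measurable_fst[of \<rho> "\<mu> \<Otimes>\<^sub>M tape_space"] by (simp cong: measurable_cong_sets add: \<rho>(2))
  have tape_m: "(\<lambda>p. snd (snd p)) \<in> ?M \<rightarrow>\<^sub>M tape_space"
    by (rule measurable_compose[OF measurable_snd measurable_snd])
  have x_m: "(\<lambda>p. fst (snd p) l) \<in> ?M \<rightarrow>\<^sub>M borel" if "l < n" for l
    by (rule measurable_compose[OF measurable_compose[OF measurable_snd measurable_fst] coord_measurable[OF that]])
  have ans_m: "ans j \<in> borel_measurable ?M" for j
    unfolding ans_def by (rule measurable_game_answer[OF A fst_m tape_m x_m])
  have mean_m: "(\<lambda>p. query_mean n \<mu> (qry j p)) \<in> borel_measurable ?M" for j
  proof -
    \<comment> \<open>The true mean of a query that depends on the whole state is an integral over a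
      second, independent sample, so the state space is extended by a copy of \<mu>.\<close>
    have "Measurable.pred (?M \<Otimes>\<^sub>M \<mu>) (\<lambda>z. qry j (fst z) (snd z l))" if "l < n" for l
      unfolding qry_def
      by (rule measurable_game_query[OF A fst_m tape_m x_m measurable_compose[OF measurable_snd coord_measurable[OF that]] measurable_fst])
    then have "(\<lambda>z. query_avg n (qry j (fst z)) (snd z)) \<in> borel_measurable (?M \<Otimes>\<^sub>M \<mu>)"
      unfolding query_avg_def
      by (intro borel_measurable_divide borel_measurable_sum measurable_of_bool_pred borel_measurable_const) auto
    then show ?thesis
      unfolding query_mean_def
      by (intro mu.borel_measurable_lebesgue_integral) (simp add: case_prod_beta')
  qed
  have bad_sets: "bad j \<in> sets ?M" for j
  proof -
    note [measurable] = ans_m mean_m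
    show ?thesis unfolding bad_def by measurable
  qed
  have bad_le: "emeasure ?M (bad j) \<le> ennreal c" if "j < k" for j
  proof -
    have f: "(\<lambda>p. indicator (bad j) p :: ennreal) \<in> borel_measurable ?M"
      using bad_sets by simp
    have "emeasure ?M (bad j) = (\<integral>\<^sup>+p. indicator (bad j) p \<partial>?M)"
      using bad_sets by simp
    also have "\<dots> = (\<integral>\<^sup>+r. (\<integral>\<^sup>+y. indicator (bad j) (r, y) \<partial>(\<mu> \<Otimes>\<^sub>M tape_space)) \<partial>\<rho>)"
      by (rule mu_tape.P.nn_integral_fst[symmetric, OF f])
    also have "\<dots> \<le> (\<integral>\<^sup>+r. ennreal c \<partial>\<rho>)"
    proof (rule nn_integral_mono)
      fix r assume r: "r \<in> space \<rho>"
      have fr: "(\<lambda>y. indicator (bad j) (r, y) :: ennreal) \<in> borel_measurable (\<mu> \<Otimes>\<^sub>M tape_space)"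
        by (rule measurable_compose[OF measurable_Pair1'[OF r] f])
      have "(\<integral>\<^sup>+y. indicator (bad j) (r, y) \<partial>(\<mu> \<Otimes>\<^sub>M tape_space)) =
          (\<integral>\<^sup>+x. (\<integral>\<^sup>+\<omega>. indicator (bad j) (r, x, \<omega>) \<partial>tape_space) \<partial>\<mu>)"
        using tape.nn_integral_fst[OF fr] by simp
      also have "\<dots> \<le> (\<integral>\<^sup>+x. (\<integral>\<^sup>+\<omega>. of_bool
        (\<alpha>' < \<bar>game_answer (A r) (noisy_mean n k a b \<omega> x) j -
          query_mean n \<mu> (game_query (A r) (noisy_mean n k a b \<omega> x) j)\<bar>) \<partial>tape_space) \<partial>\<mu>)"
        by (intro nn_integral_mono) (auto simp: bad_def ans_def qry_def split: split_indicator)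
      also have "\<dots> \<le> ennreal c" by (rule round[OF that])
      finally show "(\<integral>\<^sup>+y. indicator (bad j) (r, y) \<partial>(\<mu> \<Otimes>\<^sub>M tape_space)) \<le> ennreal c" .
    qed
    also have "\<dots> = ennreal c" by (simp add: rho.emeasure_space_1)
    finally show ?thesis .
  qed
  have bad_measure: "measure ?M (bad j) \<le> c" if "j < k" for j
    using bad_le[OF that] c by (simp add: rmt.P.emeasure_eq_measure)
  have iff: "(\<forall>(h, z) \<in> set (interaction (A r) (noisy_mean n k a b \<omega> x) k). \<bar>z - query_mean n \<mu> h\<bar> \<le> \<alpha>')
      \<longleftrightarrow> (\<forall>j\<in>{..<k}. (r, x, \<omega>) \<notin> bad j)" if "(r, x, \<omega>) \<in> space ?M" for r x \<omega>
    using that by (auto simp: interaction_eq bad_def ans_def qry_def not_less)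
  have good: "?good = space ?M - (\<Union>j<k. bad j)"
  proof (rule set_eqI)
    fix p :: "real \<times> (nat \<Rightarrow> 'a) \<times> tape"
    obtain r x \<omega> where p: "p = (r, x, \<omega>)" by (cases p)
    show "p \<in> ?good \<longleftrightarrow> p \<in> space ?M - (\<Union>j<k. bad j)"
      unfolding p using iff[of r x \<omega>] by (cases "(r, x, \<omega>) \<in> space ?M") simp_all
  qed
  have U: "(\<Union>j<k. bad j) \<in> sets ?M" using bad_sets by auto
  have "measure ?M (\<Union>j<k. bad j) \<le> (\<Sum>j<k. measure ?M (bad j))"
    by (rule rmt.P.finite_measure_subadditive_finite) (use bad_sets in auto)
  also have "\<dots> \<le> (\<Sum>j<k. c)" by (rule sum_mono) (use bad_measure in auto)
  finally have "measure ?M (\<Union>j<k. bad j) \<le> k * c" by simp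
  then show ?thesis unfolding good using rmt.P.prob_compl[OF U] by simp
qed

end

section \<open>Calibration of the sample size and its soft-O form\<close>

text \<open>If \<delta> and \<eta> both equal \<alpha> \<beta> / (36 k), a round fails with
  probability at most 2 (12 + 6) \<beta> / (36 k) = \<beta> / k. The factor 2 of
  \<open>noise_tail\<close> turns 36 into 72.\<close>

definition sample_bound :: "nat \<Rightarrow> real \<Rightarrow> real \<Rightarrow> real" where
  "sample_bound k \<alpha> \<beta> = 5000 * sqrt k * ln (72 * k / (\<alpha> * \<beta>)) / \<alpha>\<^sup>2"

text \<open>With L the logarithm in \<open>sample_bound\<close>, exp (- L) = \<eta> / 2, so both
  claims need an exponent of size at least L. The privacy term is at most exp (t ((1 + t) V -
  \<alpha> / 32)), where V = sqrt k / n is the sum of the squared shifts over all k n draws.\<close>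

lemma sample_bound_parameters:
  fixes n k :: nat and \<alpha> \<beta> :: real
  assumes n: "1 \<le> n" and k: "1 \<le> k" and \<alpha>: "0 < \<alpha>" "\<alpha> \<le> 1" and \<beta>: "0 < \<beta>" "\<beta> < 1"
    and bound: "sample_bound k \<alpha> \<beta> \<le> n"
  defines "\<eta> \<equiv> \<alpha> * \<beta> / (36 * k)"
  shows "2 * exp (- (\<alpha>\<^sup>2 * n / (256 * sqrt k))) \<le> \<eta>"
    and "\<exists>t::nat. t * (1 / (sqrt (sqrt (real k)) * real n)) \<le> 1 \<and>
      exp (- (t * (\<alpha> / 32))) *
      (1 + (t + (real t)\<^sup>2) * (1 / (sqrt (sqrt (real k)) * real n))\<^sup>2) ^ (k * n) \<le> \<eta>"
proof -
  define L where "L = ln (72 * k / (\<alpha> * \<beta>))"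
  have sk: "1 \<le> sqrt k" using k by simp
  have ab: "0 < \<alpha> * \<beta>" "\<alpha> * \<beta> \<le> 1" using \<alpha> \<beta> by (auto simp: mult_le_one)
  have "exp 1 \<le> (72::real)" using exp_le by linarith
  also have "\<dots> \<le> 72 * k / (\<alpha> * \<beta>)"
  proof -
    have "72 * (\<alpha> * \<beta>) \<le> 72 * k" using ab k by simp
    then show ?thesis using ab by (simp add: field_simps)
  qed
  finally have L1: "1 \<le> L" unfolding L_def by (subst ln_ge_iff) (use k ab in auto)
  have expL: "exp (- L) = \<eta> / 2"
    unfolding L_def \<eta>_def using k ab by (simp add: exp_minus)
  have \<eta>0: "0 < \<eta>" unfolding \<eta>_def using k ab by simp
  have nL: "5000 * sqrt k * L \<le> \<alpha>\<^sup>2 * n"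
    using bound \<alpha> by (simp add: sample_bound_def L_def field_simps)
  have "L \<le> \<alpha>\<^sup>2 * n / (256 * sqrt k)"
  proof -
    have "256 * (sqrt k * L) \<le> 5000 * (sqrt k * L)" using sk L1 by simp
    then show ?thesis using nL sk by (simp add: field_simps)
  qed
  then have "exp (- (\<alpha>\<^sup>2 * n / (256 * sqrt k))) \<le> exp (- L)" by simp
  then show "2 * exp (- (\<alpha>\<^sup>2 * n / (256 * sqrt k))) \<le> \<eta>" using expL by simp
  \<comment> \<open>Once (1 + t) V \<le> \<alpha> / 64, half of the rate \<alpha> / 32 survives, and
    64 L / \<alpha> is the order at which it is worth L. The condition on V is where 5000 \<ge> 66 *
    64 is spent.\<close>
  define t where "t = nat \<lceil>64 * L / \<alpha>\<rceil>"
  have "1 \<le> L / \<alpha>" using L1 \<alpha> by (simp add: field_simps)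
  moreover have tc: "64 * L / \<alpha> \<le> t" "t \<le> 64 * L / \<alpha> + 1"
    using L1 \<alpha> unfolding t_def by (auto simp: le_nat_iff)
  ultimately have t_up: "t \<le> 65 * (L / \<alpha>)" by simp
  define D where "D = sqrt (sqrt (real k)) * real n"
  have ssk: "1 \<le> sqrt (sqrt k)" using k by simp
  have D: "n \<le> D" using ssk n unfolding D_def by simp
  have D2: "D\<^sup>2 = sqrt k * (real n)\<^sup>2" by (simp add: D_def power_mult_distrib)
  have tD: "t \<le> D"
  proof -
    have "65 * (L / \<alpha>) \<le> 5000 * sqrt k * L / \<alpha>\<^sup>2"
    proof -
      have "\<alpha> * (65 * L) \<le> 1 * (65 * L)" using L1 \<alpha> by (intro mult_right_mono) auto
      also have "\<dots> \<le> 1 * (5000 * L)" using L1 by simp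
      also have "\<dots> \<le> sqrt k * (5000 * L)" using sk L1 by (intro mult_right_mono) auto
      finally show ?thesis using \<alpha> by (simp add: field_simps power2_eq_square)
    qed
    also have "\<dots> \<le> n" using nL \<alpha> by (simp add: field_simps)
    finally show ?thesis using t_up D by linarith
  qed
  define V where "V = sqrt k / n"
  have V: "(1 + t) * V \<le> \<alpha> / 64"
  proof -
    have "(1 + t) * V \<le> 66 * (L / \<alpha>) * V"
      using t_up \<open>1 \<le> L / \<alpha>\<close> by (intro mult_right_mono) (auto simp: V_def)
    also have "\<dots> \<le> \<alpha> / 64"
    proof -
      have "66 * L * sqrt k * 64 \<le> 5000 * sqrt k * L" using sk L1 by simp
      then have "66 * L * sqrt k * 64 \<le> \<alpha>\<^sup>2 * n" using nL by linarith
      then show ?thesis using \<alpha> n by (simp add: V_def field_simps power2_eq_square)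
    qed
    finally show ?thesis .
  qed
  have "(1 + (t + (real t)\<^sup>2) * (1 / D)\<^sup>2) ^ (k * n) \<le> exp ((t + (real t)\<^sup>2) * (1 / D)\<^sup>2) ^ (k * n)"
    by (intro power_mono add_nonneg_nonneg mult_nonneg_nonneg) auto
  also have "\<dots> = exp ((t + (real t)\<^sup>2) * V)"
  proof -
    have "sqrt k * sqrt k = real k" by simp
    moreover have "(1 / D)\<^sup>2 = 1 / (sqrt k * (real n)\<^sup>2)" by (simp add: power_divide D2)
    ultimately have "real (k * n) * (1 / D)\<^sup>2 = V"
      using n k by (simp add: V_def field_simps power2_eq_square)
    then show ?thesis by (simp add: exp_of_nat_mult[symmetric] mult_ac)
  qed
  finally have "exp (- (t * (\<alpha> / 32))) * (1 + (t + (real t)\<^sup>2) * (1 / D)\<^sup>2) ^ (k * n) \<le>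
      exp (- (t * (\<alpha> / 32))) * exp ((t + (real t)\<^sup>2) * V)"
    by (intro mult_left_mono) auto
  also have "\<dots> = exp (t * ((1 + t) * V - \<alpha> / 32))"
    by (simp add: exp_add[symmetric] algebra_simps power2_eq_square)
  also have "\<dots> \<le> exp (- L)"
  proof -
    have "t * ((1 + t) * V - \<alpha> / 32) \<le> t * (- \<alpha> / 64)"
      using V by (intro mult_left_mono) auto
    also have "\<dots> \<le> - L" using tc(1) \<alpha> by (simp add: field_simps)
    finally show ?thesis by simp
  qed
  finally have "exp (- (t * (\<alpha> / 32))) * (1 + (t + (real t)\<^sup>2) * (1 / D)\<^sup>2) ^ (k * n) \<le> \<eta>"
    using expL \<eta>0 by linarith
  moreover have "t * (1 / D) \<le> 1" using tD D n by simp
  ultimately show "\<exists>t::nat. t * (1 / (sqrt (sqrt (real k)) * real n)) \<le> 1 \<and>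
      exp (- (t * (\<alpha> / 32))) *
      (1 + (t + (real t)\<^sup>2) * (1 / (sqrt (sqrt (real k)) * real n))\<^sup>2) ^ (k * n) \<le> \<eta>"
    unfolding D_def by blast
qed

lemma noisy_mean_accurate:
  fixes n k :: nat and \<alpha> \<alpha>' \<beta> \<psi> a b :: real
  assumes n: "1 \<le> n" and k: "1 \<le> k" and \<alpha>: "0 < \<alpha>" "\<alpha> \<le> 1" and \<beta>: "0 < \<beta>" "\<beta> < 1"
    and bound: "sample_bound k \<alpha> \<beta> \<le> n" and \<alpha>': "\<alpha> + 2 * \<psi> \<le> \<alpha>'"
  shows "statistically_accurate n k \<psi> \<alpha>' \<beta> (noisy_mean n k a b :: 'a::metric_space mechanism)"
  unfolding statistically_accurate_def
proof (intro allI impI)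
  fix \<mu> :: "(nat \<Rightarrow> 'a) measure" and A :: "'a adversary" and \<rho> :: "real measure"
  assume \<mu>: "measure_on_tuples n \<mu>" and dep: "gibbs_dependent n \<psi> \<mu>" and A: "measurable_adversary A"
    and \<rho>: "prob_space \<rho>" "sets \<rho> = sets borel"
  from dep obtain \<kappa> where \<kappa>_version: "conditional_marginals n \<mu> \<kappa>" "gibbs_dependency n \<mu> \<kappa> \<le> \<psi>"
    by (auto simp: gibbs_dependent_def)
  interpret gibbs_sample n k \<mu> \<kappa> "gibbs_dependency n \<mu> \<kappa>" A
    by unfold_locales (use n k \<mu> \<kappa>_version A in auto)
  obtain x0 where "x0 \<in> space \<mu>" using mu.not_empty by blast
  then have "0 \<le> gibbs_dependency n \<mu> \<kappa>" by (rule \<psi>_nonneg)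
  \<comment> \<open>The rounds are accurate to \<alpha> plus the actual dependency; since that is
    nonnegative, so is its bound \<psi>, and \<alpha> + 2 \<psi> is no smaller.\<close>
  then have \<psi>': "\<alpha> + gibbs_dependency n \<mu> \<kappa> \<le> \<alpha>'" using \<kappa>_version(2) \<alpha>' by linarith
  define \<eta> where "\<eta> = \<alpha> * \<beta> / (36 * k)"
  note params = sample_bound_parameters[OF n k \<alpha> \<beta> bound, folded \<eta>_def]
  obtain t :: nat where t: "t * (1 / (sqrt (sqrt (real k)) * real n)) \<le> 1"
      "exp (- (t * (\<alpha> / 32))) *
        (1 + (t + (real t)\<^sup>2) * (1 / (sqrt (sqrt (real k)) * real n))\<^sup>2) ^ (k * n) \<le> \<eta>"
    using params(2) by blast
  have \<eta>0: "0 \<le> \<eta>" using \<alpha> \<beta> by (simp add: \<eta>_def)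
  have tail: "emeasure tape_space {\<omega>. \<alpha> / 4 < \<bar>noise n k j \<omega>\<bar>} \<le> ennreal \<eta>" for j
    using noise_tail[OF n k \<alpha>, of j] ennreal_leI[OF params(1)] by (rule order_trans)
  have c: "2 * ((12 * \<eta> + 6 * \<eta>) / \<alpha>) = \<beta> / k"
    using \<alpha> k by (simp add: \<eta>_def field_simps)
  have "1 - k * (\<beta> / k) \<le> measure (\<rho> \<Otimes>\<^sub>M (\<mu> \<Otimes>\<^sub>M tape_space))
    {(r, x, \<omega>) \<in> space (\<rho> \<Otimes>\<^sub>M (\<mu> \<Otimes>\<^sub>M tape_space)).
      \<forall>(h, z) \<in> set (interaction (A r) (noisy_mean n k a b \<omega> x) k). \<bar>z - query_mean n \<mu> h\<bar> \<le> \<alpha>'}"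
    by (rule accuracy_event[OF \<rho> _ round_bound[OF t \<alpha> refl tail \<eta>0 _ \<psi>', unfolded c]])
      (use \<beta> in auto)
  then show "1 - \<beta> \<le> measure (\<rho> \<Otimes>\<^sub>M (\<mu> \<Otimes>\<^sub>M tape_space))
    {(r, x, \<omega>) \<in> space (\<rho> \<Otimes>\<^sub>M (\<mu> \<Otimes>\<^sub>M tape_space)).
      \<forall>(h, z) \<in> set (interaction (A r) (noisy_mean n k a b \<omega> x) k). \<bar>z - query_mean n \<mu> h\<bar> \<le> \<alpha>'}"
    using k by simp
qed

text \<open>As \<beta> \<le> 1/2, ln (1 / \<beta>) is bounded below, so g controls sqrt k /
  \<alpha>^2, and ln 72, ln k and ln (1 / \<alpha>) are all of order ln (2 + g). The remaining
  summand ln (1 / \<beta>) is absorbed by turning the sum into a product, both factors being at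
  least 1/2.\<close>

lemma sample_bound_le:
  fixes k :: nat and \<alpha> \<beta> :: real
  assumes k: "1 \<le> k" and \<alpha>: "0 < \<alpha>" "\<alpha> < 1" and \<beta>: "0 < \<beta>" "\<beta> \<le> 1 / 2"
  defines "g \<equiv> sqrt (real k) / \<alpha>\<^sup>2 * ln (1 / \<beta>)"
  shows "0 \<le> sample_bound k \<alpha> \<beta>" and "sample_bound k \<alpha> \<beta> \<le> 5000 * 30 * (g * ln (2 + g))"
proof -
  define \<Lambda> where "\<Lambda> = ln (1 / \<beta>)"
  have half: "1 / 2 \<le> ln (2::real)" using ln_le_minus_one[of "1 / 2 :: real"] by (simp add: ln_div)
  have "ln 2 \<le> \<Lambda>" unfolding \<Lambda>_def using \<beta> by (subst ln_le_cancel_iff) (auto simp: field_simps)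
  then have \<Lambda>: "1 / 2 \<le> \<Lambda>" using half by linarith
  have sk: "1 \<le> sqrt k" using k by simp
  have ia: "1 \<le> 1 / \<alpha>\<^sup>2" using \<alpha> by (simp add: power_le_one)
  have g_lower: "sqrt k / \<alpha>\<^sup>2 \<le> 2 * g"
  proof -
    have "sqrt k / \<alpha>\<^sup>2 * (1 / 2) \<le> sqrt k / \<alpha>\<^sup>2 * \<Lambda>" by (rule mult_left_mono[OF \<Lambda>]) simp
    then show ?thesis by (simp add: g_def \<Lambda>_def)
  qed
  have g0: "0 \<le> g" using g_lower by (rule order_trans[rotated, THEN mult_left_le_imp_le[of 2]]) auto
  define G where "G = ln (2 + g)"
  have G2: "ln 2 \<le> G" unfolding G_def using g0 by (subst ln_le_cancel_iff) auto
  have upper: "ln y \<le> 2 * G" if "0 < y" "y \<le> 2 * g" for y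
  proof -
    have "ln y \<le> ln (2 * (2 + g))" using that g0 by (subst ln_le_cancel_iff) auto
    also have "\<dots> = ln 2 + G" unfolding G_def using g0 by (subst ln_mult) auto
    finally show ?thesis using G2 by linarith
  qed
  have lnk: "ln k \<le> 4 * G"
  proof -
    have "sqrt k * 1 \<le> sqrt k * (1 / \<alpha>\<^sup>2)" using ia by (intro mult_left_mono) auto
    then have "ln (sqrt k) \<le> 2 * G" using g_lower sk by (intro upper) auto
    then show ?thesis using k by (simp add: ln_sqrt)
  qed
  have lna: "ln (1 / \<alpha>) \<le> 2 * G"
  proof -
    have "1 / \<alpha> \<le> 1 / \<alpha>\<^sup>2" using \<alpha> by (simp add: field_simps power2_eq_square)
    also have "\<dots> \<le> sqrt k / \<alpha>\<^sup>2" using sk by (intro divide_right_mono) auto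
    finally show ?thesis using g_lower \<alpha> by (intro upper) auto
  qed
  have ln72: "ln (72::real) \<le> 7 * G"
  proof -
    have "ln (72::real) \<le> ln (2 ^ 7)" by (subst ln_le_cancel_iff) auto
    also have "\<dots> = 7 * ln 2" by (subst ln_realpow) auto
    finally show ?thesis using G2 by linarith
  qed
  have "ln (72 * k / (\<alpha> * \<beta>)) = ln 72 + ln k + ln (1 / \<alpha>) + \<Lambda>"
    using k \<alpha> \<beta> by (simp add: \<Lambda>_def ln_mult ln_div)
  also have "\<dots> \<le> 13 * G + \<Lambda>" using lnk lna ln72 by linarith
  also have "\<dots> \<le> 30 * (\<Lambda> * G)"
  proof -
    have "G * 1 \<le> G * (2 * \<Lambda>)" "\<Lambda> * 1 \<le> \<Lambda> * (2 * G)"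
      using \<Lambda> G2 half by (intro mult_left_mono; simp)+
    moreover have "0 \<le> \<Lambda> * G" using \<Lambda> G2 half by (intro mult_nonneg_nonneg) auto
    moreover have "G * (2 * \<Lambda>) = 2 * (\<Lambda> * G)" "\<Lambda> * (2 * G) = 2 * (\<Lambda> * G)" by simp_all
    ultimately show ?thesis by linarith
  qed
  finally have ln_le: "ln (72 * k / (\<alpha> * \<beta>)) \<le> 30 * (\<Lambda> * G)" .
  have "1 \<le> 72 * k / (\<alpha> * \<beta>)"
  proof -
    have "\<alpha> * \<beta> \<le> 1 * 1" using \<alpha> \<beta> by (intro mult_mono) auto
    then have "\<alpha> * \<beta> \<le> 72 * k" using k by simp
    then show ?thesis using \<alpha> \<beta> by simp
  qed
  then show "0 \<le> sample_bound k \<alpha> \<beta>" by (simp add: sample_bound_def)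
  have "sample_bound k \<alpha> \<beta> = 5000 * (sqrt k / \<alpha>\<^sup>2) * ln (72 * k / (\<alpha> * \<beta>))"
    by (simp add: sample_bound_def)
  also have "\<dots> \<le> 5000 * (sqrt k / \<alpha>\<^sup>2) * (30 * (\<Lambda> * G))"
    by (intro mult_left_mono ln_le) auto
  also have "\<dots> = 5000 * 30 * (g * ln (2 + g))"
    by (simp add: g_def \<Lambda>_def G_def)
  finally show "sample_bound k \<alpha> \<beta> \<le> 5000 * 30 * (g * ln (2 + g))" .
qed

lemma sample_bound_soft_bigo:
  "(\<lambda>(k, \<alpha>, \<beta>). sample_bound k (min \<alpha> 1) \<beta>)
    \<in> soft_bigo parameter_regime (\<lambda>(k, \<alpha>, \<beta>). sqrt (real k) / \<alpha>\<^sup>2 * ln (1 / \<beta>))"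
  unfolding soft_bigo_def
\<comment> \<open>A single logarithmic factor is enough.\<close>
proof (rule UN_I[of 1])
  show "(\<lambda>(k, \<alpha>, \<beta>). sample_bound k (min \<alpha> 1) \<beta>) \<in> O[parameter_regime](\<lambda>x.
      (case x of (k, \<alpha>, \<beta>) \<Rightarrow> sqrt (real k) / \<alpha>\<^sup>2 * ln (1 / \<beta>)) *
      ln (2 + \<bar>case x of (k, \<alpha>, \<beta>) \<Rightarrow> sqrt (real k) / \<alpha>\<^sup>2 * ln (1 / \<beta>)\<bar>) ^ 1)"
  proof (rule bigoI[of _ "5000 * 30"], unfold parameter_regime_def eventually_principal, rule ballI)
    fix x :: "nat \<times> real \<times> real"
    assume x: "x \<in> {(k, \<alpha>, \<beta>). 1 \<le> k \<and> 0 < \<alpha> \<and> \<alpha> < 1 \<and> 0 < \<beta> \<and> \<beta> \<le> 1 / 2}"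
    obtain k \<alpha> \<beta> where x_eq: "x = (k, \<alpha>, \<beta>)" by (cases x)
    define g where "g = sqrt (real k) / \<alpha>\<^sup>2 * ln (1 / \<beta>)"
    have g: "0 \<le> g" unfolding g_def using x x_eq by (intro mult_nonneg_nonneg) auto
    have "\<bar>sample_bound k \<alpha> \<beta>\<bar> \<le> 5000 * 30 * (g * ln (2 + g))"
      using sample_bound_le[of k \<alpha> \<beta>] x x_eq unfolding g_def by simp
    moreover have "0 \<le> g * ln (2 + g)" using g by simp
    ultimately show "norm (case x of (k, \<alpha>, \<beta>) \<Rightarrow> sample_bound k (min \<alpha> 1) \<beta>) \<le> 5000 * 30 *
        norm ((case x of (k, \<alpha>, \<beta>) \<Rightarrow> sqrt (real k) / \<alpha>\<^sup>2 * ln (1 / \<beta>)) *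
          ln (2 + \<bar>case x of (k, \<alpha>, \<beta>) \<Rightarrow> sqrt (real k) / \<alpha>\<^sup>2 * ln (1 / \<beta>)\<bar>) ^ 1)"
      using g x unfolding x_eq prod.case g_def[symmetric] by simp
  qed
qed simp

theorem corollary1p6:
  shows "\<exists>(M :: nat \<Rightarrow> nat \<Rightarrow> real \<Rightarrow> real \<Rightarrow> 'a::metric_space mechanism)
           (N :: nat \<times> real \<times> real \<Rightarrow> real).
     computationally_efficient M \<and>
     N \<in> soft_bigo parameter_regime (\<lambda>(k, \<alpha>, \<beta>). sqrt (real k) / \<alpha>\<^sup>2 * ln (1 / \<beta>)) \<and>
     (\<forall>(n::nat) (k::nat) (\<alpha>::real) (\<beta>::real) (\<psi>::real).
        1 \<le> n \<longrightarrow> 1 \<le> k \<longrightarrow> 0 < \<alpha> \<longrightarrow> 0 < \<beta> \<longrightarrow> \<beta> < 1 \<longrightarrow> N (k, \<alpha>, \<beta>) \<le> real n \<longrightarrow>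
        statistically_accurate n k \<psi> (\<alpha> + 2 * \<psi>) \<beta> (M n k \<alpha> \<beta>))"
proof (intro exI conjI)
  show "computationally_efficient (noisy_mean :: nat \<Rightarrow> nat \<Rightarrow> real \<Rightarrow> real \<Rightarrow> 'a mechanism)"
    by (rule noisy_mean_efficient)
  \<comment> \<open>For \<alpha> above 1 the stronger accuracy with 1 in place of \<alpha> is
    proved, as the analysis works with \<alpha> \<le> 1. On the parameter regime the minimum equals
    \<alpha>.\<close>
  show "(\<lambda>(k, \<alpha>, \<beta>). sample_bound k (min \<alpha> 1) \<beta>)
      \<in> soft_bigo parameter_regime (\<lambda>(k, \<alpha>, \<beta>). sqrt (real k) / \<alpha>\<^sup>2 * ln (1 / \<beta>))"
    by (rule sample_bound_soft_bigo)
  show "\<forall>(n::nat) (k::nat) (\<alpha>::real) (\<beta>::real) (\<psi>::real).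
        1 \<le> n \<longrightarrow> 1 \<le> k \<longrightarrow> 0 < \<alpha> \<longrightarrow> 0 < \<beta> \<longrightarrow> \<beta> < 1 \<longrightarrow>
        (\<lambda>(k, \<alpha>, \<beta>). sample_bound k (min \<alpha> 1) \<beta>) (k, \<alpha>, \<beta>) \<le> real n \<longrightarrow>
        statistically_accurate n k \<psi> (\<alpha> + 2 * \<psi>) \<beta> (noisy_mean n k \<alpha> \<beta> :: 'a mechanism)"
  proof (intro allI impI)
    fix n k :: nat and \<alpha> \<beta> \<psi> :: real
    assume "1 \<le> n" "1 \<le> k" "0 < \<alpha>" "0 < \<beta>" "\<beta> < 1"
      and "(\<lambda>(k, \<alpha>, \<beta>). sample_bound k (min \<alpha> 1) \<beta>) (k, \<alpha>, \<beta>) \<le> real n"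
    then show "statistically_accurate n k \<psi> (\<alpha> + 2 * \<psi>) \<beta> (noisy_mean n k \<alpha> \<beta> :: 'a mechanism)"
      by (intro noisy_mean_accurate[of n k "min \<alpha> 1"]) auto
  qed
qed

end
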